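(* Let $f$ be a nonzero holomorphic quasimodular form for $\mathrm{SL}_2(\mathbb Z)$. Then there exist finitely many pairwise disjoint intervals $I$ forming a collection $\mathscr I$ with $\mathbb R=\bigcup_{I\in\mathscr I}I$, and for each $I\in\mathscr I$ a constant $N_I(f)\in\tfrac16\mathbb Z$, such that $N_\lambda(f)=N_I(f)$ for every $\lambda\in\mathbb Q\cap I$.
   Context: Let $\mathfrak{h}$ be the complex upper half plane, $q=e^{2\pi i\tau}$, $\rho=-\tfrac12+\tfrac{\sqrt3}{2}i$, and $E_2(\tau)=1-24\sum_{m,r\ge1}mq^{mr}$. A (holomorphic) quasimodular form of weight $k$ and depth $\le p$ for $\mathrm{SL}_2(\mathbb Z)$ is $f=\sum_{j=0}^pf_jE_2^j$ with $f_j$ holomorphic modular forms of weight $k-2j$. Let $\mathfrak d$ be the derivation on quasimodular forms with $\mathfrak dE_2=12$ annihilating modular forms. Standard fundamental domain: $\mathcal{F}=\{z\in\mathfrak h: |z|>1,|\mathrm{Re} z|<\tfrac12\}\cup\{z\in\mathfrak h:|z|\ge1,-\tfrac12\le \mathrm{Re} z\le 0\}\cup\{\infty\}$. For $\tau\in\mathfrak h\cup\mathbb P^1(\mathbb Q)$, $e_\tau$ is the order of the stabilizer of $\tau$ in $\mathrm{PSL}_2(\mathbb Z)$ ($3$ for translates of $\rho$, $2$ for translates of $i$, $1$ otherwise). Order of vanishing: for $\tau_0\in\mathfrak h$, $v_{\tau_0}(f)$ is the usual order of vanishing. For a cusp $\tau_0=-d/c$ (for $\tau_0=\infty$ take $c=0,d=1$),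 choose $a,b$ with $\left(\begin{smallmatrix}a&b\\c&d\end{smallmatrix}\right)\in\mathrm{SL}_2(\mathbb Z)$; then $(c\tau+d)^kf(\tau)=\sum_{n\ge0}a_n(\tau)\exp\!\big(2\pi i n\tfrac{a\tau+b}{c\tau+d}\big)$ with $a_n(\tau)=\sum_{j=0}^p\frac{a_{n,j}}{j!}\big(\frac{-c(c\tau+d)}{2\pi i}\big)^j$, $a_{n,j}$ the $n$-th Fourier coefficient of $\mathfrak d^jf$; $v_{\tau_0}(f)$ is the least $n$ with $a_n\not\equiv0$. For $\lambda\in\mathbb P^1(\mathbb Q)$ pick $\gamma=\left(\begin{smallmatrix}a&b\\c&d\end{smallmatrix}\right)\in\mathrm{SL}_2(\mathbb Z)$ with $\lambda=-d/c$ and set $N_\lambda(f)=\sum_{\tau\in\gamma\mathcal F}v_\tau(f)/e_\tau$ (independent of the choice of $\gamma$). *)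

theory Defs
  imports "HOL-Complex_Analysis.Complex_Analysis"
begin

definition upper_half :: "complex set" where
  "upper_half = {z. Im z > 0}"

definition SL2Z :: "(int^2^2) set" where
  "SL2Z = {A. det A = 1}"

definition qpar :: "complex \<Rightarrow> complex" where
  "qpar \<tau> = exp (2 * of_real pi * \<i> * \<tau>)"

definition moebius :: "int^2^2 \<Rightarrow> complex \<Rightarrow> complex" where
  "moebius A \<tau> = (of_int (A$1$1) * \<tau> + of_int (A$1$2)) / (of_int (A$2$1) * \<tau> + of_int (A$2$2))"

text \<open>
  Functions on the upper half plane are total functions on the complex numbers whose
  values outside the upper half plane are irrelevant. A sequence is the sequence of
  Fourier coefficients of \<open>f\<close> if the expansion (with nonnegative exponents only)
  represents \<open>f\<close> on the whole upper half plane.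
\<close>

definition has_fourier_expansion :: "(complex \<Rightarrow> complex) \<Rightarrow> (nat \<Rightarrow> complex) \<Rightarrow> bool" where
  "has_fourier_expansion f a \<longleftrightarrow> (\<forall>\<tau>\<in>upper_half. (\<lambda>n. a n * qpar \<tau> ^ n) sums f \<tau>)"

definition fourier_coeff :: "(complex \<Rightarrow> complex) \<Rightarrow> nat \<Rightarrow> complex" where
  "fourier_coeff f = (THE a. has_fourier_expansion f a)"

definition modular_form :: "int \<Rightarrow> (complex \<Rightarrow> complex) \<Rightarrow> bool" where
  "modular_form k f \<longleftrightarrow>
     f holomorphic_on upper_half \<and>
     (\<forall>A\<in>SL2Z. \<forall>\<tau>\<in>upper_half.
        f (moebius A \<tau>) = (of_int (A$2$1) * \<tau> + of_int (A$2$2)) powi k * f \<tau>) \<and>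
     (\<exists>a. has_fourier_expansion f a)"

definition E2 :: "complex \<Rightarrow> complex" where
  "E2 \<tau> = 1 - 24 * (\<Sum>\<^sub>\<infinity>(m, r)\<in>{1::nat..} \<times> {1::nat..}. of_nat m * qpar \<tau> ^ (m * r))"

definition quasimodular_decomp ::
  "int \<Rightarrow> nat \<Rightarrow> (nat \<Rightarrow> complex \<Rightarrow> complex) \<Rightarrow> (complex \<Rightarrow> complex) \<Rightarrow> bool" where
  "quasimodular_decomp k p g f \<longleftrightarrow>
     (\<forall>j\<le>p. modular_form (k - 2 * int j) (g j)) \<and>
     (\<forall>\<tau>\<in>upper_half. f \<tau> = (\<Sum>j\<le>p. g j \<tau> * E2 \<tau> ^ j))"

definition quasimodular_form :: "int \<Rightarrow> nat \<Rightarrow> (complex \<Rightarrow> complex) \<Rightarrow> bool" where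
  "quasimodular_form k p f \<longleftrightarrow> (\<exists>g. quasimodular_decomp k p g f)"

text \<open>
  The derivation that annihilates modular forms and sends \<open>E2\<close> to 12. Its value on the upper
  half plane does not depend on the decomposition chosen, because \<open>E2\<close> is algebraically
  independent over the ring of modular forms and the weight of a nonzero form is unique.
\<close>

definition qm_derivation :: "(complex \<Rightarrow> complex) \<Rightarrow> complex \<Rightarrow> complex" where
  "qm_derivation f =
     (let (k, p, g) = (SOME (k, p, g). quasimodular_decomp k p g f)
      in (\<lambda>\<tau>. \<Sum>j=1..p. g j \<tau> * (of_nat j * E2 \<tau> ^ (j - 1) * 12)))"

definition qm_depth :: "(complex \<Rightarrow> complex) \<Rightarrow> nat" where
  "qm_depth f = (LEAST p. \<exists>k. quasimodular_form k p f)"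

text \<open>
  The rational projective line, with \<open>None\<close> for infinity; \<open>proj x y\<close> is the
  point \<open>x / y\<close>, and \<open>homog\<close> gives coprime homogeneous coordinates.
\<close>

type_synonym proj_rat = "rat option"

definition proj :: "int \<Rightarrow> int \<Rightarrow> proj_rat" where
  "proj x y = (if y = 0 then None else Some (Fract x y))"

fun homog :: "proj_rat \<Rightarrow> int \<times> int" where
  "homog None = (1, 0)"
| "homog (Some r) = quotient_of r"

datatype ext_point = Inner complex | Cusp proj_rat

fun act :: "int^2^2 \<Rightarrow> ext_point \<Rightarrow> ext_point" where
  "act A (Inner \<tau>) = Inner (moebius A \<tau>)"
| "act A (Cusp l) =
     (let (x, y) = homog l
      in Cusp (proj (A$1$1 * x + A$1$2 * y) (A$2$1 * x + A$2$2 * y)))"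

text \<open>
  The coefficient of \<open>exp (2 \<pi> i n (a \<tau> + b) / (c \<tau> + d))\<close> in the expansion of
  \<open>(c \<tau> + d)^k f(\<tau>)\<close>. It does not involve \<open>a\<close> and \<open>b\<close> and is unchanged
  when \<open>(c, d)\<close> is replaced by \<open>(-c, -d)\<close>.
\<close>

definition cusp_coeff :: "(complex \<Rightarrow> complex) \<Rightarrow> int \<Rightarrow> int \<Rightarrow> nat \<Rightarrow> complex \<Rightarrow> complex" where
  "cusp_coeff f c d n \<tau> =
     (\<Sum>j\<le>qm_depth f. fourier_coeff ((qm_derivation ^^ j) f) n / fact j *
        (- of_int c * (of_int c * \<tau> + of_int d) / (2 * of_real pi * \<i>)) ^ j)"

text \<open>The cusp \<open>x / y\<close> is \<open>-d / c\<close> for \<open>c = -y\<close> and \<open>d = x\<close>.\<close>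

fun vanishing_order :: "(complex \<Rightarrow> complex) \<Rightarrow> ext_point \<Rightarrow> int" where
  "vanishing_order f (Inner \<tau>) = zorder f \<tau>"
| "vanishing_order f (Cusp l) =
     (let (x, y) = homog l
      in int (LEAST n. \<exists>\<tau>\<in>upper_half. cusp_coeff f (- y) x n \<tau> \<noteq> 0))"

text \<open>
  The order of the stabilizer in PSL(2,Z), whose elements are the classes \<open>{A, -A}\<close>.
  Cusps, whose stabilizer is infinite, are given the value 1 by convention.
\<close>

fun stab_order :: "ext_point \<Rightarrow> nat" where
  "stab_order (Inner \<tau>) = card ((\<lambda>A. {A, - A}) ` {A\<in>SL2Z. moebius A \<tau> = \<tau>})"
| "stab_order (Cusp l) = 1"

definition fundamental_domain :: "ext_point set" where
  "fundamental_domain =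
     Inner ` {z\<in>upper_half. norm z > 1 \<and> \<bar>Re z\<bar> < 1/2} \<union>
     Inner ` {z\<in>upper_half. norm z \<ge> 1 \<and> - 1/2 \<le> Re z \<and> Re z \<le> 0} \<union>
     {Cusp None}"

text \<open>
  For a nonzero quasimodular form only finitely many terms of the sum are nonzero, and the sum
  depends on \<open>A\<close> only through \<open>-d / c\<close>, so that the choice of \<open>A\<close> below is immaterial.
\<close>

definition zero_count_translate :: "(complex \<Rightarrow> complex) \<Rightarrow> int^2^2 \<Rightarrow> real" where
  "zero_count_translate f A =
     (\<Sum>\<^sub>\<infinity>\<tau>\<in>act A ` fundamental_domain. of_int (vanishing_order f \<tau>) / of_nat (stab_order \<tau>))"

definition zero_count :: "(complex \<Rightarrow> complex) \<Rightarrow> proj_rat \<Rightarrow> real" where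
  "zero_count f l =
     zero_count_translate f (SOME A. A \<in> SL2Z \<and> l = proj (- (A$2$2)) (A$2$1))"

end

theory Submission
  imports Defs "Subresultants.Subresultant_Gcd" "HOL-Computational_Algebra.Field_as_Ring"
    "HOL-Computational_Algebra.Fundamental_Theorem_Algebra"
begin

text \<open>
  Write \<open>f = \<Sum> g\<^sub>j E\<^sub>2\<^sup>j\<close>. The transformation law of \<open>E\<^sub>2\<close> turns the zeros of \<open>f\<close> in \<open>\<gamma>F\<close>,
  with \<open>\<lambda> = - d / c\<close>, into the zeros in \<open>F\<close> of
  \<open>R(z, \<lambda>) = \<Sum> g\<^sub>j(z) (E\<^sub>2(z) (z - \<lambda>) + \<kappa>)\<^sup>j (z - \<lambda>)\<^sup>p\<^sup>-\<^sup>j\<close> with \<open>\<kappa> = 6 / (\<pi>i)\<close>, a polynomial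
  in \<open>\<lambda>\<close>, while the order of vanishing at the cusp \<open>\<gamma>\<infinity>\<close> does not depend on \<open>\<gamma>\<close>. By Rouche's
  theorem the weighted number of zeros is locally constant in the real variable \<open>\<lambda>\<close> unless a zero
  crosses the boundary of \<open>F\<close>. A boundary point \<open>z\<close> for which \<open>R(z, \<cdot>)\<close> has a real root is a zero of
  the resultant of \<open>R(z, \<cdot>)\<close> with its complex conjugate, and along each boundary arc this resultant
  is the restriction of a holomorphic function. That function is not identically zero:
  at \<open>z + n\<close> with \<open>n\<close> large the two polynomials have no common root. So only finitely many boundary
  points can be crossed, and for each of them only finitely many \<open>\<lambda>\<close> matter (common zeros of
  all \<open>g\<^sub>j\<close> stay in place with a generically constant order).
\<close>

section \<open>The transformation law of \<open>E\<^sub>2\<close>\<close>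

text \<open>Only rational lambda come from matrices, but R(z, lambda) and its weighted zero count
  make sense for every real lambda; this is what allows a continuity argument. The weights are 1
  inside F, 1 / e on one half of its boundary and 0 on the other half, so inside F zeros may merge
  or split freely. Besides crossing the boundary, a zero could only disturb the count by escaping to
  i infinity; for bounded lambda this is excluded because q = exp (2 pi i z) is small against every
  power of z - lambda. The resultant is taken in formal degree, with a Sylvester matrix of fixed
  size, because the leading coefficient of R(z, .) is f(z) up to sign and has zeros of its own:
  there a root moves to infinity. The constant kappa = 12 / (2 pi i) measures how far the lattice
  sum of 1 / (r tau + n)^2 depends on the order of summation. Sixths occur because points of F have
  stabilizers of order at most 3.\<close>

lemma sum_int_symmetric:
  fixes f :: "int \<Rightarrow> 'a::comm_monoid_add"
  shows "sum f {- int N..<int N} = (\<Sum>n<N. f (int n) + f (- int n - 1))"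
proof (induction N)
  case (Suc N)
  have "{- int (Suc N)..<int (Suc N)} = insert (- int N - 1) (insert (int N) {- int N..<int N})"
    by auto
  then show ?case using Suc by (simp add: add_ac)
qed auto

lemma infsum_int_LIMSEQ:
  fixes f :: "int \<Rightarrow> 'a::{topological_comm_monoid_add,t2_space}"
  assumes "f summable_on UNIV"
  shows "(\<lambda>N. sum f {- int N..<int N}) \<longlonglongrightarrow> infsum f UNIV"
proof -
  have *: "filterlim (\<lambda>N. {- int N..<int N}) (finite_subsets_at_top UNIV) sequentially"
    unfolding filterlim_finite_subsets_at_top
  proof (intro allI impI)
    fix X :: "int set" assume X: "finite X \<and> X \<subseteq> UNIV"
    obtain M where M: "\<And>x. x \<in> X \<Longrightarrow> \<bar>x\<bar> \<le> M"
      using X finite_imageI[of X abs] by (meson Max_ge imageI)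
    show "\<forall>\<^sub>F N in sequentially. finite {- int N..<int N} \<and> X \<subseteq> {- int N..<int N} \<and> {- int N..<int N} \<subseteq> UNIV"
      using eventually_gt_at_top[of "nat M"]
    proof eventually_elim
      case (elim N)
      then have "\<bar>x\<bar> < int N" if "x \<in> X" for x using M[OF that] by linarith
      then show ?case by (fastforce simp: abs_less_iff)
    qed
  qed
  from has_sum_infsum[OF assms] show ?thesis
    unfolding has_sum_def using * by (rule filterlim_compose)
qed

section \<open>Partial fractions of the cotangent from the reflection formula of Gamma\<close>

lemma nonpos_Ints_reflect:
  fixes z :: complex
  assumes "z \<notin> \<int>"
  shows "z \<notin> \<int>\<^sub>\<le>\<^sub>0" "1 - z \<notin> \<int>\<^sub>\<le>\<^sub>0"
proof -
  show "z \<notin> \<int>\<^sub>\<le>\<^sub>0" using assms nonpos_Ints_Int by blast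
  show "1 - z \<notin> \<int>\<^sub>\<le>\<^sub>0"
  proof
    assume "1 - z \<in> \<int>\<^sub>\<le>\<^sub>0"
    then have "1 - (1 - z) \<in> \<int>" by (intro Ints_diff Ints_1 nonpos_Ints_Int)
    then show False using assms by simp
  qed
qed

text \<open>Reads the Gamma reflection formula with x / 0 = 0: a zero of the sine would make a
  product of two Gamma values vanish, but Gamma takes the value 0 only at its poles, by
  convention.\<close>

lemma sin_pi_mult_nonzero:
  fixes z :: complex
  assumes "z \<notin> \<int>"
  shows "sin (of_real pi * z) \<noteq> 0"
proof
  assume "sin (of_real pi * z) = 0"
  then have "Gamma z * Gamma (1 - z) = 0" by (simp add: Gamma_reflection_complex)
  then show False using nonpos_Ints_reflect[OF assms] by (auto simp: Gamma_eq_zero_iff)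
qed

text \<open>Logarithmic derivative of the reflection formula Gamma z Gamma (1 - z) = pi / sin (pi
  z).\<close>

lemma Digamma_reflection_complex:
  fixes z :: complex
  assumes "z \<notin> \<int>"
  shows "Digamma (1 - z) - Digamma z = of_real pi * cot (of_real pi * z)"
proof -
  let ?s = "sin (of_real pi * z)"
  have s: "?s \<noteq> 0" by (rule sin_pi_mult_nonzero[OF assms])
  have "((\<lambda>z. Gamma z * Gamma (1 - z)) has_field_derivative
      Gamma z * Gamma (1 - z) * (Digamma z - Digamma (1 - z))) (at z)"
    using nonpos_Ints_reflect[OF assms]
    by (auto intro!: derivative_eq_intros simp: algebra_simps)
  moreover have "((\<lambda>z. of_real pi / sin (of_real pi * z)) has_field_derivative
      - (of_real pi * (of_real pi * cos (of_real pi * z)) / ?s^2)) (at z)"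
    using s by (auto intro!: derivative_eq_intros simp: power2_eq_square)
  ultimately have "Gamma z * Gamma (1 - z) * (Digamma z - Digamma (1 - z)) =
      - (of_real pi * (of_real pi * cos (of_real pi * z)) / ?s^2)"
    unfolding Gamma_reflection_complex by (rule DERIV_unique)
  then have eq: "of_real pi / ?s * (Digamma z - Digamma (1 - z)) =
      - (of_real pi * (of_real pi * cos (of_real pi * z)) / ?s^2)"
    unfolding Gamma_reflection_complex .
  have "of_real pi / ?s * (Digamma (1 - z) - Digamma z) =
      - (of_real pi / ?s * (Digamma z - Digamma (1 - z)))"
    by (simp only: mult_minus_right[symmetric] minus_diff_eq)
  also have "\<dots> = of_real pi / ?s * (of_real pi * cot (of_real pi * z))"
    unfolding eq by (simp add: cot_def power2_eq_square)
  finally show ?thesis using s by (subst (asm) mult_left_cancel) auto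
qed

text \<open>Difference of the limit formulas for Digamma at z and at 1 - z, in which the logarithms
  cancel. The half-open range makes -n - 1 the partner of n, and its term 1 / (z - n - 1) is -1 / (1
  - z + n).\<close>

lemma cot_partial_fractions:
  fixes z :: complex
  assumes "z \<notin> \<int>"
  shows "(\<lambda>N. \<Sum>r\<in>{- int N..<int N}. 1 / (z + of_int r)) \<longlonglongrightarrow> of_real pi * cot (of_real pi * z)"
proof -
  have "z \<noteq> 0" "1 - z \<noteq> 0" using assms by auto
  then have "(\<lambda>m. (of_real (ln (real m)) - (\<Sum>n<m. inverse (1 - z + of_nat n))) -
      (of_real (ln (real m)) - (\<Sum>n<m. inverse (z + of_nat n)))) \<longlonglongrightarrow> Digamma (1 - z) - Digamma z"
    by (intro tendsto_diff Digamma_LIMSEQ)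
  also have "(\<lambda>m. (of_real (ln (real m)) - (\<Sum>n<m. inverse (1 - z + of_nat n))) -
      (of_real (ln (real m)) - (\<Sum>n<m. inverse (z + of_nat n)))) =
      (\<lambda>N. \<Sum>r\<in>{- int N..<int N}. 1 / (z + of_int r))"
  proof
    fix m
    have "1 / (z + of_int (- int n - 1)) = - inverse (1 - z + of_nat n)" for n
      using minus_divide_right[of 1 "1 - z + of_nat n"] by (simp add: divide_inverse algebra_simps)
    then show "(of_real (ln (real m)) - (\<Sum>n<m. inverse (1 - z + of_nat n))) -
      (of_real (ln (real m)) - (\<Sum>n<m. inverse (z + of_nat n))) =
      (\<Sum>r\<in>{- int m..<int m}. 1 / (z + of_int r))"
      unfolding sum_int_symmetric sum.distrib
      by (simp add: sum_negf inverse_eq_divide)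
  qed
  finally show ?thesis unfolding Digamma_reflection_complex[OF assms] .
qed

text \<open>Derivative of the Digamma reflection formula, with the series of Polygamma 1 on one
  side.\<close>

lemma inverse_sin_squared_sums:
  fixes z :: complex
  assumes "z \<notin> \<int>"
  shows "(\<lambda>n. 1 / (z + of_nat n)^2 + 1 / (1 - z + of_nat n)^2) sums
    (of_real pi^2 / sin (of_real pi * z)^2)"
proof -
  have "((\<lambda>z. Digamma (1 - z) - Digamma z) has_field_derivative
      - Polygamma 1 (1 - z) - Polygamma 1 z) (at z)"
    using nonpos_Ints_reflect[OF assms] by (auto intro!: derivative_eq_intros)
  then have "((\<lambda>z. of_real pi * cot (of_real pi * z)) has_field_derivative
      - Polygamma 1 (1 - z) - Polygamma 1 z) (at z)"
    by (rule has_field_derivative_transform_within_open[where S = "- \<int>"])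
       (use assms in \<open>auto simp: Digamma_reflection_complex\<close>)
  moreover have "((\<lambda>z. of_real pi * cot (of_real pi * z)) has_field_derivative
      of_real pi * (- inverse (sin (of_real pi * z)^2) * of_real pi)) (at z)"
    by (intro DERIV_cmult DERIV_chain2[OF DERIV_cot] sin_pi_mult_nonzero assms)
       (auto intro!: derivative_eq_intros)
  ultimately have eq: "- Polygamma 1 (1 - z) - Polygamma 1 z =
      of_real pi * (- inverse (sin (of_real pi * z)^2) * of_real pi)"
    by (rule DERIV_unique)
  have "z \<noteq> 0" "1 - z \<noteq> 0" using assms by auto
  then have "(\<lambda>n. 1 / (z + of_nat n)^2 + 1 / (1 - z + of_nat n)^2) sums
      (Polygamma 1 z + Polygamma 1 (1 - z))"
    using sums_add[OF Polygamma_LIMSEQ[of z 1] Polygamma_LIMSEQ[of "1 - z" 1]]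
    by (simp add: inverse_eq_divide numeral_2_eq_2)
  also have "Polygamma 1 z + Polygamma 1 (1 - z) = of_real pi^2 / sin (of_real pi * z)^2"
    using arg_cong[OF eq, of uminus] by (simp add: divide_inverse power2_eq_square mult_ac add_ac)
  finally show ?thesis .
qed

section \<open>Summing over the lattice Z tau + Z in both orders\<close>

lemma lattice_bound:
  assumes "Im \<tau> > 0"
  obtains K where "K > 0"
    "\<And>r n. norm (1 / (of_int r * \<tau> + of_int n)) \<le> K / (1 + \<bar>real_of_int r\<bar> + \<bar>real_of_int n\<bar>)"
proof -
  \<comment> \<open>The imaginary part of x controls r, and then n = x - r tau controls n, so |r| +
    |n| is at most D |x|. The extra 1 in the denominator costs a factor 2, as |r| + |n| >= 1 off the
    origin.\<close>
  define D where "D = 1 / Im \<tau> + 1 + norm \<tau> / Im \<tau>"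
  have D: "D > 0" unfolding D_def using assms by (auto intro!: add_pos_nonneg)
  have "norm (1 / (of_int r * \<tau> + of_int n)) \<le> 2 * D / (1 + \<bar>real_of_int r\<bar> + \<bar>real_of_int n\<bar>)" for r n
  proof (cases "r = 0 \<and> n = 0")
    case True
    then show ?thesis using D by auto
  next
    case False
    let ?x = "of_int r * \<tau> + of_int n"
    have "\<bar>real_of_int r\<bar> * Im \<tau> = \<bar>Im ?x\<bar>" using assms by (simp add: abs_mult)
    also have "\<dots> \<le> norm ?x" by (rule abs_Im_le_cmod)
    finally have r: "\<bar>real_of_int r\<bar> \<le> norm ?x / Im \<tau>" using assms by (simp add: field_simps)
    have "of_int n = ?x - of_int r * \<tau>" by simp
    then have "\<bar>real_of_int n\<bar> \<le> norm ?x + \<bar>real_of_int r\<bar> * norm \<tau>"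
      by (metis norm_mult norm_of_int norm_triangle_ineq4)
    also have "\<dots> \<le> norm ?x + norm ?x / Im \<tau> * norm \<tau>"
      using r by (intro add_left_mono mult_right_mono) auto
    finally have le: "\<bar>real_of_int r\<bar> + \<bar>real_of_int n\<bar> \<le> D * norm ?x"
      using r unfolding D_def by (simp add: algebra_simps)
    have one: "1 \<le> \<bar>real_of_int r\<bar> + \<bar>real_of_int n\<bar>" using False by linarith
    have "0 < D * norm ?x" using le one by linarith
    then have x: "norm ?x > 0" using D by (simp add: zero_less_mult_iff)
    have "1 + \<bar>real_of_int r\<bar> + \<bar>real_of_int n\<bar> \<le> 2 * D * norm ?x" using le one by linarith
    then show ?thesis using x by (simp add: norm_divide field_simps)
  qed
  with D show ?thesis using that[of "2 * D"] by simp
qed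

text \<open>The exponent 3/2 is half of 3 and larger than 1: cubic decay on the lattice is bounded
  by a product of two such summable weights, and quadratic decay along a single row or column by one
  of them.\<close>

lemma summable_on_int_powr:
  "(\<lambda>n::int. (1 + \<bar>real_of_int n\<bar>) powr (-(3/2))) summable_on UNIV"
proof -
  have *: "(\<lambda>n::nat. (1 + real n) powr (-(3/2))) summable_on UNIV"
  proof -
    have "summable (\<lambda>n. real (Suc n) powr (-(3/2)))"
      using summable_real_powr_iff[of "-(3/2)"] by (subst summable_Suc_iff) auto
    then have "summable (\<lambda>n. norm ((1 + real n) powr (-(3/2))))" by (simp add: add_ac)
    then show ?thesis by (rule norm_summable_imp_summable_on)
  qed
  have "(\<lambda>n::int. (1 + \<bar>real_of_int n\<bar>) powr (-(3/2))) summable_on range int"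
    by (subst summable_on_reindex) (use * in \<open>auto simp: o_def\<close>)
  moreover have "(\<lambda>n::int. (1 + \<bar>real_of_int n\<bar>) powr (-(3/2))) summable_on range (\<lambda>n. - int n)"
    by (subst summable_on_reindex) (use * in \<open>auto simp: o_def inj_def\<close>)
  ultimately have "(\<lambda>n::int. (1 + \<bar>real_of_int n\<bar>) powr (-(3/2))) summable_on (range int \<union> range (\<lambda>n. - int n))"
    by (rule summable_on_union)
  also have "range int \<union> range (\<lambda>n. - int n) = UNIV"
    by (metis (no_types, lifting) UNIV_eq_I UnCI int_cases2 rangeI)
  finally show ?thesis .
qed

definition lattice_row :: "complex \<Rightarrow> int \<Rightarrow> complex" where
  "lattice_row \<tau> r = (\<Sum>\<^sub>\<infinity>n::int. 1 / (of_int r * \<tau> + of_int n)^2)"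

definition cot_col :: "complex \<Rightarrow> int \<Rightarrow> complex" where
  "cot_col \<tau> n = of_real pi / \<tau> * cot (of_real pi * (of_int n / \<tau>))"

lemma infsum_diff:
  fixes f g :: "'a \<Rightarrow> complex"
  assumes "f summable_on A" "g summable_on A"
  shows "(\<Sum>\<^sub>\<infinity>x\<in>A. f x - g x) = infsum f A - infsum g A"
  using infsum_add[OF assms(1) summable_on_uminus[THEN iffD2, OF assms(2)]]
  by (simp add: infsum_uminus)

lemma not_Ints_of_Im: "Im z \<noteq> 0 \<Longrightarrow> z \<notin> \<int>"
  by (auto elim!: Ints_cases)

text \<open>With h = 1 + |r| + |n| the product (1 + |r|) (1 + |n|) is at most h^2; raise this to the
  power -3/2.\<close>

lemma lattice_majorant3:
  "1 / (1 + \<bar>real_of_int r\<bar> + \<bar>real_of_int n\<bar>)^3 \<le>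
     (1 + \<bar>real_of_int r\<bar>) powr (-(3/2)) * (1 + \<bar>real_of_int n\<bar>) powr (-(3/2))"
proof -
  let ?h = "1 + \<bar>real_of_int r\<bar> + \<bar>real_of_int n\<bar>"
  have "(1 + \<bar>real_of_int r\<bar>) * (1 + \<bar>real_of_int n\<bar>) \<le> ?h * ?h"
    by (intro mult_mono) auto
  then have "(?h * ?h) powr (-(3/2)) \<le> ((1 + \<bar>real_of_int r\<bar>) * (1 + \<bar>real_of_int n\<bar>)) powr (-(3/2))"
    by (intro powr_mono2') (auto intro!: mult_pos_pos)
  moreover have "(?h * ?h) powr (-(3/2)) = 1 / ?h^3"
  proof -
    have "(?h * ?h) powr (-(3/2)) = (?h powr 2) powr (-(3/2))"
      by (simp add: power2_eq_square)
    also have "\<dots> = ?h powr (- 3)" by (simp only: powr_powr) simp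
    also have "\<dots> = 1 / ?h^3" by (simp add: powr_minus divide_inverse powr_numeral)
    finally show ?thesis .
  qed
  ultimately show ?thesis by (simp add: powr_mult)
qed

lemma lattice_majorant2:
  "1 / (1 + \<bar>real_of_int r\<bar> + \<bar>real_of_int n\<bar>)^2 \<le> (1 + \<bar>real_of_int n\<bar>) powr (-(3/2))"
proof -
  let ?h = "1 + \<bar>real_of_int r\<bar> + \<bar>real_of_int n\<bar>"
  have "1 / ?h^2 \<le> 1 / (1 + \<bar>real_of_int n\<bar>)^2"
    by (intro divide_left_mono power_mono) (auto intro!: mult_pos_pos)
  also have "\<dots> = (1 + \<bar>real_of_int n\<bar>) powr (- 2)"
    by (simp add: powr_minus divide_inverse powr_numeral)
  also have "\<dots> \<le> (1 + \<bar>real_of_int n\<bar>) powr (-(3/2))"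
    by (intro powr_mono) auto
  finally show ?thesis .
qed

lemma summable_on_majorised:
  fixes f :: "'a \<Rightarrow> complex"
  assumes "g summable_on A" "\<And>x. x \<in> A \<Longrightarrow> norm (f x) \<le> C * g x"
  shows "f summable_on A"
proof -
  have "(\<lambda>x. C * g x) summable_on A" using assms(1) by (rule summable_on_cmult_right)
  then have "(\<lambda>x. norm (f x)) summable_on A"
    by (rule summable_on_comparison_test) (use assms(2) in auto)
  then show ?thesis by (rule abs_summable_summable)
qed

text \<open>N / tau runs to infinity in the lower half plane, where the cotangent tends to i. This
  limit is the source of the nonmodular term of E2.\<close>

lemma cot_at_lower_infinity:
  assumes "Im \<tau> > 0"
  shows "(\<lambda>N. cot (of_real pi * (of_int (int N) / \<tau>))) \<longlonglongrightarrow> \<i>"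
proof -
  define \<sigma> where "\<sigma> = 1 / \<tau>"
  have \<sigma>: "Im \<sigma> < 0" using assms unfolding \<sigma>_def
    by (simp add: Im_divide power2_eq_square field_simps add_pos_nonneg sum_squares_gt_zero_iff)
  define E where "E = exp (- 2 * \<i> * of_real pi * \<sigma>)"
  have E: "norm E < 1" using \<sigma> unfolding E_def by (simp add: mult_pos_neg)
  have "(\<lambda>N. E ^ N) \<longlonglongrightarrow> 0" using E by (rule LIMSEQ_power_zero)
  then have "(\<lambda>N. \<i> * (1 + E^N) / (1 - E^N)) \<longlonglongrightarrow> \<i> * (1 + 0) / (1 - 0)"
    by (intro tendsto_divide tendsto_mult tendsto_add tendsto_diff tendsto_const) auto
  moreover have "cot (of_real pi * (of_int (int N) / \<tau>)) = \<i> * (1 + E^N) / (1 - E^N)" for N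
  proof -
    define w where "w = of_real pi * of_nat N * \<sigma>"
    have w: "of_real pi * (of_int (int N) / \<tau>) = w" by (simp add: w_def \<sigma>_def)
    have EN: "E^N = exp (- (\<i> * w)) / exp (\<i> * w)"
      unfolding E_def exp_of_nat_mult[symmetric] exp_diff[symmetric] by (simp add: w_def algebra_simps)
    have nz: "exp (\<i> * w) \<noteq> 0" by simp
    have "cot w = \<i> * (exp (\<i> * w) + exp (- (\<i> * w))) / (exp (\<i> * w) - exp (- (\<i> * w)))"
      unfolding cot_def sin_exp_eq cos_exp_eq by (simp add: field_simps)
    also have "\<dots> = \<i> * (1 + E^N) / (1 - E^N)"
      unfolding EN using nz by (simp add: add_divide_distrib[symmetric] diff_divide_distrib[symmetric] divide_simps)
    finally show ?thesis using w by simp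
  qed
  ultimately show ?thesis by simp
qed

lemma lattice_column_limit:
  assumes "Im \<tau> > 0"
  shows "(\<lambda>N. \<Sum>r\<in>{- int N..<int N}. 1 / (of_int r * \<tau> + of_int n)) \<longlonglongrightarrow> cot_col \<tau> n"
proof -
  have \<tau>: "\<tau> \<noteq> 0" using assms by auto
  show ?thesis
  proof (cases "n = 0")
    case True
    \<comment> \<open>Opposite terms cancel, 1 / 0 = 0, and only r = -N survives. The limit 0 agrees
      with \<open>cot_col\<close> at 0, because cot 0 = 1 / 0 = 0.\<close>
    have eq: "(\<Sum>r\<in>{- int N..<int N}. 1 / (of_int r * \<tau>)) = - (1 / \<tau>) * (1 / of_nat N)" for N
    proof -
      have "(\<Sum>n<N. 1 / (of_nat n * \<tau>) - 1 / (of_nat (Suc n) * \<tau>)) = - (1 / (of_nat N * \<tau>))"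
        by (subst sum_lessThan_telescope') simp
      moreover have "1 / (of_int (- int n - 1) * \<tau>) = - (1 / (of_nat (Suc n) * \<tau>))" for n
      proof -
        have "of_int (- int n - 1) * \<tau> = - (of_nat (Suc n) * \<tau>)" by (simp add: algebra_simps)
        then show ?thesis by (simp only: minus_divide_right[symmetric])
      qed
      ultimately show ?thesis unfolding sum_int_symmetric by (simp add: mult_ac)
    qed
    have "(\<lambda>N. - (1 / \<tau>) * (1 / of_nat N)) \<longlonglongrightarrow> - (1 / \<tau>) * 0"
      by (intro tendsto_intros lim_1_over_n)
    then show ?thesis using True eq by (simp add: cot_col_def)
  next
    case False
    have "Im (of_int n / \<tau>) \<noteq> 0" using False assms by (simp add: Im_divide sum_squares_gt_zero_iff)
    then have "(\<lambda>N. 1 / \<tau> * (\<Sum>r\<in>{- int N..<int N}. 1 / (of_int n / \<tau> + of_int r))) \<longlonglongrightarrow>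
        1 / \<tau> * (of_real pi * cot (of_real pi * (of_int n / \<tau>)))"
      by (intro tendsto_mult_left cot_partial_fractions not_Ints_of_Im)
    moreover have "1 / \<tau> * (1 / (of_int n / \<tau> + of_int r)) = 1 / (of_int r * \<tau> + of_int n)" for r
    proof -
      have "\<tau> * (of_int n / \<tau> + of_int r) = of_int r * \<tau> + of_int n" using \<tau> by (simp add: distrib_left mult.commute)
      then show ?thesis by (simp only: times_divide_times_eq mult_1)
    qed
    ultimately show ?thesis
      by (simp only: sum_distrib_left cot_col_def mult.assoc[symmetric] times_divide_eq_left mult_1)
  qed
qed

text \<open>Both iterated sums of \<open>1 / x\<^sup>2 - (1 / x - 1 / (x + 1))\<close> over \<open>x = r \<tau> + n\<close> agree, as it is
  absolutely summable. With \<open>1 / 0 = 0\<close> the correction telescopes along every row and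
  column, including those through the origin; only the columns leave a contribution, at infinity.\<close>

lemma lattice_sum_swap:
  assumes \<tau>: "Im \<tau> > 0"
    and rows: "lattice_row \<tau> summable_on UNIV" and cols: "lattice_row (- 1 / \<tau>) summable_on UNIV"
  shows "infsum (lattice_row \<tau>) UNIV =
    infsum (lattice_row (- 1 / \<tau>)) UNIV / \<tau>^2 + 2 * of_real pi * \<i> / \<tau>"
proof -
  have \<tau>0: "\<tau> \<noteq> 0" using \<tau> by auto
  define x where "x r n = of_int r * \<tau> + of_int n" for r n :: int
  define h where "h r n = 1 + \<bar>real_of_int r\<bar> + \<bar>real_of_int n\<bar>" for r n
  define a where "a r n = 1 / (x r n)^2" for r n
  define b where "b r n = 1 / x r n - 1 / x r (n + 1)" for r n
  obtain K where K: "K > 0" "\<And>r n. norm (1 / x r n) \<le> K / h r n"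
    using lattice_bound[OF \<tau>] unfolding x_def h_def by blast
  have h1: "h r n \<ge> 1" for r n unfolding h_def by auto
  have K': "norm (1 / x r (n + 1)) \<le> 2 * K / h r n" for r n
  proof -
    have "h r n \<le> 2 * h r (n + 1)" unfolding h_def by (auto simp: abs_if)
    then have "K / h r (n + 1) \<le> 2 * K / h r n"
      using K(1) h1[of r n] h1[of r "n + 1"] by (simp add: divide_simps)
    with K(2)[of r "n + 1"] show ?thesis by linarith
  qed
  have a_bound: "norm (a r n) \<le> K^2 * (1 / h r n ^ 2)" for r n
  proof -
    have "norm (a r n) = norm (1 / x r n) ^ 2" unfolding a_def by (simp add: norm_divide norm_power power_divide)
    also have "\<dots> \<le> (K / h r n) ^ 2" by (intro power_mono K) auto
    finally show ?thesis by (simp add: power_divide)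
  qed
  \<comment> \<open>Only (0, 0) and (0, -1) meet the convention 1 / 0 = 0. The product formulas fail
    there, so these two terms are bounded by hand.\<close>
  have exceptional: "h r n \<le> 2 \<and> norm (b r n) \<le> 2 \<and> norm (a r n - b r n) \<le> 2" if "x r n = 0 \<or> x r (n + 1) = 0" for r n
  proof -
    have r: "r = 0"
    proof (rule ccontr)
      assume "r \<noteq> 0"
      then have "Im (x r m) \<noteq> 0" for m using \<tau> by (simp add: x_def)
      then show False using that by (metis zero_complex.simps(2))
    qed
    moreover have "n = 0 \<or> n = -1" 
    proof -
      have "(of_int n :: complex) = 0 \<or> (of_int (n + 1) :: complex) = 0"
        using that unfolding x_def r by simp
      then show ?thesis unfolding of_int_eq_0_iff by auto
    qed
    ultimately show ?thesis by (auto simp: h_def a_def b_def x_def)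
  qed
  have regular: "b r n = 1 / x r n * (1 / x r (n + 1))" if "x r n \<noteq> 0" "x r (n + 1) \<noteq> 0" for r n
  proof -
    have "x r (n + 1) = x r n + 1" by (simp add: x_def)
    then show ?thesis using that unfolding b_def by (simp add: divide_simps)
  qed
  have regular': "a r n - b r n = 1 / x r n * (1 / x r n) * (1 / x r (n + 1))"
    if "x r n \<noteq> 0" "x r (n + 1) \<noteq> 0" for r n
  proof -
    have *: "x r (n + 1) = x r n + 1" by (simp add: x_def)
    show ?thesis using that unfolding regular[OF that] a_def * by (simp add: divide_simps power2_eq_square)
  qed
  \<comment> \<open>The 8 = 2 * 2^2 pays for the exceptional terms, where |b| <= 2 and h <= 2; 2 K^2
    comes from the bounds K / h and 2 K / h of the two factors. The 16 = 2 * 2^3 in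
    \<open>c_bound\<close> arises likewise.\<close>
  have b_bound: "norm (b r n) \<le> (8 + 2 * K^2) * (1 / h r n ^ 2)" for r n
  proof (cases "x r n = 0 \<or> x r (n + 1) = 0")
    case True
    from exceptional[OF True] have h: "h r n \<le> 2" "norm (b r n) \<le> 2" by auto
    have "2 * h r n ^ 2 \<le> 2 * 2 ^ 2" using h h1[of r n] by (intro mult_left_mono power_mono) auto
    also have "\<dots> \<le> 8 + 2 * K^2" by simp
    finally have "2 \<le> (8 + 2 * K^2) * (1 / h r n ^ 2)" using h1[of r n] by (simp add: field_simps)
    then show ?thesis using h by linarith
  next
    case False
    then have "norm (b r n) = norm (1 / x r n) * norm (1 / x r (n + 1))"
      by (subst regular) (simp_all only: norm_mult de_Morgan_disj simp_thms)
    also have "\<dots> \<le> (K / h r n) * (2 * K / h r n)"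
      by (intro mult_mono K K') (use K h1[of r n] in auto)
    also have "\<dots> = (2 * K^2) * (1 / h r n ^ 2)" by (simp add: power2_eq_square)
    also have "\<dots> \<le> (8 + 2 * K^2) * (1 / h r n ^ 2)" by (intro mult_right_mono) auto
    finally show ?thesis .
  qed
  have c_bound: "norm (a r n - b r n) \<le> (16 + 2 * K^3) * (1 / h r n ^ 3)" for r n
  proof (cases "x r n = 0 \<or> x r (n + 1) = 0")
    case True
    from exceptional[OF True] have h: "h r n \<le> 2" "norm (a r n - b r n) \<le> 2" by auto
    have "2 * h r n ^ 3 \<le> 2 * 2 ^ 3" using h h1[of r n] by (intro mult_left_mono power_mono) auto
    also have "\<dots> \<le> 16 + 2 * K^3" using K by simp
    finally have "2 \<le> (16 + 2 * K^3) * (1 / h r n ^ 3)" using h1[of r n] by (simp add: field_simps)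
    then show ?thesis using h by linarith
  next
    case False
    then have "norm (a r n - b r n) = norm (1 / x r n) * norm (1 / x r n) * norm (1 / x r (n + 1))"
      by (subst regular') (simp_all only: norm_mult de_Morgan_disj simp_thms)
    also have "\<dots> \<le> (K / h r n) * (K / h r n) * (2 * K / h r n)"
      by (intro mult_mono K K') (use K h1[of r n] in auto)
    also have "\<dots> = (2 * K^3) * (1 / h r n ^ 3)" by (simp add: power3_eq_cube)
    also have "\<dots> \<le> (16 + 2 * K^3) * (1 / h r n ^ 3)"
      using h1[of r n] by (intro mult_right_mono) auto
    finally show ?thesis .
  qed
  let ?w = "\<lambda>n::int. (1 + \<bar>real_of_int n\<bar>) powr (-(3/2))"
  have sym: "h r n = h n r" for r n by (simp add: h_def)
  have w_row: "1 / h r n ^ 2 \<le> ?w n" for r n unfolding h_def by (rule lattice_majorant2)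
  have w_col: "1 / h r n ^ 2 \<le> ?w r" for r n using w_row[of n r] by (simp add: sym)
  have sum_rc: "f summable_on UNIV"
    if "\<And>n. norm (f n) \<le> C * (1 / h (u n) (v n) ^ 2)" "C \<ge> 0" "u = (\<lambda>n. n) \<or> v = (\<lambda>n. n)"
    for f :: "int \<Rightarrow> complex" and C u v
  proof (rule summable_on_majorised[OF summable_on_int_powr])
    fix n
    have "1 / h (u n) (v n) ^ 2 \<le> ?w n" using that(3) w_row w_col by auto
    then show "norm (f n) \<le> C * ?w n" using that(1)[of n] mult_left_mono[OF _ that(2)] by fastforce
  qed
  have a_row: "a r summable_on UNIV" for r
    by (rule sum_rc[where C = "K^2" and u = "\<lambda>_. r" and v = "\<lambda>n. n"]) (use a_bound in auto)
  have a_col: "(\<lambda>r. a r n) summable_on UNIV" for n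
    by (rule sum_rc[where C = "K^2" and v = "\<lambda>_. n" and u = "\<lambda>n. n"]) (use a_bound in auto)
  have b_row: "b r summable_on UNIV" for r
    by (rule sum_rc[where C = "8 + 2 * K^2" and u = "\<lambda>_. r" and v = "\<lambda>n. n"]) (use b_bound in auto)
  have b_col: "(\<lambda>r. b r n) summable_on UNIV" for n
    by (rule sum_rc[where C = "8 + 2 * K^2" and v = "\<lambda>_. n" and u = "\<lambda>n. n"]) (use b_bound in auto)
  have c_sum: "(\<lambda>(r, n). a r n - b r n) summable_on UNIV \<times> UNIV"
  proof (rule summable_on_majorised[where g = "\<lambda>(r, n). ?w r * ?w n" and C = "16 + 2 * K^3"])
    show "(\<lambda>(r, n). ?w r * ?w n) summable_on UNIV \<times> UNIV"
      by (rule summable_on_SigmaI[where g = "\<lambda>r. ?w r * infsum ?w UNIV"])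
         (auto intro!: has_sum_cmult_right has_sum_infsum summable_on_cmult_left summable_on_int_powr)
    fix p :: "int \<times> int"
    obtain r n where p: "p = (r, n)" by (cases p)
    have "norm (a r n - b r n) \<le> (16 + 2 * K^3) * (?w r * ?w n)"
      using c_bound[of r n] lattice_majorant3[of r n] K(1) unfolding h_def
      by (meson add_nonneg_nonneg mult_left_mono order_trans zero_le_numeral mult_nonneg_nonneg zero_le_power less_imp_le)
    then show "norm (case p of (r, n) \<Rightarrow> a r n - b r n) \<le> (16 + 2 * K^3) * (case p of (r, n) \<Rightarrow> ?w r * ?w n)"
      by (simp add: p)
  qed
  have telescope: "(\<Sum>n\<in>{- int N..<int N}. u n - u (n + 1)) = u (- int N) - u (int N)"
    for u :: "int \<Rightarrow> complex" and N
  proof (induction N)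
    case (Suc N)
    have "{- int (Suc N)..<int (Suc N)} = insert (- int N - 1) (insert (int N) {- int N..<int N})"
      by auto
    moreover have "u (- int N - 1) = u (- 1 - int N)" by (rule arg_cong[of _ _ u]) simp
    ultimately show ?case using Suc by (simp add: algebra_simps)
  qed auto
  have b_row_sum: "infsum (b r) UNIV = 0" for r
  proof -
    have "(\<lambda>N. 1 / x r (- int N) - 1 / x r (int N)) \<longlonglongrightarrow> infsum (b r) UNIV"
      using infsum_int_LIMSEQ[OF b_row[of r]] unfolding b_def telescope[where u = "\<lambda>n. 1 / x r n"] .
    moreover have "(\<lambda>N. 1 / x r (- int N) - 1 / x r (int N)) \<longlonglongrightarrow> 0"
    proof (rule Lim_null_comparison)
      have "norm (1 / x r (- int N) - 1 / x r (int N)) \<le> 2 * K * (1 / real N)" if "N > 0" for N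
      proof -
        have "norm (1 / x r n) \<le> K * (1 / real N)" if n: "\<bar>n\<bar> = int N" for n
        proof -
          have "\<bar>real_of_int n\<bar> = real N"
            using arg_cong[OF n, of real_of_int] by simp
          then have "real N \<le> h r n" unfolding h_def by linarith
          then have "K / h r n \<le> K / real N" using K \<open>N > 0\<close> by (intro divide_left_mono) auto
          then show ?thesis using K(2)[of r n] by simp
        qed
        from this[of "- int N"] this[of "int N"] show ?thesis
          using norm_triangle_ineq4[of "1 / x r (- int N)" "1 / x r (int N)"] by simp
      qed
      then show "\<forall>\<^sub>F N in sequentially. norm (1 / x r (- int N) - 1 / x r (int N)) \<le> 2 * K * (1 / real N)"
        by (intro eventually_mono[OF eventually_gt_at_top[of 0]])
      show "(\<lambda>N. 2 * K * (1 / real N)) \<longlonglongrightarrow> 0"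
        using tendsto_mult_left[OF lim_1_over_n, of "2 * K"] by simp
    qed
    ultimately show ?thesis by (rule LIMSEQ_unique)
  qed
  have b_col_sum: "infsum (\<lambda>r. b r n) UNIV = cot_col \<tau> n - cot_col \<tau> (n + 1)" for n
  proof (rule LIMSEQ_unique)
    show "(\<lambda>N. \<Sum>r\<in>{- int N..<int N}. b r n) \<longlonglongrightarrow> infsum (\<lambda>r. b r n) UNIV"
      by (rule infsum_int_LIMSEQ[OF b_col])
    show "(\<lambda>N. \<Sum>r\<in>{- int N..<int N}. b r n) \<longlonglongrightarrow> cot_col \<tau> n - cot_col \<tau> (n + 1)"
      unfolding b_def sum_subtractf x_def by (intro tendsto_diff lattice_column_limit \<tau>)
  qed
  have a_col_sum: "infsum (\<lambda>r. a r n) UNIV = lattice_row (- 1 / \<tau>) n / \<tau>^2" for n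
  proof -
    have "infsum (\<lambda>r. a r n) UNIV = infsum (\<lambda>r. a (- r) n) UNIV"
      by (rule infsum_reindex_bij_witness[of _ uminus uminus]) auto
    also have "(\<lambda>r. a (- r) n) = (\<lambda>r. 1 / (of_int n * (- 1 / \<tau>) + of_int r)^2 * (1 / \<tau>^2))"
    proof
      fix r
      have "of_int (- r) * \<tau> + of_int n = - \<tau> * (of_int n * (- 1 / \<tau>) + of_int r)"
        using \<tau>0 by (simp add: right_diff_distrib mult.commute)
      then show "a (- r) n = 1 / (of_int n * (- 1 / \<tau>) + of_int r)^2 * (1 / \<tau>^2)"
        unfolding a_def x_def by (simp only: power_mult_distrib) (simp add: mult.commute)
    qed
    also have "infsum (\<lambda>r. 1 / (of_int n * (- 1 / \<tau>) + of_int r)^2 * (1 / \<tau>^2)) UNIV =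
        lattice_row (- 1 / \<tau>) n / \<tau>^2"
      unfolding lattice_row_def by (subst infsum_cmult_left') simp
    finally show ?thesis .
  qed
  have row: "(\<Sum>\<^sub>\<infinity>n. a r n - b r n) = lattice_row \<tau> r" for r
  proof -
    have "(\<Sum>\<^sub>\<infinity>n. a r n - b r n) = infsum (a r) UNIV - infsum (b r) UNIV"
      by (rule infsum_diff[OF a_row b_row])
    moreover have "a r = (\<lambda>n. 1 / (of_int r * \<tau> + of_int n)^2)" by (rule ext) (simp add: a_def x_def)
    ultimately show ?thesis by (simp only: b_row_sum lattice_row_def diff_0_right)
  qed
  let ?G = "\<lambda>n. lattice_row (- 1 / \<tau>) n / \<tau>^2"
  have col: "(\<Sum>\<^sub>\<infinity>r. a r n - b r n) = ?G n - (cot_col \<tau> n - cot_col \<tau> (n + 1))" for n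
    using infsum_diff[OF a_col b_col, of n n] by (simp add: b_col_sum a_col_sum)
  \<comment> \<open>Fubini for the absolutely summable difference: in the row sums the correction
    disappears, in the column sums it leaves a difference of cotangents.\<close>
  have eq: "infsum (lattice_row \<tau>) UNIV = (\<Sum>\<^sub>\<infinity>n. ?G n - (cot_col \<tau> n - cot_col \<tau> (n + 1)))"
    using infsum_swap_banach[OF c_sum] unfolding row col .
  have G: "?G summable_on UNIV" using summable_on_cmult_left[OF cols, of "1 / \<tau>^2"] by simp
  have "(\<lambda>n. \<Sum>\<^sub>\<infinity>r. a r n - b r n) summable_on UNIV"
  proof -
    have "(\<lambda>(n, r). a r n - b r n) summable_on UNIV \<times> UNIV"
      using c_sum by (subst summable_on_swap) (simp add: case_prod_unfold)
    then show ?thesis by (rule summable_on_Sigma_banach)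
  qed
  then have "(\<lambda>N. \<Sum>n\<in>{- int N..<int N}. ?G n - (cot_col \<tau> n - cot_col \<tau> (n + 1))) \<longlonglongrightarrow> infsum (lattice_row \<tau>) UNIV"
    unfolding col eq by (rule infsum_int_LIMSEQ)
  moreover have "(\<lambda>N. \<Sum>n\<in>{- int N..<int N}. ?G n - (cot_col \<tau> n - cot_col \<tau> (n + 1))) \<longlonglongrightarrow>
      infsum ?G UNIV + 2 * (of_real pi / \<tau> * \<i>)"
  proof -
    \<comment> \<open>The column corrections telescope once more in n. As the cotangent is odd, the
      two ends add up instead of cancelling.\<close>
    have "cot_col \<tau> (- int N) - cot_col \<tau> (int N) =
        - (2 * (of_real pi / \<tau> * cot (of_real pi * (of_int (int N) / \<tau>))))" for N
    proof -
      have "of_real pi * (of_int (- int N) / \<tau>) = - (of_real pi * (of_int (int N) / \<tau>))" by simp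
      then have "cot_col \<tau> (- int N) = - cot_col \<tau> (int N)"
        unfolding cot_col_def by (simp only: cot_minus mult_minus_right)
      then show ?thesis by (simp add: cot_col_def)
    qed
    then have "(\<Sum>n\<in>{- int N..<int N}. ?G n - (cot_col \<tau> n - cot_col \<tau> (n + 1))) =
      (\<Sum>n\<in>{- int N..<int N}. ?G n) + 2 * (of_real pi / \<tau> * cot (of_real pi * (of_int (int N) / \<tau>)))" for N
      by (subst sum_subtractf) (simp add: telescope[where u = "cot_col \<tau>"] del: of_int_of_nat_eq)
    then show ?thesis
      by (simp only:) (intro tendsto_intros infsum_int_LIMSEQ G cot_at_lower_infinity \<tau>)
  qed
  ultimately have "infsum (lattice_row \<tau>) UNIV = infsum ?G UNIV + 2 * (of_real pi / \<tau> * \<i>)"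
    by (rule LIMSEQ_unique)
  also have "infsum ?G UNIV = infsum (lattice_row (- 1 / \<tau>)) UNIV / \<tau>^2"
    using infsum_cmult_left'[of "lattice_row (- 1 / \<tau>)" "1 / \<tau>^2" UNIV] by simp
  finally show ?thesis by (simp add: mult_ac)
qed

section \<open>The rows of the lattice sum and the q-expansion of E2\<close>

lemma lattice_row_summable:
  assumes "Im \<tau> > 0"
  shows "(\<lambda>n. 1 / (of_int r * \<tau> + of_int n)^2) summable_on (UNIV :: int set)"
proof -
  obtain K where K: "K > 0"
    "\<And>r n. norm (1 / (of_int r * \<tau> + of_int n)) \<le> K / (1 + \<bar>real_of_int r\<bar> + \<bar>real_of_int n\<bar>)"
    using lattice_bound[OF assms] by blast
  show ?thesis
  proof (rule summable_on_majorised[OF summable_on_int_powr])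
    fix n
    have "norm (1 / (of_int r * \<tau> + of_int n)^2) = norm (1 / (of_int r * \<tau> + of_int n)) ^ 2"
      by (simp add: norm_divide norm_power power_divide)
    also have "\<dots> \<le> (K / (1 + \<bar>real_of_int r\<bar> + \<bar>real_of_int n\<bar>)) ^ 2"
      by (intro power_mono K) auto
    also have "\<dots> = K^2 * (1 / (1 + \<bar>real_of_int r\<bar> + \<bar>real_of_int n\<bar>)^2)"
      by (simp add: power_divide)
    also have "\<dots> \<le> K^2 * (1 + \<bar>real_of_int n\<bar>) powr (-(3/2))"
      by (intro mult_left_mono lattice_majorant2) auto
    finally show "norm (1 / (of_int r * \<tau> + of_int n)^2) \<le> K^2 * (1 + \<bar>real_of_int n\<bar>) powr (-(3/2))" .
  qed
qed

text \<open>Twice zeta(2), as the origin contributes 1 / 0 = 0.\<close>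

lemma lattice_row_zero:
  assumes "Im \<tau> > 0"
  shows "lattice_row \<tau> 0 = of_real pi^2 / 3"
proof -
  have s1: "(\<lambda>n. 1 / (of_nat n + 1)^2) sums (of_real (pi^2 / 6) :: complex)"
    using sums_of_real[OF inverse_squares_sums, where 'a = complex] by (simp add: add_ac)
  then have s2: "(\<lambda>n. 1 / (of_nat n)^2) sums (of_real (pi^2 / 6) :: complex)"
    using sums_Suc_iff[of "\<lambda>n. 1 / (of_nat n)^2 :: complex"] by (simp add: add_ac)
  have eq: "(\<Sum>n\<in>{- int N..<int N}. 1 / (of_int 0 * \<tau> + of_int n)^2) =
      (\<Sum>n<N. 1 / (of_nat n)^2 + 1 / (of_nat n + 1)^2)" for N
  proof -
    have "(of_int 0 * \<tau> + of_int (- int n - 1))^2 = (of_nat n + 1)^2" for n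
      by (simp add: power2_eq_square algebra_simps)
    then show ?thesis unfolding sum_int_symmetric by simp
  qed
  have "(\<lambda>N. \<Sum>n<N. 1 / (of_nat n)^2 + 1 / (of_nat n + 1)^2) \<longlonglongrightarrow> lattice_row \<tau> 0"
    using infsum_int_LIMSEQ[OF lattice_row_summable[OF assms, of 0]] unfolding eq lattice_row_def .
  moreover have "(\<lambda>N. \<Sum>n<N. 1 / (of_nat n)^2 + 1 / (of_nat n + 1)^2) \<longlonglongrightarrow> (of_real (pi^2 / 6) + of_real (pi^2 / 6) :: complex)"
    using sums_add[OF s2 s1] unfolding sums_def .
  ultimately show ?thesis using LIMSEQ_unique by fastforce
qed

lemma lattice_row_uminus: "lattice_row \<tau> (- r) = lattice_row \<tau> r"
  unfolding lattice_row_def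
proof (rule infsum_reindex_bij_witness[of _ uminus uminus])
  fix n :: int
  have "of_int (- r) * \<tau> + of_int n = - (of_int r * \<tau> + of_int (- n))" by simp
  then show "1 / (of_int r * \<tau> + of_int (- n))^2 = 1 / (of_int (- r) * \<tau> + of_int n)^2"
    by (simp only: power2_minus)
qed auto

text \<open>Lipschitz formula: the row is pi^2 / sin^2 at pi r tau, and for w = exp (i pi r tau) the
  sine is (w - 1 / w) / (2 i) with w^2 = q^r.\<close>

lemma lattice_row_eq:
  assumes "Im \<tau> > 0" "r > 0"
  shows "lattice_row \<tau> (int r) = - (4 * of_real pi^2) * (qpar \<tau> ^ r / (1 - qpar \<tau> ^ r)^2)"
proof -
  define z where "z = of_nat r * \<tau>"
  have "Im z \<noteq> 0" using assms by (simp add: z_def)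
  then have z: "z \<notin> \<int>" by (rule not_Ints_of_Im)
  have eq: "(\<Sum>n\<in>{- int N..<int N}. 1 / (of_int (int r) * \<tau> + of_int n)^2) =
      (\<Sum>n<N. 1 / (z + of_nat n)^2 + 1 / (1 - z + of_nat n)^2)" for N
  proof -
    have "(of_int (int r) * \<tau> + of_int (- int n - 1))^2 = (1 - z + of_nat n)^2" for n
      by (simp add: z_def power2_eq_square algebra_simps)
    then show ?thesis unfolding sum_int_symmetric by (simp add: z_def)
  qed
  have "(\<lambda>N. \<Sum>n<N. 1 / (z + of_nat n)^2 + 1 / (1 - z + of_nat n)^2) \<longlonglongrightarrow> lattice_row \<tau> (int r)"
    using infsum_int_LIMSEQ[OF lattice_row_summable[OF assms(1), of "int r"]]
    unfolding eq lattice_row_def .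
  with inverse_sin_squared_sums[OF z] have "lattice_row \<tau> (int r) = of_real pi^2 / sin (of_real pi * z)^2"
    unfolding sums_def by (rule LIMSEQ_unique[symmetric])
  also have "sin (of_real pi * z)^2 = - ((1 - qpar \<tau> ^ r)^2 / (4 * qpar \<tau> ^ r))"
  proof -
    define w where "w = exp (\<i> * (of_real pi * z))"
    have w: "w \<noteq> 0" "exp (- (\<i> * (of_real pi * z))) = 1 / w" by (simp_all add: w_def exp_minus inverse_eq_divide)
    have q: "qpar \<tau> ^ r = w^2"
      unfolding qpar_def w_def z_def exp_of_nat_mult[symmetric] by (simp add: algebra_simps)
    have "sin (of_real pi * z) = (w - 1 / w) / (2 * \<i>)"
      unfolding sin_exp_eq w(2) by (simp add: w_def)
    also have "\<dots> = (w^2 - 1) / (2 * \<i> * w)"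
    proof -
      have "w - 1 / w = (w^2 - 1) / w" using w(1) by (simp add: diff_divide_distrib power2_eq_square)
      then show ?thesis by (simp add: mult.commute)
    qed
    finally show ?thesis unfolding q
      by (simp add: power_divide power_mult_distrib power2_commute[of "w^2" 1])
  qed
  also have "of_real pi^2 / - ((1 - qpar \<tau> ^ r)^2 / (4 * qpar \<tau> ^ r)) =
      - (4 * of_real pi^2) * (qpar \<tau> ^ r / (1 - qpar \<tau> ^ r)^2)" by simp
  finally show ?thesis .
qed

definition lambert :: "complex \<Rightarrow> nat \<times> nat \<Rightarrow> complex" where
  "lambert q mr = of_nat (fst mr) * q ^ (fst mr * snd mr)"

definition e2_series :: "complex \<Rightarrow> complex" where
  "e2_series q = 1 - 24 * infsum (lambert q) ({1..} \<times> {1..})"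

lemma E2_eq: "E2 \<tau> = e2_series (qpar \<tau>)"
  unfolding E2_def e2_series_def lambert_def by (simp add: case_prod_unfold)

lemma has_sum_linear_geometric:
  fixes x :: "'a::{real_normed_field,banach}"
  assumes "norm x < 1"
  shows "((\<lambda>m. of_nat m * x ^ (m - 1)) has_sum (1 / (1 - x)^2)) {1..}"
proof -
  have "(\<lambda>n. of_nat (Suc n) * norm x ^ n) sums (1 / (1 - norm x)^2)"
    by (rule geometric_deriv_sums) (use assms in auto)
  then have "summable (\<lambda>n. norm (of_nat (Suc n) * x ^ n))"
    by (simp add: sums_iff norm_mult norm_power del: of_nat_Suc)
  then have "((\<lambda>n. of_nat (Suc n) * x ^ n) has_sum (1 / (1 - x)^2)) UNIV"
    by (rule norm_summable_imp_has_sum) (rule geometric_deriv_sums[OF assms])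
  moreover have "bij_betw Suc UNIV {1..}" by (rule bij_betw_byWitness[where f' = "\<lambda>n. n - 1"]) auto
  ultimately show ?thesis
    using has_sum_reindex_bij_betw[of Suc UNIV "{1..}" "\<lambda>m. of_nat m * x ^ (m - 1)" "1 / (1 - x)^2"] by simp
qed

text \<open>m r >= (m - 1) + r because (m - 1) (r - 1) >= 0, so the double series is dominated by a
  product of two single series, uniformly for |q| <= t.\<close>

lemma lambert_majorant:
  assumes "norm q \<le> t" "t < 1" "mr \<in> {1..} \<times> {1..}"
  shows "norm (lambert q mr) \<le> (real (fst mr) * t ^ (fst mr - 1)) * t ^ snd mr"
proof -
  obtain m r where mr: "mr = (m, r)" "m \<ge> 1" "r \<ge> 1" using assms by auto
  have t: "0 \<le> t" using assms(1) norm_ge_zero order_trans by blast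
  obtain m' r' where Suc: "m = Suc m'" "r = Suc r'" using mr by (metis Suc_le_D One_nat_def)
  have "norm q ^ (m * r) \<le> t ^ (m * r)" by (intro power_mono assms) auto
  also have "\<dots> \<le> t ^ ((m - 1) + r)"
    by (intro power_decreasing) (use t assms Suc in auto)
  finally show ?thesis unfolding lambert_def mr
    by (simp add: norm_mult norm_power power_add mult_left_mono mult.assoc)
qed

lemma lambert_majorant_summable:
  assumes "0 \<le> t" "t < (1::real)"
  shows "(\<lambda>mr. (real (fst mr) * t ^ (fst mr - 1)) * t ^ snd mr) summable_on {1..} \<times> {1..}"
proof (rule summable_on_SigmaI)
  have t: "norm t < 1" using assms by auto
  have "summable (\<lambda>n. norm (t ^ n))" using t assms by (simp add: summable_geometric)
  then have "(\<lambda>r. t ^ r) summable_on UNIV" by (rule norm_summable_imp_summable_on)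
  then have g: "(\<lambda>r. t ^ r) summable_on {1..}" by (rule summable_on_subset_banach) auto
  show "((\<lambda>y. real (fst (x, y)) * t ^ (fst (x, y) - 1) * t ^ snd (x, y)) has_sum
      (real x * t ^ (x - 1)) * infsum (\<lambda>r. t ^ r) {1..}) {1..}" for x
    unfolding fst_conv snd_conv by (intro has_sum_cmult_right has_sum_infsum g)
  show "(\<lambda>x. real x * t ^ (x - 1) * infsum (\<lambda>r. t ^ r) {1..}) summable_on {1..}"
    by (intro summable_on_cmult_left has_sum_imp_summable[OF has_sum_linear_geometric] t)
qed (use assms in auto)

lemma lambert_summable:
  assumes "norm q < 1"
  shows "lambert q summable_on {1..} \<times> {1..}"
  by (rule summable_on_majorised[OF lambert_majorant_summable[of "norm q"], where C = 1])
     (use assms lambert_majorant[of q "norm q"] in auto)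

lemma e2_series_holomorphic: "e2_series holomorphic_on ball 0 1"
proof -
  have "(\<lambda>q. infsum (lambert q) ({1..} \<times> {1..})) holomorphic_on ball 0 t" if t: "0 < t" "t < 1" for t
  proof -
    let ?F = "finite_subsets_at_top ({1..} \<times> {1..} :: (nat \<times> nat) set)"
    have lim: "uniform_limit (cball 0 t) (\<lambda>X q. \<Sum>mr\<in>X. lambert q mr) (\<lambda>q. infsum (lambert q) ({1..} \<times> {1..})) ?F"
      by (rule Weierstrass_m_test_general[where f = "\<lambda>mr q. lambert q mr", OF _ lambert_majorant_summable[of t]])
         (use t lambert_majorant in auto)
    show ?thesis
      by (rule holomorphic_uniform_limit[OF _ lim])
         (auto intro!: always_eventually continuous_intros holomorphic_intros simp: lambert_def)
  qed
  then have "(\<lambda>q. infsum (lambert q) ({1..} \<times> {1..})) field_differentiable at q" if "norm q < 1" for q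
  proof -
    obtain t where "norm q < t" "t < 1" using dense[OF \<open>norm q < 1\<close>] by blast
    moreover have "0 < t" using \<open>norm q < t\<close> norm_ge_zero[of q] by linarith
    ultimately show ?thesis
      using \<open>\<And>t. \<lbrakk>0 < t; t < 1\<rbrakk> \<Longrightarrow> _\<close>[of t] by (auto simp: holomorphic_on_open field_differentiable_def)
  qed
  then have "(\<lambda>q. infsum (lambert q) ({1..} \<times> {1..})) holomorphic_on ball 0 1"
    by (auto simp: holomorphic_on_open field_differentiable_def)
  then show ?thesis unfolding e2_series_def by (intro holomorphic_intros)
qed

lemma norm_qpar: "norm (qpar \<tau>) = exp (- 2 * pi * Im \<tau>)"
  by (simp add: qpar_def)

lemma qpar_in_ball: "Im \<tau> > 0 \<Longrightarrow> norm (qpar \<tau>) < 1"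
  by (simp add: norm_qpar)

text \<open>Row 0 gives pi^2 / 3, and the rows r and -r together give -8 pi^2 q^r / (1 - q^r)^2, the
  sum over m of -8 pi^2 m q^(m r). The quotient of 8 pi^2 by pi^2 / 3 is the 24 of E2.\<close>

lemma E2_lattice:
  assumes "Im \<tau> > 0"
  shows "lattice_row \<tau> summable_on UNIV" "infsum (lattice_row \<tau>) UNIV = of_real pi^2 / 3 * E2 \<tau>"
proof -
  let ?q = "qpar \<tau>"
  have q: "norm ?q < 1" by (rule qpar_in_ball[OF assms])
  have inner: "(\<Sum>\<^sub>\<infinity>m\<in>{1..}. lambert ?q (m, r)) = ?q^r / (1 - ?q^r)^2" if "r \<in> {1..}" for r
  proof -
    have "norm (?q^r) < 1" using q that by (simp add: norm_power power_less_one_iff)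
    then have "((\<lambda>m. ?q^r * (of_nat m * (?q^r) ^ (m - 1))) has_sum (?q^r * (1 / (1 - ?q^r)^2))) {1..}"
      by (intro has_sum_cmult_right has_sum_linear_geometric)
    moreover have "?q^r * (of_nat m * (?q^r) ^ (m - 1)) = lambert ?q (m, r)" if "m \<in> {1..}" for m
    proof -
      obtain n where "m = Suc n" using \<open>m \<in> {1..}\<close> by (cases m) auto
      then show ?thesis by (simp add: lambert_def power_mult[symmetric] power_add mult_ac)
    qed
    ultimately have "((\<lambda>m. lambert ?q (m, r)) has_sum (?q^r * (1 / (1 - ?q^r)^2))) {1..}"
      by (subst has_sum_cong[symmetric]) auto
    then show ?thesis by (simp add: infsumI)
  qed
  have "(\<lambda>(r, m). lambert ?q (m, r)) summable_on {1..} \<times> {1..}"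
    using lambert_summable[OF q] by (subst summable_on_swap) (simp add: case_prod_unfold)
  then have "(\<lambda>r. \<Sum>\<^sub>\<infinity>m\<in>{1..}. lambert ?q (m, r)) summable_on {1..}" 
    and sw: "(\<Sum>\<^sub>\<infinity>r\<in>{1..}. \<Sum>\<^sub>\<infinity>m\<in>{1..}. lambert ?q (m, r)) = infsum (\<lambda>(r, m). lambert ?q (m, r)) ({1..} \<times> {1..})"
    by (auto intro: summable_on_Sigma_banach infsum_Sigma'_banach)
  then have sm: "(\<lambda>r. ?q^r / (1 - ?q^r)^2) summable_on {1..}"
    by (subst (asm) summable_on_cong[OF inner])
  have "infsum (\<lambda>(r, m). lambert ?q (m, r)) ({1..} \<times> {1..}) = infsum (lambert ?q) ({1..} \<times> {1..})"
    by (rule infsum_reindex_bij_witness[of _ prod.swap prod.swap]) auto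
  moreover have "(\<Sum>\<^sub>\<infinity>r\<in>{1..}. \<Sum>\<^sub>\<infinity>m\<in>{1..}. lambert ?q (m, r)) = (\<Sum>\<^sub>\<infinity>r\<in>{1..}. ?q^r / (1 - ?q^r)^2)"
    by (rule infsum_cong) (rule inner)
  ultimately have lam: "infsum (lambert ?q) ({1..} \<times> {1..}) = (\<Sum>\<^sub>\<infinity>r\<in>{1..}. ?q^r / (1 - ?q^r)^2)"
    using sw by simp
  define L where "L = (\<lambda>r. - (4 * of_real pi^2) * (?q^r / (1 - ?q^r)^2))"
  have L: "(L has_sum (- (4 * of_real pi^2) * infsum (lambert ?q) ({1..} \<times> {1..}))) {1..}"
    unfolding L_def lam by (intro has_sum_cmult_right has_sum_infsum sm)
  have bij1: "bij_betw int {1..} {1..}" 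
    by (rule bij_betw_byWitness[where f' = nat]) auto
  have bij2: "bij_betw (\<lambda>r. - int r) {1..} {..-1}"
    by (rule bij_betw_byWitness[where f' = "\<lambda>r. nat (- r)"]) auto
  have row: "lattice_row \<tau> (int r) = L r" if "r \<in> {1..}" for r
    using lattice_row_eq[OF assms, of r] that unfolding L_def by auto
  let ?S = "- (4 * of_real pi^2) * infsum (lambert ?q) ({1..} \<times> {1..})"
  have h1: "(lattice_row \<tau> has_sum ?S) {1..}"
    using L has_sum_cong[of "{1..}" "\<lambda>r. lattice_row \<tau> (int r)" L, OF row]
    by (simp only: has_sum_reindex_bij_betw[OF bij1])
  have h2: "(lattice_row \<tau> has_sum ?S) {..-1}"
    using L has_sum_cong[of "{1..}" "\<lambda>r. lattice_row \<tau> (int r)" L, OF row]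
      has_sum_reindex_bij_betw[OF bij2, of "lattice_row \<tau>"]
    by (simp only: lattice_row_uminus)
  have h0: "(lattice_row \<tau> has_sum (of_real pi^2 / 3)) {0}"
    using has_sum_finite[of "{0}" "lattice_row \<tau>"] by (simp add: lattice_row_zero[OF assms])
  have "(lattice_row \<tau> has_sum (?S + ?S)) ({1..} \<union> {..-1})"
    by (rule has_sum_Un_disjoint[OF h1 h2]) auto
  then have "(lattice_row \<tau> has_sum ((?S + ?S) + of_real pi^2 / 3)) (({1..} \<union> {..-1}) \<union> {0})"
    by (rule has_sum_Un_disjoint[OF _ h0]) auto
  also have "({1..} \<union> {..-1}) \<union> {0} = (UNIV :: int set)" by auto
  also have "(?S + ?S) + of_real pi^2 / 3 = of_real pi^2 / 3 * E2 \<tau>"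
    unfolding E2_eq e2_series_def by (simp add: algebra_simps)
  finally have "(lattice_row \<tau> has_sum (of_real pi^2 / 3 * E2 \<tau>)) UNIV" .
  then show "lattice_row \<tau> summable_on UNIV" "infsum (lattice_row \<tau>) UNIV = of_real pi^2 / 3 * E2 \<tau>"
    by (auto simp: has_sum_imp_summable infsumI)
qed

text \<open>The anomaly 2 pi i / tau of the lattice sum, divided by the normalisation pi^2 / 3 and
  moved to the other side. It equals 12 / (2 pi i), where 12 is the value of the derivation on
  E2.\<close>

definition qm_kappa :: complex where "qm_kappa = 6 / (of_real pi * \<i>)"

lemma Im_neg_inverse: "Im \<tau> > 0 \<Longrightarrow> Im (- 1 / \<tau>) > 0"
  by (simp add: Im_divide power2_eq_square sum_squares_gt_zero_iff add_nonneg_pos)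

lemma E2_inversion:
  assumes "Im \<tau> > 0"
  shows "E2 (- 1 / \<tau>) = \<tau>^2 * E2 \<tau> + qm_kappa * \<tau>"
proof -
  have \<tau>: "\<tau> \<noteq> 0" using assms by auto
  note i = Im_neg_inverse[OF assms]
  have pi: "(of_real pi :: complex) \<noteq> 0" by simp
  have "of_real pi^2 / 3 * E2 \<tau> = of_real pi^2 / 3 * E2 (- 1 / \<tau>) / \<tau>^2 + 2 * of_real pi * \<i> / \<tau>"
    using lattice_sum_swap[OF assms E2_lattice(1)[OF assms] E2_lattice(1)[OF i]]
    unfolding E2_lattice(2)[OF assms] E2_lattice(2)[OF i] .
  then have "of_real pi^2 * E2 \<tau> * \<tau>^2 = of_real pi^2 * E2 (- 1 / \<tau>) + 6 * of_real pi * \<i> * \<tau>"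
    using \<tau> by (simp add: divide_simps power2_eq_square mult_ac)
  then have "of_real pi * (of_real pi * E2 (- 1 / \<tau>)) = of_real pi * (of_real pi * E2 \<tau> * \<tau>^2 - 6 * \<i> * \<tau>)"
    by (simp add: algebra_simps power2_eq_square)
  then have "of_real pi * E2 (- 1 / \<tau>) = of_real pi * E2 \<tau> * \<tau>^2 - 6 * \<i> * \<tau>" by (simp only: mult_left_cancel[OF pi])
  then have "E2 (- 1 / \<tau>) = (of_real pi * E2 \<tau> * \<tau>^2 - 6 * \<i> * \<tau>) / of_real pi"
    using pi by (simp add: nonzero_eq_divide_eq mult.commute)
  also have "\<dots> = \<tau>^2 * E2 \<tau> - 6 * \<i> / of_real pi * \<tau>"
    using pi by (simp add: diff_divide_distrib mult_ac)
  also have "\<dots> = \<tau>^2 * E2 \<tau> + qm_kappa * \<tau>"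
  proof -
    have k: "qm_kappa = - (6 * \<i> / of_real pi)"
      unfolding qm_kappa_def by (simp add: divide_inverse mult_ac)
    show ?thesis unfolding k by simp
  qed
  finally show ?thesis .
qed

section \<open>From translations and the inversion to all of SL(2,Z)\<close>

lemma qpar_add_of_int: "qpar (\<tau> + of_int n) = qpar \<tau>"
proof -
  have "2 * of_real pi * \<i> * (\<tau> + of_int n) = 2 * of_real pi * \<i> * \<tau> + (2 * of_int n * of_real pi) * \<i>"
    by (simp add: algebra_simps)
  moreover have "exp ((2 * of_int n * of_real pi) * \<i>) = 1"
    using exp_integer_2pi[of "real_of_int n"] by simp
  ultimately show ?thesis unfolding qpar_def by (simp only: exp_add mult_1_right)
qed

lemma E2_add_of_int: "E2 (\<tau> + of_int n) = E2 \<tau>"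
  by (simp add: E2_eq qpar_add_of_int)

lemma denom_nonzero:
  fixes a b c d :: int
  assumes "Im \<tau> > 0" "a * d - b * c = 1"
  shows "of_int c * \<tau> + of_int d \<noteq> 0"
proof
  assume *: "of_int c * \<tau> + of_int d = 0"
  then have "Im (of_int c * \<tau> + of_int d) = 0" by simp
  then have "c = 0" using assms(1) by simp
  with * have "d = 0" by simp
  with \<open>c = 0\<close> assms(2) show False by simp
qed

lemma Im_moebius_int:
  fixes a b c d :: int
  assumes "Im \<tau> > 0" "a * d - b * c = 1"
  shows "Im ((of_int a * \<tau> + of_int b) / (of_int c * \<tau> + of_int d)) =
    Im \<tau> / norm (of_int c * \<tau> + of_int d) ^ 2"
proof -
  have "real_of_int (a * d - b * c) = 1" using assms(2) by simp
  then have ab: "real_of_int a * real_of_int d = 1 + real_of_int b * real_of_int c" by simp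
  have "(of_int a * Im \<tau>) * (of_int c * Re \<tau> + of_int d) - (of_int a * Re \<tau> + of_int b) * (of_int c * Im \<tau>)
     = (real_of_int a * real_of_int d - real_of_int b * real_of_int c) * Im \<tau>" by (simp add: algebra_simps)
  also have "\<dots> = Im \<tau>" using ab by simp
  finally show ?thesis unfolding Im_divide cmod_power2 by simp
qed

lemma Im_moebius_int_pos:
  fixes a b c d :: int
  assumes "Im \<tau> > 0" "a * d - b * c = 1"
  shows "Im ((of_int a * \<tau> + of_int b) / (of_int c * \<tau> + of_int d)) > 0"
  unfolding Im_moebius_int[OF assms] using denom_nonzero[OF assms] assms(1) by simp

text \<open>Euclid's algorithm on the column (a, c): with n = a div c the matrix is the translation
  by n, times the inversion, times a matrix whose lower left entry is a mod c.\<close>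

lemma E2_transform:
  fixes a b c d :: int
  assumes "Im \<tau> > 0" "a * d - b * c = 1"
  shows "E2 ((of_int a * \<tau> + of_int b) / (of_int c * \<tau> + of_int d)) =
    (of_int c * \<tau> + of_int d)^2 * E2 \<tau> + qm_kappa * of_int c * (of_int c * \<tau> + of_int d)"
  using assms(2)
proof (induction "nat \<bar>c\<bar>" arbitrary: a b c d rule: less_induct)
  case less
  show ?case
  proof (cases "c = 0")
    case True
    with less.prems have ad: "(a = 1 \<and> d = 1) \<or> (a = -1 \<and> d = -1)"
      by (simp add: zmult_eq_1_iff)
    then have "(of_int a * \<tau> + of_int b) / (of_int c * \<tau> + of_int d) = \<tau> + of_int (b * d)"
      using True by auto
    moreover have "(of_int d :: complex)^2 = 1" using ad by auto
    ultimately show ?thesis using True E2_add_of_int[of \<tau> "b * d"] by simp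
  next
    case False
    define n where "n = a div c"
    define c' where "c' = a mod c"
    define d' where "d' = b - n * d"
    have a: "a = n * c + c'" unfolding n_def c'_def by simp
    have b: "b = n * d + d'" unfolding d'_def by simp
    have det: "(- c) * d' - (- d) * c' = 1"
      using less.prems unfolding a b by (simp add: algebra_simps)
    have small: "nat \<bar>c'\<bar> < nat \<bar>c\<bar>"
      using False abs_mod_less[of c a] unfolding c'_def by linarith
    define J where "J = of_int c * \<tau> + of_int d"
    define J' where "J' = of_int c' * \<tau> + of_int d'"
    define w where "w = (of_int (- c) * \<tau> + of_int (- d)) / (of_int c' * \<tau> + of_int d')"
    have J: "J \<noteq> 0" unfolding J_def by (rule denom_nonzero[OF assms(1) less.prems])
    have J': "J' \<noteq> 0" unfolding J'_def by (rule denom_nonzero[OF assms(1) det])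
    have w: "w = - J / J'" unfolding w_def J_def J'_def by (simp add: algebra_simps)
    have wpos: "Im w > 0" unfolding w_def by (rule Im_moebius_int_pos[OF assms(1) det])
    have "of_int a * \<tau> + of_int b = of_int n * J + J'"
      unfolding J_def J'_def a b by (simp add: algebra_simps)
    then have "(of_int a * \<tau> + of_int b) / J = - 1 / w + of_int n"
      using J J' unfolding w by (simp add: add_divide_distrib)
    then have "E2 ((of_int a * \<tau> + of_int b) / J) = w^2 * E2 w + qm_kappa * w"
      by (simp only: E2_add_of_int E2_inversion[OF wpos])
    also have "E2 w = J'^2 * E2 \<tau> + qm_kappa * of_int c' * J'"
      unfolding w_def J'_def by (rule less.hyps[OF small det])
    also have "w^2 * (J'^2 * E2 \<tau> + qm_kappa * of_int c' * J') + qm_kappa * w =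
        J^2 * E2 \<tau> + qm_kappa * (J / J') * (of_int c' * J - 1)"
      using J' unfolding w by (simp add: power2_eq_square distrib_left right_diff_distrib)
    also have "of_int c' * J - 1 = of_int c * J'"
    proof -
      have "of_int c' * J - of_int c * J' = of_int ((- c) * d' - (- d) * c')"
        unfolding J_def J'_def by (simp add: algebra_simps)
      then have "of_int c' * J - of_int c * J' = 1" unfolding det by simp
      then show ?thesis by (simp add: algebra_simps)
    qed
    finally show ?thesis using J' unfolding J_def[symmetric] by simp
  qed
qed

section \<open>Resultants and functions polynomial in \<open>z\<close> over power series in \<open>q\<close>\<close>

lemma finite_zeros_on_compact:
  fixes f :: "complex \<Rightarrow> complex"
  assumes "f holomorphic_on S" "open S" "connected S" "compact K" "K \<subseteq> S" "z1 \<in> S" "f z1 \<noteq> 0"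
  shows "finite {z \<in> K. f z = 0}"
proof (cases "f constant_on S")
  case True
  then have "f z = f z1" if "z \<in> K" for z using that assms by (auto simp: constant_on_def)
  then have "{z \<in> K. f z = 0} = {}" using assms by auto
  then show ?thesis by (simp only: finite.emptyI)
qed (use assms holomorphic_compact_finite_zeros in blast)

text \<open>Divide by z - z0 as long as all the functions vanish there; the order of
  \<open>r m0\<close>, which is not identically zero, bounds the number of divisions. Used at q = 0
  for the leading power of q, and at points of the half plane for the generic order of a
  zero.\<close>

lemma holomorphic_common_factor:
  fixes r :: "nat \<Rightarrow> complex \<Rightarrow> complex"
  assumes S: "open S" "connected S" "z0 \<in> S" and r: "\<And>m. m \<le> N \<Longrightarrow> r m holomorphic_on S"
    and nz: "m0 \<le> N" "z1 \<in> S" "r m0 z1 \<noteq> 0"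
  obtains n s where "\<And>m. m \<le> N \<Longrightarrow> s m holomorphic_on S"
    "\<And>m z. m \<le> N \<Longrightarrow> z \<in> S \<Longrightarrow> r m z = (z - z0) ^ n * s m z" "\<exists>m\<le>N. s m z0 \<noteq> 0"
proof -
  define P where "P n \<longleftrightarrow> (\<exists>s. \<forall>m\<le>N. s m holomorphic_on S \<and> (\<forall>z\<in>S. r m z = (z - z0) ^ n * s m z))" for n
  have P0: "P 0" unfolding P_def using r by (intro exI[of _ r]) auto
  have bound: "n \<le> nat (zorder (r m0) z0)" if "P n" for n
  proof -
    obtain s' where s': "\<forall>m\<le>N. s' m holomorphic_on S \<and> (\<forall>z\<in>S. r m z = (z - z0) ^ n * s' m z)"
      using \<open>P n\<close> unfolding P_def by blast
    define s where "s = s' m0"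
    have s: "s holomorphic_on S" "\<And>z. z \<in> S \<Longrightarrow> r m0 z = (z - z0) ^ n * s z"
      using s' nz(1) unfolding s_def by auto
    have "s z1 \<noteq> 0" using s(2)[OF nz(2)] nz(3) by auto
    then have ev: "\<forall>\<^sub>F w in at z0. s w \<noteq> 0"
      using non_zero_neighbour_alt[OF s(1) S nz(2)] by (auto elim: eventually_mono)
    then have fr: "\<exists>\<^sub>F w in at z0. s w \<noteq> 0" by (rule eventually_frequently[rotated]) auto
    have s_an: "s analytic_on {z0}" using s(1) S by (auto simp: analytic_at)
    have "zorder (r m0) z0 = zorder (\<lambda>z. (z - z0) ^ n * s z) z0"
      by (rule zorder_cong) (use s(2) eventually_at_in_open'[OF S(1,3)] in \<open>auto elim: eventually_mono\<close>)
    also have "\<dots> = zorder (\<lambda>z. (z - z0) ^ n) z0 + zorder s z0"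
    proof (rule zorder_times_analytic)
      show "(\<lambda>z. (z - z0) ^ n) analytic_on {z0}" by (intro analytic_intros)
      show "\<forall>\<^sub>F z in at z0. (z - z0) ^ n * s z \<noteq> 0"
        using ev eventually_neq_at_within[of z0 z0 UNIV] by eventually_elim auto
    qed (rule s_an)
    also have "zorder (\<lambda>z. (z - z0) ^ n) z0 = int n"
      by (rule zorder_eqI[where S = UNIV and g = "\<lambda>_. 1"]) auto
    finally show ?thesis using zorder_ge_0[OF s_an fr] by linarith
  qed
  define n where "n = Greatest P"
  have "P n" unfolding n_def using GreatestI_nat[of P 0, OF P0] bound by blast
  then obtain s where s: "\<And>m. m \<le> N \<Longrightarrow> s m holomorphic_on S"
      "\<And>m z. m \<le> N \<Longrightarrow> z \<in> S \<Longrightarrow> r m z = (z - z0) ^ n * s m z"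
    unfolding P_def by blast
  have "\<exists>m\<le>N. s m z0 \<noteq> 0"
  proof (rule ccontr)
    assume "\<not> ?thesis"
    then have z: "s m z0 = 0" if "m \<le> N" for m using that by auto
    \<comment> \<open>One more division: the singularity at z0 is removable, which contradicts the
      maximality of n.\<close>
    define t where "t = (\<lambda>m z. if z = z0 then deriv (s m) z0 else (s m z - s m z0) / (z - z0))"
    have "t m holomorphic_on S" if "m \<le> N" for m
      unfolding t_def by (rule pole_lemma_open[OF s(1)[OF that] S(1)])
    moreover have "r m z = (z - z0) ^ Suc n * t m z" if "m \<le> N" "z \<in> S" for m z
      using s(2)[OF that] z[OF that(1)] by (auto simp: t_def)
    ultimately have "P (Suc n)" unfolding P_def by (intro exI[of _ t]) auto
    then have "Suc n \<le> Greatest P" using Greatest_le_nat[of P "Suc n"] bound by blast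
    then have "Suc n \<le> n" by (simp only: n_def)
    then show False by simp
  qed
  with s that show ?thesis by blast
qed

lemma poly_bounded_below_at_infinity:
  fixes p :: "complex poly"
  assumes "p \<noteq> 0"
  obtains c Y where "c > 0" "\<And>x. norm x \<ge> Y \<Longrightarrow> norm (poly p x) \<ge> c"
proof -
  obtain a p' where p: "p = pCons a p'" by (cases p)
  show ?thesis
  proof (cases "p' = 0")
    case True
    then show ?thesis using assms p that[of "norm a" 0] by simp
  next
    case False
    from poly_infinity[OF False, of 1 a] p that[of 1] show ?thesis by auto
  qed
qed

text \<open>The leading power of \<open>q\<close> dominates as soon as \<open>q\<close> is small against every power of \<open>1 / x\<close> that occurs.\<close>

lemma poly_in_q_nonvanishing:
  fixes r :: "nat \<Rightarrow> complex \<Rightarrow> complex"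
  assumes r: "\<And>m. m \<le> N \<Longrightarrow> r m holomorphic_on ball 0 1"
    and nz: "m0 \<le> N" "norm q1 < 1" "r m0 q1 \<noteq> 0"
  obtains Y where "Y > 0" "\<And>x q. norm x \<ge> Y \<Longrightarrow> q \<noteq> 0 \<Longrightarrow> norm q \<le> 1/2 \<Longrightarrow>
    norm q * norm x ^ N * Y \<le> 1 \<Longrightarrow> (\<Sum>m\<le>N. r m q * x ^ m) \<noteq> 0"
proof -
  obtain n s where s: "\<And>m. m \<le> N \<Longrightarrow> s m holomorphic_on ball 0 1"
    "\<And>m z. m \<le> N \<Longrightarrow> z \<in> ball 0 1 \<Longrightarrow> r m z = (z - 0) ^ n * s m z" "\<exists>m\<le>N. s m 0 \<noteq> 0"
    by (rule holomorphic_common_factor[of "ball 0 1" 0 N r m0 q1]) (use r nz in auto)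
  \<comment> \<open>The coefficient of the leading power q^n, a nonzero polynomial in x.\<close>
  define P where "P = (\<Sum>m\<le>N. monom (s m 0) m)"
  have "coeff P m = s m 0" if "m \<le> N" for m
    unfolding P_def coeff_sum using that by (simp add: coeff_monom sum.delta)
  then have "P \<noteq> 0" using s(3) by (metis coeff_0)
  then obtain c Y0 where c: "c > 0" "\<And>x. norm x \<ge> Y0 \<Longrightarrow> norm (poly P x) \<ge> c"
    using poly_bounded_below_at_infinity[of P] by blast
  define t where "t = (\<lambda>m z. if z = 0 then deriv (s m) 0 else (s m z - s m 0) / (z - 0))"
  have t: "t m holomorphic_on ball 0 1" if "m \<le> N" for m
    unfolding t_def by (rule pole_lemma_open[OF s(1)[OF that]]) auto
  have st: "s m q = s m 0 + q * t m q" for m q by (auto simp: t_def)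
  have "\<exists>M. \<forall>q\<in>cball 0 (1/2). norm (t m q) \<le> M" if "m \<le> N" for m
  proof -
    have "continuous_on (cball 0 (1/2)) (t m)"
      by (rule continuous_on_subset[OF holomorphic_on_imp_continuous_on[OF t[OF that]]]) auto
    then have "compact (t m ` cball 0 (1/2))" by (intro compact_continuous_image) auto
    then show ?thesis using compact_imp_bounded bounded_iff by (metis imageI)
  qed
  then obtain M where M: "\<And>m q. m \<le> N \<Longrightarrow> norm q \<le> 1/2 \<Longrightarrow> norm (t m q) \<le> M m" 
    by (metis mem_cball_0)
  define M' where "M' = (\<Sum>m\<le>N. \<bar>M m\<bar>)"
  have M': "M' \<ge> 0" unfolding M'_def by (intro sum_nonneg) auto
  \<comment> \<open>|x| >= Y0 gives |P(x)| >= c, and Y >= (M' + 1) / c keeps the remainder, which is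
    at most M' / Y, below c.\<close>
  define Y where "Y = max 1 (max Y0 ((M' + 1) / c))"
  have Y: "Y \<ge> 1" "Y \<ge> Y0" "Y \<ge> (M' + 1) / c" unfolding Y_def by auto
  show ?thesis
  proof (rule that[of Y])
    show "Y > 0" using Y by linarith
    fix x q :: complex
    assume x: "norm x \<ge> Y" and q: "q \<noteq> 0" "norm q \<le> 1/2" "norm q * norm x ^ N * Y \<le> 1"
    have eq: "(\<Sum>m\<le>N. r m q * x ^ m) = q ^ n * (poly P x + q * (\<Sum>m\<le>N. t m q * x ^ m))"
    proof -
      have "(\<Sum>m\<le>N. r m q * x ^ m) = (\<Sum>m\<le>N. q ^ n * (s m 0 * x ^ m + q * (t m q * x ^ m)))"
      proof (rule sum.cong)
        fix m assume "m \<in> {..N}"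
        then have "r m q = q ^ n * s m q" using s(2)[of m q] q by auto
        also have "s m q = s m 0 + q * t m q" by (rule st)
        finally show "r m q * x ^ m = q ^ n * (s m 0 * x ^ m + q * (t m q * x ^ m))"
          by (simp only: distrib_left distrib_right mult.assoc)
      qed simp
      then show ?thesis unfolding P_def
        by (simp add: poly_sum poly_monom sum_distrib_left sum.distrib distrib_left)
    qed
    have "norm (\<Sum>m\<le>N. t m q * x ^ m) \<le> (\<Sum>m\<le>N. \<bar>M m\<bar> * norm x ^ N)"
    proof (rule sum_norm_le)
      fix m assume m: "m \<in> {..N}"
      have "norm (t m q) \<le> \<bar>M m\<bar>" using M[of m q] m q by fastforce
      moreover have "norm x ^ m \<le> norm x ^ N" using m x Y by (intro power_increasing) auto
      ultimately show "norm (t m q * x ^ m) \<le> \<bar>M m\<bar> * norm x ^ N"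
        by (simp add: norm_mult norm_power mult_mono)
    qed
    also have "\<dots> = M' * norm x ^ N" unfolding M'_def by (simp add: sum_distrib_right)
    finally have "norm q * norm (\<Sum>m\<le>N. t m q * x ^ m) \<le> norm q * (M' * norm x ^ N)"
      by (rule mult_left_mono) auto
    also have "\<dots> = M' * (norm q * norm x ^ N)" by simp
    also have "\<dots> \<le> M' * (1 / Y)"
      using q(3) Y M' by (intro mult_left_mono) (auto simp: field_simps)
    also have "\<dots> < c"
    proof -
      have "M' < c * Y" using Y(3) c(1) by (simp add: field_simps)
      then show ?thesis using Y(1) by (simp add: field_simps)
    qed
    finally have "norm (q * (\<Sum>m\<le>N. t m q * x ^ m)) < norm (poly P x)"
      using c(2)[of x] x Y by (simp add: norm_mult)
    then have "poly P x + q * (\<Sum>m\<le>N. t m q * x ^ m) \<noteq> 0"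
      by (metis add_eq_0_iff norm_minus_cancel order_less_irrefl)
    then show "(\<Sum>m\<le>N. r m q * x ^ m) \<noteq> 0" unfolding eq using q by simp
  qed
qed

section \<open>Resultants of fixed formal degree\<close>

lemma poly_eq_sum_atMost:
  fixes p :: "'a::comm_semiring_1 poly"
  assumes "degree p \<le> n"
  shows "poly p x = (\<Sum>k\<le>n. coeff p k * x ^ k)"
  unfolding poly_altdef
  by (intro sum.mono_neutral_left) (use assms in \<open>auto simp: coeff_eq_0\<close>)

text \<open>The vector of the powers x^(2p-1), ..., x, 1 lies in the kernel of the Sylvester matrix,
  whose rows evaluate A or B at x times a power of x. The fixed size 2p keeps this true, and the
  determinant polynomial in the coefficients, when a leading coefficient vanishes.\<close>

lemma resultant_sub_common_root:
  fixes A B :: "complex poly"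
  assumes "degree A \<le> p" "degree B \<le> p" "p > 0" "poly A x = 0" "poly B x = 0"
  shows "resultant_sub p p A B = 0"
proof -
  let ?M = "sylvester_mat_sub p p A B"
  have M: "?M \<in> carrier_mat (p + p) (p + p)" by (rule sylvester_mat_sub_carrier)
  define v where "v = vec (p + p) (\<lambda>j. x ^ (2 * p - 1 - j))"
  have v: "v \<in> carrier_vec (p + p)" by (simp add: v_def)
  have "vec_index v (2 * p - 1) = x ^ (2 * p - 1 - (2 * p - 1))"
    unfolding v_def by (rule index_vec) (use assms(3) in simp)
  then have "vec_index v (2 * p - 1) = 1" by simp
  then have "v \<noteq> 0\<^sub>v (p + p)" using assms(3) by (auto simp: mult_2)
  moreover have "?M *\<^sub>v v = 0\<^sub>v (p + p)"
  proof (rule eq_vecI)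
    fix i assume "i < dim_vec (0\<^sub>v (p + p) :: complex vec)"
    then have i: "i < p + p" by simp
    have "vec_index (?M *\<^sub>v v) i = (\<Sum>j\<in>{0..<p+p}. ?M $$ (i, j) * x ^ (2 * p - 1 - j))"
      using i M by (simp add: scalar_prod_def v_def)
    also have "\<dots> = 0"
    proof (cases "i < p")
      case True
      have "(\<Sum>j\<in>{0..<p+p}. ?M $$ (i, j) * x ^ (2 * p - 1 - j)) =
          (\<Sum>j\<in>{i..i+p}. coeff A (p + i - j) * x ^ (2 * p - 1 - j))"
        by (rule sum.mono_neutral_cong_right)
           (use i True in \<open>auto simp: sylvester_mat_sub_index\<close>)
      also have "\<dots> = (\<Sum>k\<le>p. coeff A k * x ^ k * x ^ (p - 1 - i))"
        by (rule sum.reindex_bij_witness[of _ "\<lambda>k. p + i - k" "\<lambda>j. p + i - j"])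
           (use True in \<open>auto simp: power_add[symmetric] mult.assoc intro!: arg_cong2[of _ _ _ _ "(*)"] arg_cong[of _ _ "(^) x"]\<close>)
      also have "\<dots> = poly A x * x ^ (p - 1 - i)"
        unfolding poly_eq_sum_atMost[OF assms(1)] by (simp add: sum_distrib_right)
      finally show ?thesis using assms by simp
    next
      case False
      have "(\<Sum>j\<in>{0..<p+p}. ?M $$ (i, j) * x ^ (2 * p - 1 - j)) =
          (\<Sum>j\<in>{i-p..i}. coeff B (i - j) * x ^ (2 * p - 1 - j))"
        by (rule sum.mono_neutral_cong_right)
           (use i False in \<open>auto simp: sylvester_mat_sub_index\<close>)
      also have "\<dots> = (\<Sum>k\<le>p. coeff B k * x ^ k * x ^ (2 * p - 1 - i))"
        by (rule sum.reindex_bij_witness[of _ "\<lambda>k. i - k" "\<lambda>j. i - j"])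
           (use False i in \<open>auto simp: power_add[symmetric] mult.assoc intro!: arg_cong2[of _ _ _ _ "(*)"] arg_cong[of _ _ "(^) x"]\<close>)
      also have "\<dots> = poly B x * x ^ (2 * p - 1 - i)"
        unfolding poly_eq_sum_atMost[OF assms(2)] by (simp add: sum_distrib_right)
      finally show ?thesis using assms by simp
    qed
    finally show "vec_index (?M *\<^sub>v v) i = vec_index (0\<^sub>v (p + p)) i" using i by simp
  qed (simp add: sylvester_mat_sub_def)
  ultimately show ?thesis unfolding resultant_sub_def
    using det_0_iff_vec_prod_zero[OF M] v by blast
qed

text \<open>At full degree p this is the genuine resultant; if it vanished, the gcd would be
  nonconstant and have a complex root.\<close>

lemma resultant_sub_nonzero:
  fixes A B :: "complex poly"
  assumes "degree A = p" "degree B = p" "\<And>x. poly A x = 0 \<Longrightarrow> poly B x = 0 \<Longrightarrow> False" "A \<noteq> 0"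
  shows "resultant_sub p p A B \<noteq> 0"
proof
  assume "resultant_sub p p A B = 0"
  then have "resultant A B = 0" using assms by (simp add: resultant_sub)
  then have "degree (gcd A B) \<noteq> 0" by (simp add: resultant_0_gcd)
  then have "\<not> constant (poly (gcd A B))" by (simp add: constant_degree)
  then obtain x where "poly (gcd A B) x = 0" using fundamental_theorem_of_algebra by blast
  then have "poly A x = 0" "poly B x = 0" by (auto elim: dvdE[OF gcd_dvd1[of A B]] dvdE[OF gcd_dvd2[of A B]] simp: poly_eq_0_iff_dvd intro: dvd_trans)
  then show False using assms(3) by blast
qed

text \<open>By the Leibniz formula the determinant is a polynomial in the coefficients, for a matrix
  size independent of z. Used for two rings of functions: those satisfying \<open>qpoly\<close>, and
  the holomorphic ones.\<close>

lemma resultant_sub_closed: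
  fixes A B :: "complex \<Rightarrow> complex poly" and Q :: "(complex \<Rightarrow> complex) \<Rightarrow> bool"
  assumes const: "\<And>c. Q (\<lambda>_. c)" and add: "\<And>f g. Q f \<Longrightarrow> Q g \<Longrightarrow> Q (\<lambda>z. f z + g z)"
    and mult: "\<And>f g. Q f \<Longrightarrow> Q g \<Longrightarrow> Q (\<lambda>z. f z * g z)"
    and A: "\<And>i. Q (\<lambda>z. coeff (A z) i)" and B: "\<And>i. Q (\<lambda>z. coeff (B z) i)"
  shows "Q (\<lambda>z. resultant_sub p p (A z) (B z))"
proof -
  have sum: "Q (\<lambda>z. \<Sum>i\<in>I. f i z)" if "finite I" "\<And>i. i \<in> I \<Longrightarrow> Q (f i)" for I :: "'a set" and f
    using that by (induction I rule: finite_induct) (auto intro: const add)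
  have prod: "Q (\<lambda>z. \<Prod>i\<in>I. f i z)" if "finite I" "\<And>i. i \<in> I \<Longrightarrow> Q (f i)" for I :: "'b set" and f
    using that by (induction I rule: finite_induct) (auto intro: const mult)
  have entry: "Q (\<lambda>z. sylvester_mat_sub p p (A z) (B z) $$ (i, j))" if "i < p + p" "j < p + p" for i j
    unfolding sylvester_mat_sub_index[OF that]
    by (cases "i < p"; cases "i \<le> j \<and> j - i \<le> p"; cases "i - p \<le> j \<and> j \<le> i") (auto intro: A B const)
  have eq: "resultant_sub p p (A z) (B z) = (\<Sum>\<pi> | \<pi> permutes {0..<p+p}. of_int (sign \<pi>) *
      (\<Prod>i\<in>{0..<p+p}. sylvester_mat_sub p p (A z) (B z) $$ (i, \<pi> i)))" for z
    unfolding resultant_sub_def by (simp add: det_def)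
  show ?thesis unfolding eq
    by (intro sum prod mult const entry finite_permutations) (auto simp: permutes_in_image)
qed

section \<open>Polynomials in z with coefficients holomorphic in q\<close>

definition halfplane :: "complex set" where "halfplane = {z. Im z > 0}"

lemma halfplane_topology: "open halfplane" "connected halfplane" "halfplane = upper_half"
  unfolding halfplane_def upper_half_def
  by (auto simp: open_halfspace_Im_gt intro: convex_connected convex_halfspace_Im_gt)

lemma holomorphic_on_qpar:
  assumes "f holomorphic_on ball 0 1"
  shows "(\<lambda>z. f (qpar z)) holomorphic_on halfplane"
proof -
  have "qpar holomorphic_on halfplane" unfolding qpar_def by (intro holomorphic_intros)
  moreover have "qpar ` halfplane \<subseteq> ball 0 1" by (auto simp: halfplane_def qpar_in_ball)
  ultimately show ?thesis using holomorphic_on_compose_gen[OF _ assms] by (simp add: o_def)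
qed

text \<open>A ring that contains z and all holomorphic functions of q on the unit disc. It records
  enough about the growth near i infinity to exclude zeros high up in the strip, which holomorphy
  alone does not give.\<close>

definition qpoly :: "(complex \<Rightarrow> complex) \<Rightarrow> bool" where
  "qpoly h \<longleftrightarrow> (\<exists>P N. (\<forall>q. degree (P q) \<le> N) \<and> (\<forall>i. (\<lambda>q. coeff (P q) i) holomorphic_on ball 0 1) \<and>
     (\<forall>z\<in>halfplane. h z = poly (P (qpar z)) z))"

lemma qpolyI:
  assumes "\<And>q. degree (P q) \<le> N" "\<And>i. (\<lambda>q. coeff (P q) i) holomorphic_on ball 0 1"
    "\<And>z. z \<in> halfplane \<Longrightarrow> h z = poly (P (qpar z)) z"
  shows "qpoly h"
  unfolding qpoly_def using assms by blast

lemma qpolyE: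
  assumes "qpoly h"
  obtains P N where "\<And>q. degree (P q) \<le> N" "\<And>i. (\<lambda>q. coeff (P q) i) holomorphic_on ball 0 1"
    "\<And>z. z \<in> halfplane \<Longrightarrow> h z = poly (P (qpar z)) z"
  using assms unfolding qpoly_def by blast

lemma qpoly_qpar:
  assumes "f holomorphic_on ball 0 1"
  shows "qpoly (\<lambda>z. f (qpar z))"
proof (rule qpolyI[of "\<lambda>q. [:f q:]" 0])
  show "(\<lambda>q. coeff [:f q:] i) holomorphic_on ball 0 1" for i
    using assms by (cases i) auto
qed auto

lemma qpoly_const: "qpoly (\<lambda>_. c)"
  using qpoly_qpar[of "\<lambda>_. c"] by simp

lemma qpoly_ident: "qpoly (\<lambda>z. z)"
  by (rule qpolyI[of "\<lambda>q. [:0, 1:]" 1]) auto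

lemma qpoly_add:
  assumes "qpoly f" "qpoly g"
  shows "qpoly (\<lambda>z. f z + g z)"
proof -
  obtain P N where P: "\<And>q. degree (P q) \<le> N" "\<And>i. (\<lambda>q. coeff (P q) i) holomorphic_on ball 0 1"
    "\<And>z. z \<in> halfplane \<Longrightarrow> f z = poly (P (qpar z)) z" using qpolyE[OF assms(1)] by blast
  obtain P' N' where P': "\<And>q. degree (P' q) \<le> N'" "\<And>i. (\<lambda>q. coeff (P' q) i) holomorphic_on ball 0 1"
    "\<And>z. z \<in> halfplane \<Longrightarrow> g z = poly (P' (qpar z)) z" using qpolyE[OF assms(2)] by blast
  show ?thesis
  proof (rule qpolyI[of "\<lambda>q. P q + P' q" "max N N'"])
    show "degree (P q + P' q) \<le> max N N'" for q
      using P(1)[of q] P'(1)[of q] by (intro degree_add_le) auto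
    show "(\<lambda>q. coeff (P q + P' q) i) holomorphic_on ball 0 1" for i
      unfolding coeff_add by (intro holomorphic_intros P P')
  qed (use P P' in auto)
qed

lemma qpoly_mult:
  assumes "qpoly f" "qpoly g"
  shows "qpoly (\<lambda>z. f z * g z)"
proof -
  obtain P N where P: "\<And>q. degree (P q) \<le> N" "\<And>i. (\<lambda>q. coeff (P q) i) holomorphic_on ball 0 1"
    "\<And>z. z \<in> halfplane \<Longrightarrow> f z = poly (P (qpar z)) z" using qpolyE[OF assms(1)] by blast
  obtain P' N' where P': "\<And>q. degree (P' q) \<le> N'" "\<And>i. (\<lambda>q. coeff (P' q) i) holomorphic_on ball 0 1"
    "\<And>z. z \<in> halfplane \<Longrightarrow> g z = poly (P' (qpar z)) z" using qpolyE[OF assms(2)] by blast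
  show ?thesis
  proof (rule qpolyI[of "\<lambda>q. P q * P' q" "N + N'"])
    show "degree (P q * P' q) \<le> N + N'" for q
      using P(1)[of q] P'(1)[of q] degree_mult_le[of "P q" "P' q"] by linarith
    show "(\<lambda>q. coeff (P q * P' q) i) holomorphic_on ball 0 1" for i
      unfolding coeff_mult by (intro holomorphic_intros P P')
  qed (use P P' in auto)
qed

lemma qpoly_holomorphic:
  assumes "qpoly h"
  shows "h holomorphic_on halfplane"
proof -
  obtain P N where P: "\<And>q. degree (P q) \<le> N" "\<And>i. (\<lambda>q. coeff (P q) i) holomorphic_on ball 0 1"
    "\<And>z. z \<in> halfplane \<Longrightarrow> h z = poly (P (qpar z)) z" using qpolyE[OF assms] by blast
  have "(\<lambda>z. \<Sum>i\<le>N. coeff (P (qpar z)) i * z ^ i) holomorphic_on halfplane"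
    by (intro holomorphic_intros holomorphic_on_qpar[of "\<lambda>q. coeff (P q) _"] P)
  then show ?thesis
    by (rule holomorphic_transform) (simp add: P(3) poly_eq_sum_atMost[OF P(1)])
qed

text \<open>Supplies the hypotheses of \<open>poly_in_q_nonvanishing\<close> at x = z - l, uniformly
  for bounded real l: q decays exponentially in Im z, whereas |z - l| exceeds Im z by at most the
  constant C.\<close>

lemma strip_estimates:
  fixes \<Lambda> Y :: real and N :: nat
  obtains Y1 where "\<And>z l. \<lbrakk>\<bar>Re z\<bar> \<le> 1/2; Im z \<ge> Y1; norm l \<le> \<Lambda>; Im l = 0\<rbrakk> \<Longrightarrow>
     Im z > 0 \<and> norm (z - l) \<ge> Y \<and> norm (qpar z) \<le> 1/2 \<and> norm (qpar z) * norm (z - l) ^ N * Y \<le> 1"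
proof -
  define C where "C = 1/2 + \<bar>\<Lambda>\<bar>"
  have "((\<lambda>t. exp C * \<bar>Y\<bar> * (t ^ N / exp t)) \<longlongrightarrow> exp C * \<bar>Y\<bar> * 0) at_top"
    by (intro tendsto_mult_left tendsto_power_div_exp_0)
  then have "\<forall>\<^sub>F t in at_top. exp C * \<bar>Y\<bar> * (t ^ N / exp t) < 1"
    by (intro order_tendstoD) auto
  then obtain T where T: "\<And>t. t \<ge> T \<Longrightarrow> exp C * \<bar>Y\<bar> * (t ^ N / exp t) < 1"
    by (auto simp: eventually_at_top_linorder)
  show ?thesis
  proof (rule that[of "max T (max \<bar>Y\<bar> 1)"])
    fix z l :: complex
    assume z: "\<bar>Re z\<bar> \<le> 1/2" "max T (max \<bar>Y\<bar> 1) \<le> Im z" and l: "norm l \<le> \<Lambda>" "Im l = 0"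
    have y: "Im z \<ge> 1" "Im z \<ge> T" "Im z \<ge> \<bar>Y\<bar>" using z by auto
    have q: "norm (qpar z) \<le> exp (- Im z)"
    proof -
      have "Im z \<le> 2 * pi * Im z" using y pi_gt3 mult_right_mono[of 1 "2 * pi" "Im z"] by simp
      then show ?thesis by (simp add: norm_qpar)
    qed
    have "norm z \<le> \<bar>Re z\<bar> + \<bar>Im z\<bar>" by (rule cmod_le)
    then have nz: "norm (z - l) \<le> Im z + C"
      using norm_triangle_ineq4[of z l] z(1) l y(1) unfolding C_def by linarith
    have "\<bar>Im (z - l)\<bar> \<le> norm (z - l)" by (rule abs_Im_le_cmod)
    then have big: "norm (z - l) \<ge> Y" using y l by simp
    have "(2::real) \<le> exp 1" using exp_ge_add_one_self[of 1] by simp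
    then have "exp (- (1::real)) \<le> 1/2" by (simp add: exp_minus field_simps)
    moreover have "exp (- Im z) \<le> exp (- 1)" using y by simp
    ultimately have half: "norm (qpar z) \<le> 1/2" using q by linarith
    have "norm (qpar z) * norm (z - l) ^ N * \<bar>Y\<bar> \<le> exp (- Im z) * (Im z + C) ^ N * \<bar>Y\<bar>"
      using q nz y by (intro mult_mono power_mono) (auto simp: C_def)
    also have "\<dots> = exp C * \<bar>Y\<bar> * ((Im z + C) ^ N / exp (Im z + C))"
      by (simp add: exp_add exp_minus divide_inverse)
    also have "\<dots> < 1" using y by (intro T) (auto simp: C_def)
    finally have "norm (qpar z) * norm (z - l) ^ N * \<bar>Y\<bar> \<le> 1" by simp
    moreover have "norm (qpar z) * norm (z - l) ^ N * Y \<le> norm (qpar z) * norm (z - l) ^ N * \<bar>Y\<bar>"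
      by (intro mult_left_mono) auto
    ultimately show "Im z > 0 \<and> norm (z - l) \<ge> Y \<and> norm (qpar z) \<le> 1/2 \<and> norm (qpar z) * norm (z - l) ^ N * Y \<le> 1"
      using y big half by linarith
  qed
qed

lemma qpar_nonzero: "qpar z \<noteq> 0"
  by (simp add: qpar_def)

lemma qpoly_nonvanishing:
  assumes "qpoly h" "z1 \<in> halfplane" "h z1 \<noteq> 0"
  obtains Y where "\<And>z. \<bar>Re z\<bar> \<le> 1/2 \<Longrightarrow> Im z \<ge> Y \<Longrightarrow> h z \<noteq> 0"
proof -
  obtain P N where P: "\<And>q. degree (P q) \<le> N" "\<And>i. (\<lambda>q. coeff (P q) i) holomorphic_on ball 0 1"
    "\<And>z. z \<in> halfplane \<Longrightarrow> h z = poly (P (qpar z)) z" using qpolyE[OF assms(1)] by blast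
  note h = P(3)[unfolded poly_eq_sum_atMost[OF P(1)]]
  obtain m0 where m0: "m0 \<le> N" "coeff (P (qpar z1)) m0 \<noteq> 0"
    using h[OF assms(2)] assms(3) by (metis (no_types, lifting) atMost_iff mult_zero_left sum.neutral)
  have q1: "norm (qpar z1) < 1" using assms(2) by (simp add: halfplane_def qpar_in_ball)
  obtain Y where Y: "Y > 0" "\<And>x q. norm x \<ge> Y \<Longrightarrow> q \<noteq> 0 \<Longrightarrow> norm q \<le> 1/2 \<Longrightarrow>
    norm q * norm x ^ N * Y \<le> 1 \<Longrightarrow> (\<Sum>m\<le>N. coeff (P q) m * x ^ m) \<noteq> 0"
    using poly_in_q_nonvanishing[of N "\<lambda>m q. coeff (P q) m" m0 "qpar z1", OF P(2) m0(1) q1 m0(2)]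
    by blast
  obtain Y1 where Y1: "\<And>z l. \<lbrakk>\<bar>Re z\<bar> \<le> 1/2; Im z \<ge> Y1; norm l \<le> 0; Im l = 0\<rbrakk> \<Longrightarrow>
     Im z > 0 \<and> norm (z - l) \<ge> Y \<and> norm (qpar z) \<le> 1/2 \<and> norm (qpar z) * norm (z - l) ^ N * Y \<le> 1"
    using strip_estimates[where \<Lambda> = 0 and Y = Y and N = N] by blast
  show ?thesis
  proof (rule that[of Y1])
    fix z assume "\<bar>Re z\<bar> \<le> 1/2" "Y1 \<le> Im z"
    from Y1[OF this, of 0] Y(2)[of z "qpar z"] show "h z \<noteq> 0"
      using h[of z] by (auto simp: halfplane_def qpar_nonzero)
  qed
qed

text \<open>A polynomial in l, as \<open>[:w, -1:]\<close> stands for w - l. The arguments w and q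
  are kept apart because reflection in the line Re z = - 1/2 replaces w by -1 - z while q stays
  \<open>qpar z\<close>.\<close>

definition root_poly :: "(nat \<Rightarrow> complex \<Rightarrow> complex) \<Rightarrow> nat \<Rightarrow> complex \<Rightarrow> complex \<Rightarrow> complex poly" where
  "root_poly e p w q = (\<Sum>i\<le>p. Polynomial.smult (e i q) ([:w, -1:] ^ (p - i)))"

lemma poly_root_poly: "poly (root_poly e p w q) l = (\<Sum>i\<le>p. e i q * (w - l) ^ (p - i))"
  by (simp add: root_poly_def poly_sum)

lemma degree_root_poly: "degree (root_poly e p w q) \<le> p"
  unfolding root_poly_def
proof (rule degree_sum_le)
  fix i assume "i \<in> {..p}"
  have "degree ([:w, -1:] ^ (p - i)) \<le> degree [:w, -1:] * (p - i)" by (rule degree_power_le)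
  then show "degree (Polynomial.smult (e i q) ([:w, -1:] ^ (p - i))) \<le> p"
    using degree_smult_le[of "e i q" "[:w, -1:] ^ (p - i)"] by simp
qed simp

lemma coeff_linear_power_top: "coeff ([:w, -1:] ^ n) n = (- 1 :: complex) ^ n"
proof -
  have "degree ([:w, -1:] ^ n) = n" by (simp add: degree_power_eq)
  then have "coeff ([:w, -1:] ^ n) n = lead_coeff ([:w, -1:] ^ n)" by simp
  also have "\<dots> = (- 1) ^ n" by (simp add: lead_coeff_power)
  finally show ?thesis .
qed

text \<open>Only the summand i = 0 reaches degree p, so a root moves to infinity exactly where
  \<open>e 0\<close> vanishes.\<close>

lemma coeff_root_poly_top: "coeff (root_poly e p w q) p = (- 1) ^ p * e 0 q"
proof -
  have "coeff ([:w, -1:] ^ (p - i)) p = 0" if "i \<in> {..p} - {0}" for i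
  proof (rule coeff_eq_0)
    have "degree ([:w, -1:] ^ (p - i)) \<le> degree [:w, -1:] * (p - i)" by (rule degree_power_le)
    then show "degree ([:w, -1:] ^ (p - i)) < p" using that by auto
  qed
  then have "coeff (root_poly e p w q) p = (\<Sum>i\<in>{0}. coeff (Polynomial.smult (e i q) ([:w, -1:] ^ (p - i))) p)"
    unfolding root_poly_def coeff_sum by (intro sum.mono_neutral_right) auto
  then show ?thesis by (simp add: coeff_linear_power_top)
qed

lemma degree_root_poly_eq:
  assumes "e 0 q \<noteq> 0"
  shows "degree (root_poly e p w q) = p"
proof (rule antisym[OF degree_root_poly])
  have "coeff (root_poly e p w q) p \<noteq> 0" using assms by (simp add: coeff_root_poly_top)
  then show "p \<le> degree (root_poly e p w q)" by (rule le_degree)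
qed

lemma qpoly_coeff_root_poly:
  assumes e: "\<And>i. i \<le> p \<Longrightarrow> e i holomorphic_on ball 0 1" and w: "qpoly w"
  shows "qpoly (\<lambda>z. coeff (root_poly e p (w z) (qpar z)) n)"
proof -
  have lin: "qpoly (\<lambda>z. coeff ([:w z, -1:] ^ k) n)" for k n
  proof (induction k arbitrary: n)
    case (Suc k)
    have "coeff ([:w z, -1:] ^ Suc k) n = w z * coeff ([:w z, -1:] ^ k) n +
        (-1) * (case n of 0 \<Rightarrow> 0 | Suc m \<Rightarrow> coeff ([:w z, -1:] ^ k) m)" for z
      by (cases n) (simp_all add: coeff_pCons)
    moreover have "qpoly (\<lambda>z. case n of 0 \<Rightarrow> 0 | Suc m \<Rightarrow> coeff ([:w z, -1:] ^ k) m)"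
      by (cases n) (auto intro: Suc qpoly_const)
    ultimately show ?case by (simp only:) (intro qpoly_add qpoly_mult w Suc qpoly_const)
  qed (auto simp: coeff_1 intro: qpoly_const)
  have "qpoly (\<lambda>z. \<Sum>i\<in>I. e i (qpar z) * coeff ([:w z, -1:] ^ (p - i)) n)" if "finite I" "I \<subseteq> {..p}" for I
    using that
    by (induction I rule: finite_induct) (auto intro!: qpoly_const qpoly_add qpoly_mult lin qpoly_qpar e)
  then show ?thesis unfolding root_poly_def coeff_sum coeff_smult by blast
qed

section \<open>Real roots over the boundary of the fundamental domain\<close>

text \<open>The last two assumptions are one symmetry on the projective line: a root l of the
  polynomial at -1 / z becomes the root -1 / l at z, and a vanishing leading coefficient, meaning l
  = infinity, becomes the root 0.\<close>

locale root_family =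
  fixes e :: "nat \<Rightarrow> complex \<Rightarrow> complex" and p :: nat
  assumes p_pos: "p > 0"
    and e_holo: "\<And>i. i \<le> p \<Longrightarrow> e i holomorphic_on ball 0 1"
    and lead_nz: "\<exists>z\<in>halfplane. e 0 (qpar z) \<noteq> 0"
    and inv_root: "\<And>z l. \<lbrakk>z \<in> halfplane; l \<noteq> 0; poly (root_poly e p (- 1 / z) (qpar (- 1 / z))) l = 0\<rbrakk> \<Longrightarrow>
       poly (root_poly e p z (qpar z)) (- 1 / l) = 0"
    and inv_lead: "\<And>z. \<lbrakk>z \<in> halfplane; e 0 (qpar (- 1 / z)) = 0\<rbrakk> \<Longrightarrow> poly (root_poly e p z (qpar z)) 0 = 0"
begin

definition A :: "complex \<Rightarrow> complex poly" where "A z = root_poly e p z (qpar z)"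

lemma A_shift: "poly (A (z + of_int n)) l = poly (A z) (l - of_int n)"
  by (simp add: A_def poly_root_poly qpar_add_of_int algebra_simps)

text \<open>Passing from z to z + n shifts every root by n, so the differences z + n - l form the
  same finite set for all n.\<close>

lemma A_bound:
  assumes "e 0 (qpar z) \<noteq> 0"
  obtains M where "M \<ge> 0" "\<And>n l. poly (A (z + of_int n)) l = 0 \<Longrightarrow> norm (z + of_int n - l) \<le> M"
proof -
  have "coeff (A z) p \<noteq> 0" using assms by (simp add: A_def coeff_root_poly_top)
  then have "A z \<noteq> 0" by auto
  then have "finite {l. poly (A z) l = 0}" by (rule poly_roots_finite)
  then have "bounded ((\<lambda>l. z - l) ` {l. poly (A z) l = 0})" by (intro finite_imp_bounded finite_imageI)
  then obtain M where M: "\<And>l. poly (A z) l = 0 \<Longrightarrow> norm (z - l) \<le> M"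
    unfolding bounded_iff by auto
  show ?thesis
  proof (rule that[of "\<bar>M\<bar>"])
    fix n l assume "poly (A (z + of_int n)) l = 0"
    then have "norm (z - (l - of_int n)) \<le> M" unfolding A_shift by (rule M)
    then show "norm (z + of_int n - l) \<le> \<bar>M\<bar>" by (simp add: algebra_simps)
  qed simp
qed

text \<open>Schwarz reflection: it conjugates the Taylor coefficients at 0, so holomorphy is
  kept.\<close>

definition e_star :: "nat \<Rightarrow> complex \<Rightarrow> complex" where "e_star i q = cnj (e i (cnj q))"

lemma e_star_holo: "i \<le> p \<Longrightarrow> e_star i holomorphic_on ball 0 1"
proof -
  assume i: "i \<le> p"
  have "cnj ` ball 0 1 = (ball 0 1 :: complex set)"
  proof safe
    fix x :: complex assume "x \<in> ball 0 1"
    then show "x \<in> cnj ` ball 0 1" by (intro image_eqI[of _ _ "cnj x"]) auto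
  qed auto
  then have "cnj \<circ> e i \<circ> cnj holomorphic_on ball 0 1"
    using e_holo[OF i] by (intro holomorphic_on_compose_cnj_cnj) auto
  then show ?thesis by (simp add: e_star_def[abs_def] o_def)
qed

lemma qpar_reflect: "qpar (- cnj z) = cnj (qpar z)"
  by (simp add: qpar_def exp_cnj)

lemma qpar_reflect': "qpar (- 1 - cnj z) = cnj (qpar z)"
proof -
  have "- 1 - cnj z = - cnj z + of_int (- 1)" by simp
  then show ?thesis by (simp only: qpar_add_of_int qpar_reflect)
qed

text \<open>Two holomorphic functions that do not vanish identically have a common point where
  neither vanishes. The condition at the mirror point - cnj z is made holomorphic in z by means of
  \<open>e_star\<close>.\<close>

lemma generic_point:
  obtains z where "z \<in> halfplane" "e 0 (qpar z) \<noteq> 0" "e 0 (qpar (- cnj z)) \<noteq> 0"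
proof -
  obtain z1 where z1: "z1 \<in> halfplane" "e 0 (qpar z1) \<noteq> 0" using lead_nz by blast
  have h: "(\<lambda>z. e 0 (qpar z)) holomorphic_on halfplane" "(\<lambda>z. e_star 0 (qpar z)) holomorphic_on halfplane"
    by (intro holomorphic_on_qpar e_holo e_star_holo; simp)+
  have "- cnj z1 \<in> halfplane" using z1 by (simp add: halfplane_def)
  moreover have "e_star 0 (qpar (- cnj z1)) \<noteq> 0" using z1 by (simp add: e_star_def qpar_reflect)
  ultimately have "\<forall>\<^sub>F w in at z1. e_star 0 (qpar w) \<noteq> 0 \<and> w \<in> halfplane"
    by (intro non_zero_neighbour_alt[OF h(2) halfplane_topology(1,2) z1(1)])
  moreover have "\<forall>\<^sub>F w in at z1. e 0 (qpar w) \<noteq> 0 \<and> w \<in> halfplane"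
    by (rule non_zero_neighbour_alt[OF h(1) halfplane_topology(1,2) z1(1) z1])
  ultimately have "\<forall>\<^sub>F w in at z1. w \<in> halfplane \<and> e 0 (qpar w) \<noteq> 0 \<and> e_star 0 (qpar w) \<noteq> 0"
    by eventually_elim auto
  then obtain w where "w \<in> halfplane" "e 0 (qpar w) \<noteq> 0" "e_star 0 (qpar w) \<noteq> 0"
    using eventually_happens'[of "at z1"] by auto
  then show ?thesis by (intro that[of w]) (simp_all add: e_star_def qpar_reflect)
qed

text \<open>On the line \<open>Re z = - 1/2\<close> we have \<open>z = - 1 - cnj z\<close>, so a real root of \<open>A z\<close> is
  also a root of the polynomial \<open>B z\<close> below, whose coefficients are holomorphic in \<open>z\<close>. At
  \<open>z + n\<close> the roots of the two polynomials drift in opposite directions as \<open>n\<close> grows.\<close>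

lemma finite_real_roots_line:
  "finite {z. Re z = - 1/2 \<and> Im z \<ge> 1/2 \<and> (\<exists>l::real. poly (A z) (of_real l) = 0)}"
proof -
  define B where "B = (\<lambda>z. root_poly e_star p (- 1 - z) (qpar z))"
  define \<rho> where "\<rho> = (\<lambda>z. resultant_sub p p (A z) (B z))"
  have poly_B: "poly (B z) l = cnj (poly (A (- 1 - cnj z)) (cnj l))" for z l
    by (simp add: B_def A_def poly_root_poly e_star_def qpar_reflect')
  have w: "qpoly (\<lambda>z. - 1 - z)"
    using qpoly_add[OF qpoly_const[of "-1"] qpoly_mult[OF qpoly_const[of "-1"] qpoly_ident]] by simp
  have q\<rho>: "qpoly \<rho>" unfolding \<rho>_def A_def B_def
    by (rule resultant_sub_closed[of qpoly])
       (intro qpoly_const qpoly_add qpoly_mult qpoly_coeff_root_poly e_holo e_star_holo qpoly_ident w | assumption)+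
  obtain z where z: "z \<in> halfplane" "e 0 (qpar z) \<noteq> 0" "e 0 (qpar (- cnj z)) \<noteq> 0" by (rule generic_point)
  obtain M where M: "M \<ge> 0" "\<And>n l. poly (A (z + of_int n)) l = 0 \<Longrightarrow> norm (z + of_int n - l) \<le> M"
    using A_bound[OF z(2)] by blast
  obtain M' where M': "M' \<ge> 0" "\<And>n l. poly (A (- cnj z + of_int n)) l = 0 \<Longrightarrow> norm (- cnj z + of_int n - l) \<le> M'"
    using A_bound[OF z(3)] by blast
  \<comment> \<open>A common root l would lie within M of z + n and within M' of -(z + n + 1), two
    points at distance at least 2 n - |2 z + 1|.\<close>
  obtain n :: nat where n: "real n > M + M' + norm (2 * z + 1)" using reals_Archimedean2 by blast
  define z1 where "z1 = z + of_int (int n)"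
  have z1: "z1 \<in> halfplane" using z by (simp add: z1_def halfplane_def)
  have q1: "qpar z1 = qpar z" unfolding z1_def by (rule qpar_add_of_int)
  have "\<rho> z1 \<noteq> 0" unfolding \<rho>_def
  proof (rule resultant_sub_nonzero)
    show "degree (A z1) = p" unfolding A_def using z q1 by (intro degree_root_poly_eq) simp
    then show "A z1 \<noteq> 0" using p_pos by auto
    show "degree (B z1) = p" unfolding B_def
      using z(3) q1 by (intro degree_root_poly_eq) (simp add: e_star_def qpar_reflect)
    fix l assume l: "poly (A z1) l = 0" "poly (B z1) l = 0"
    have 1: "norm (z + of_nat n - l) \<le> M" using M(2)[of "int n" l] l(1) by (simp add: z1_def)
    have "- 1 - cnj z1 = - cnj z + of_int (- int n - 1)" by (simp add: z1_def)
    then have "poly (A (- cnj z + of_int (- int n - 1))) (cnj l) = 0"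
      using l(2) unfolding poly_B by (simp only: complex_cnj_zero_iff)
    then have "norm (- cnj z + of_int (- int n - 1) - cnj l) \<le> M'" by (rule M')
    moreover have "- cnj z + of_int (- int n - 1) - cnj l = - cnj (z + of_nat n + 1 + l)" by simp
    ultimately have 2: "norm (z + of_nat n + 1 + l) \<le> M'"
      by (simp only: norm_minus_cancel complex_mod_cnj)
    have "of_nat (2 * n) = (z + of_nat n - l) + (z + of_nat n + 1 + l) - (2 * z + 1)" by simp
    then have "real (2 * n) \<le> norm (z + of_nat n - l) + norm (z + of_nat n + 1 + l) + norm (2 * z + 1)"
      by (metis norm_of_nat norm_triangle_ineq norm_triangle_ineq4 add_right_mono order_trans)
    with 1 2 n M M' show False by simp
  qed
  then obtain Y where Y: "\<And>z. \<bar>Re z\<bar> \<le> 1/2 \<Longrightarrow> Im z \<ge> Y \<Longrightarrow> \<rho> z \<noteq> 0"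
    using qpoly_nonvanishing[OF q\<rho> z1] by blast
  \<comment> \<open>A degenerate box, namely a vertical segment; above height Y the resultant has no
    zeros on the line, by the \<open>qpoly\<close> property.\<close>
  define K where "K = cbox (Complex (-1/2) (1/2)) (Complex (-1/2) Y)"
  have "finite {z \<in> K. \<rho> z = 0}"
    by (rule finite_zeros_on_compact[OF qpoly_holomorphic[OF q\<rho>] halfplane_topology(1,2) _ _ z1 \<open>\<rho> z1 \<noteq> 0\<close>])
       (auto simp: K_def halfplane_def in_cbox_complex_iff)
  moreover have "{z. Re z = - 1/2 \<and> Im z \<ge> 1/2 \<and> (\<exists>l::real. poly (A z) (of_real l) = 0)} \<subseteq> {z \<in> K. \<rho> z = 0}"
  proof safe
    fix z and l :: real
    assume zz: "Re z = - 1/2" "Im z \<ge> 1/2" and l: "poly (A z) (of_real l) = 0"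
    have "- 1 - cnj z = z" using zz by (simp add: complex_eq_iff)
    then have "poly (B z) (of_real l) = 0" using l by (simp add: poly_B)
    then show \<rho>0: "\<rho> z = 0" unfolding \<rho>_def using l
      by (intro resultant_sub_common_root[OF _ _ p_pos]) (auto simp: A_def B_def degree_root_poly)
    then have "Im z \<le> Y" using Y[of z] zz by (cases "Y \<le> Im z") auto
    then show "z \<in> K" using zz by (simp add: K_def in_cbox_complex_iff)
  qed
  ultimately show ?thesis by (rule finite_subset[rotated])
qed

text \<open>On the unit circle \<open>z = 1 / cnj z\<close>; the inversion turns \<open>1 / cnj (z + n)\<close> into \<open>- cnj z - n\<close>.\<close>

lemma finite_real_roots_arc:
  "finite {z. norm z = 1 \<and> Im z \<ge> 1/2 \<and> (\<exists>l::real. poly (A z) (of_real l) = 0)}"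
proof -
  \<comment> \<open>Holomorphic in z after two conjugations, but it involves
    \<open>qpar (- 1 / z)\<close>, so only holomorphy is used. That is enough, because the arc is
    compact.\<close>
  define B where "B = (\<lambda>z. map_poly cnj (A (1 / cnj z)))"
  define \<rho> where "\<rho> = (\<lambda>z. resultant_sub p p (A z) (B z))"
  have poly_B: "poly (B z) l = cnj (poly (A (1 / cnj z)) (cnj l))" for z l
    using poly_cnj[of "A (1 / cnj z)" "cnj l"] by (simp add: B_def)
  have coeff_B: "coeff (B z) i = cnj (coeff (A (1 / cnj z)) i)" for z i
    by (simp add: B_def coeff_map_poly)
  have deg_B: "degree (B z) = degree (A (1 / cnj z))" for z
    unfolding B_def by (rule Polynomial.degree_map_poly) auto
  have cA: "(\<lambda>z. coeff (A z) i) holomorphic_on halfplane" for i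
    unfolding A_def by (intro qpoly_holomorphic qpoly_coeff_root_poly e_holo qpoly_ident)
  have cB: "(\<lambda>z. coeff (B z) i) holomorphic_on halfplane" for i
  proof -
    let ?L = "{z. Im z < 0}"
    have "cnj ` ?L = halfplane" by (auto simp: halfplane_def image_iff intro!: exI[of _ "cnj _"])
    then have c: "cnj \<circ> (\<lambda>z. coeff (A z) i) \<circ> cnj holomorphic_on ?L"
      using cA by (intro holomorphic_on_compose_cnj_cnj) (auto simp: open_halfspace_Im_lt)
    have inv: "(\<lambda>z. 1 / z) holomorphic_on halfplane" by (intro holomorphic_intros) (auto simp: halfplane_def)
    have "(\<lambda>z. 1 / z) ` halfplane \<subseteq> ?L"
      by (auto simp: halfplane_def Im_divide sum_squares_gt_zero_iff power2_eq_square)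
    then have "(cnj \<circ> (\<lambda>z. coeff (A z) i) \<circ> cnj) \<circ> (\<lambda>z. 1 / z) holomorphic_on halfplane"
      using holomorphic_on_compose_gen[OF inv c] by blast
    then show ?thesis by (simp add: o_def coeff_B)
  qed
  have h\<rho>: "\<rho> holomorphic_on halfplane" unfolding \<rho>_def
    by (rule resultant_sub_closed[of "\<lambda>f. f holomorphic_on halfplane"])
       (intro holomorphic_on_const holomorphic_on_add holomorphic_on_mult cA cB | assumption)+
  obtain z where z: "z \<in> halfplane" "e 0 (qpar z) \<noteq> 0" "e 0 (qpar (- cnj z)) \<noteq> 0" by (rule generic_point)
  obtain M where M: "M \<ge> 0" "\<And>n l. poly (A (z + of_int n)) l = 0 \<Longrightarrow> norm (z + of_int n - l) \<le> M"
    using A_bound[OF z(2)] by blast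
  obtain M' where M': "M' \<ge> 0" "\<And>n l. poly (A (- cnj z + of_int n)) l = 0 \<Longrightarrow> norm (- cnj z + of_int n - l) \<le> M'"
    using A_bound[OF z(3)] by blast
  \<comment> \<open>Once |z1| > M + M' + 1, a root l of \<open>A z1\<close> has |l| > 1. A common
    root would make -1 / cnj l a root of \<open>A u\<close>, of norm less than 1 and yet within M'
    of u.\<close>
  obtain n :: nat where n: "real n > M + M' + norm z + 1" using reals_Archimedean2 by blast
  define z1 where "z1 = z + of_int (int n)"
  define u where "u = - cnj z + of_int (- int n)"
  have z1: "z1 \<in> halfplane" using z by (simp add: z1_def halfplane_def)
  have q1: "qpar z1 = qpar z" unfolding z1_def by (rule qpar_add_of_int)
  have uz: "u = - cnj z1" by (simp add: u_def z1_def)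
  have u: "1 / cnj z1 = - 1 / u" "u \<in> halfplane" "norm u = norm z1"
    using z1 unfolding uz by (simp_all add: halfplane_def)
  have big: "norm z1 > M + M' + 1"
    using norm_triangle_ineq4[of z1 z] n by (simp add: z1_def)
  have big_u: "norm u > M + M' + 1" using big u by simp
  have "\<rho> z1 \<noteq> 0" unfolding \<rho>_def
  proof (rule resultant_sub_nonzero)
    show "degree (A z1) = p" unfolding A_def using z q1 by (intro degree_root_poly_eq) simp
    then show "A z1 \<noteq> 0" using p_pos by auto
    \<comment> \<open>Otherwise the root infinity at -1 / u would correspond to the root 0 at u,
      which is too far from u.\<close>
    have "e 0 (qpar (- 1 / u)) \<noteq> 0"
    proof
      assume "e 0 (qpar (- 1 / u)) = 0"
      then have "poly (A u) 0 = 0" unfolding A_def by (rule inv_lead[OF u(2)])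
      then have "norm (u - 0) \<le> M'" unfolding u_def by (rule M')
      then show False using big_u M by simp
    qed
    then have "degree (A (1 / cnj z1)) = p" unfolding A_def u(1) by (rule degree_root_poly_eq)
    then show "degree (B z1) = p" by (simp only: deg_B)
    fix l assume l: "poly (A z1) l = 0" "poly (B z1) l = 0"
    have 1: "norm (z1 - l) \<le> M" using M(2)[of "int n" l] l(1) by (simp add: z1_def)
    have l1: "norm l > 1" using norm_triangle_ineq4[of "z1" "z1 - l"] norm_triangle_ineq2[of z1 "z1 - l"] 1 big M' by simp
    then have "l \<noteq> 0" by auto
    have "poly (A (- 1 / u)) (cnj l) = 0" using l(2) unfolding poly_B u(1) by simp
    then have "poly (A u) (- 1 / cnj l) = 0" unfolding A_def
      using \<open>l \<noteq> 0\<close> by (intro inv_root[OF u(2)]) auto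
    then have "norm (u - (- 1 / cnj l)) \<le> M'" unfolding u_def by (rule M')
    moreover have "norm u \<le> norm (u - (- 1 / cnj l)) + norm (1 / cnj l)"
      using norm_triangle_ineq4[of "u - (- 1 / cnj l)" "1 / cnj l"] by simp
    moreover have "norm (1 / cnj l) \<le> 1" using l1 by (simp add: norm_divide divide_le_eq_1)
    ultimately show False using big_u M by linarith
  qed
  define K where "K = sphere 0 1 \<inter> {z. Im z \<ge> 1/2}"
  have "compact K" unfolding K_def
    by (intro compact_Int_closed closed_halfspace_Im_ge compact_sphere)
  moreover have "K \<subseteq> halfplane" by (auto simp: K_def halfplane_def)
  ultimately have "finite {z \<in> K. \<rho> z = 0}"
    by (intro finite_zeros_on_compact[OF h\<rho> halfplane_topology(1,2) _ _ z1 \<open>\<rho> z1 \<noteq> 0\<close>])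
  moreover have "{z. norm z = 1 \<and> Im z \<ge> 1/2 \<and> (\<exists>l::real. poly (A z) (of_real l) = 0)} \<subseteq> {z \<in> K. \<rho> z = 0}"
  proof safe
    fix z and l :: real
    assume zz: "norm z = 1" "Im z \<ge> 1/2" and l: "poly (A z) (of_real l) = 0"
    have "z * cnj z = 1" using zz by (simp add: complex_norm_square[symmetric])
    moreover from this have "cnj z \<noteq> 0" by auto
    ultimately have "1 / cnj z = z" by (simp add: divide_eq_eq)
    then have "poly (B z) (of_real l) = 0" using l by (simp add: poly_B)
    then show "\<rho> z = 0" unfolding \<rho>_def using l
      by (intro resultant_sub_common_root[OF _ _ p_pos]) (auto simp: A_def deg_B degree_root_poly)
    show "z \<in> K" using zz by (simp add: K_def)
  qed
  ultimately show ?thesis by (rule finite_subset[rotated])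
qed

end

section \<open>Stability of the number of zeros\<close>

text \<open>On the compact set |F| has a positive minimum at l0, and uniform continuity keeps the
  change in l below it. The conclusion is the hypothesis of Rouche's theorem and also shows that F
  stays nonzero.\<close>

lemma nonvanishing_stable:
  fixes F :: "complex \<Rightarrow> real \<Rightarrow> complex"
  assumes C: "compact C" and F: "continuous_on (C \<times> UNIV) (\<lambda>(z, l). F z l)"
    and nz: "\<And>z. z \<in> C \<Longrightarrow> F z l0 \<noteq> 0"
  obtains \<delta> where "\<delta> > 0" "\<And>z l. z \<in> C \<Longrightarrow> \<bar>l - l0\<bar> < \<delta> \<Longrightarrow> norm (F z l - F z l0) < norm (F z l0)"
proof (cases "C = {}")
  case True
  then show ?thesis using that[of 1] by auto
next
  case False
  have "continuous_on C ((\<lambda>(z, l). F z l) \<circ> (\<lambda>z. (z, l0)))"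
    by (rule continuous_on_compose[OF _ continuous_on_subset[OF F]]) (auto intro!: continuous_intros)
  then have "continuous_on C (\<lambda>z. norm (F z l0))" by (simp add: o_def continuous_on_norm)
  then obtain z' where z': "z' \<in> C" "\<And>z. z \<in> C \<Longrightarrow> norm (F z' l0) \<le> norm (F z l0)"
    using continuous_attains_inf[OF C False] by blast
  define c where "c = norm (F z' l0)"
  have c: "c > 0" using nz[OF z'(1)] by (simp add: c_def)
  have "uniformly_continuous_on (C \<times> cball l0 1) (\<lambda>(z, l). F z l)"
    by (intro compact_uniformly_continuous compact_Times C continuous_on_subset[OF F]) auto
  then obtain \<delta> where \<delta>: "\<delta> > 0" "\<And>x y. x \<in> C \<times> cball l0 1 \<Longrightarrow> y \<in> C \<times> cball l0 1 \<Longrightarrow> dist y x < \<delta> \<Longrightarrow>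
      dist (case y of (z, l) \<Rightarrow> F z l) (case x of (z, l) \<Rightarrow> F z l) < c"
    unfolding uniformly_continuous_on_def using c by blast
  show ?thesis
  proof (rule that[of "min \<delta> 1"])
    fix z l assume z: "z \<in> C" and l: "\<bar>l - l0\<bar> < min \<delta> 1"
    have "dist (case (z, l) of (z, l) \<Rightarrow> F z l) (case (z, l0) of (z, l) \<Rightarrow> F z l) < c"
      by (rule \<delta>(2)) (use z l in \<open>auto simp: dist_Pair_Pair dist_real_def abs_minus_commute\<close>)
    then show "norm (F z l - F z l0) < norm (F z l0)"
      using z'(2)[OF z] by (simp add: dist_norm c_def)
  qed (use \<delta> in auto)
qed

lemma zero_count_stable:
  fixes F :: "complex \<Rightarrow> real \<Rightarrow> complex"
  assumes S: "open S" "connected S" and hol: "\<And>l. (\<lambda>z. F z l) holomorphic_on S"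
    and cont: "continuous_on (S \<times> UNIV) (\<lambda>(z, l). F z l)"
    and nz: "\<And>l. \<exists>z\<in>S. F z l \<noteq> 0" and z0: "z0 \<in> S" "F z0 l0 = 0" and \<epsilon>: "\<epsilon> > 0"
  obtains r \<delta> where "0 < r" "r < \<epsilon>" "ball z0 r \<subseteq> S" "\<delta> > 0"
    "\<And>l. \<bar>l - l0\<bar> < \<delta> \<Longrightarrow> finite {z \<in> ball z0 r. F z l = 0} \<and>
      (\<Sum>z | z \<in> ball z0 r \<and> F z l = 0. zorder (\<lambda>z. F z l) z) = zorder (\<lambda>z. F z l0) z0"
proof -
  obtain z1 where z1: "z1 \<in> S" "F z1 l0 \<noteq> 0" using nz by blast
  have "\<forall>\<^sub>F w in at z0. F w l0 \<noteq> 0 \<and> w \<in> S"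
    by (rule non_zero_neighbour_alt[OF hol S z0(1) z1])
  then obtain d where d: "d > 0" "\<And>w. w \<noteq> z0 \<Longrightarrow> dist w z0 < d \<Longrightarrow> F w l0 \<noteq> 0 \<and> w \<in> S"
    unfolding eventually_at by auto
  \<comment> \<open>Within radius 4 r there is no other zero at l0. Rouche's theorem is applied in
    the ball of radius 2 r, to the circle of radius r.\<close>
  define r where "r = min d \<epsilon> / 4"
  have r: "0 < r" "r < \<epsilon>" "4 * r \<le> d" using d \<epsilon> by (auto simp: r_def)
  have sub: "ball z0 (4 * r) \<subseteq> S"
  proof
    fix w assume "w \<in> ball z0 (4 * r)"
    then show "w \<in> S" using d(2)[of w] r(3) z0(1) by (cases "w = z0") (auto simp: dist_commute)
  qed
  define s where "s = ball z0 (2 * r)"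
  have s: "s \<subseteq> S" "cball z0 (2 * r) \<subseteq> S" "sphere z0 r \<subseteq> s" "ball z0 r \<subseteq> s"
    using sub r by (auto simp: s_def)
  have fin: "finite {z \<in> s. F z l = 0}" for l
  proof -
    obtain z2 where "z2 \<in> S" "F z2 l \<noteq> 0" using nz by blast
    then have "finite {z \<in> cball z0 (2 * r). F z l = 0}"
      using s by (intro finite_zeros_on_compact[OF hol S]) auto
    then show ?thesis by (rule finite_subset[rotated]) (auto simp: s_def)
  qed
  have zeros0: "{z \<in> s. F z l0 = 0} = {z0}"
  proof safe
    fix w assume "w \<in> s" "F w l0 = 0"
    then have "dist w z0 < d" using r by (simp add: s_def dist_commute)
    then show "w = z0" using d(2)[of w] \<open>F w l0 = 0\<close> by blast
  qed (use r z0 in \<open>auto simp: s_def\<close>)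
  have "continuous_on (sphere z0 r \<times> UNIV) (\<lambda>(z, l). F z l)"
    by (rule continuous_on_subset[OF cont]) (use s in auto)
  moreover have "F z l0 \<noteq> 0" if "z \<in> sphere z0 r" for z
  proof
    assume "F z l0 = 0"
    then have "z \<in> {z \<in> s. F z l0 = 0}" using that s(3) by auto
    then show False unfolding zeros0 using that r(1) by auto
  qed
  ultimately obtain \<delta> where \<delta>: "\<delta> > 0"
    "\<And>z l. z \<in> sphere z0 r \<Longrightarrow> \<bar>l - l0\<bar> < \<delta> \<Longrightarrow> norm (F z l - F z l0) < norm (F z l0)"
    using nonvanishing_stable[of "sphere z0 r" F l0, OF compact_sphere] by blast
  show ?thesis
  proof (rule that[OF r(1,2) _ \<delta>(1)])
    show "ball z0 r \<subseteq> S" using s by auto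
    fix l assume l: "\<bar>l - l0\<bar> < \<delta>"
    let ?\<gamma> = "circlepath z0 r"
    have eq: "F z l0 + (F z l - F z l0) = F z l" for z by simp
    have "(\<Sum>z\<in>{z \<in> s. F z l0 + (F z l - F z l0) = 0}. winding_number ?\<gamma> z * zorder (\<lambda>z. F z l0 + (F z l - F z l0)) z) =
        (\<Sum>z\<in>{z \<in> s. F z l0 = 0}. winding_number ?\<gamma> z * zorder (\<lambda>z. F z l0) z)"
    proof (rule Rouche_theorem)
      show "finite {p \<in> s. F p l0 + (F p l - F p l0) = 0}" unfolding eq by (rule fin)
      show "(\<lambda>z. F z l0) holomorphic_on s" by (rule holomorphic_on_subset[OF hol s(1)])
      show "(\<lambda>z. F z l - F z l0) holomorphic_on s"
        by (intro holomorphic_intros holomorphic_on_subset[OF hol s(1)])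
      show "path_image ?\<gamma> \<subseteq> s" using s(3) r by simp
      show "\<forall>z\<in>path_image ?\<gamma>. cmod (F z l - F z l0) < cmod (F z l0)"
        using \<delta>(2) l r by simp
      show "\<forall>z. z \<notin> s \<longrightarrow> winding_number ?\<gamma> z = 0"
        using s(3) r by (auto simp: s_def intro!: winding_number_zero_outside[of _ "ball z0 (2 * r)"])
      show "finite {p \<in> s. F p l0 = 0}" by (rule fin)
    qed (auto simp: s_def)
    then have sum: "(\<Sum>z\<in>{z \<in> s. F z l = 0}. winding_number ?\<gamma> z * zorder (\<lambda>z. F z l) z) =
        of_int (zorder (\<lambda>z. F z l0) z0)"
      unfolding eq zeros0 using r by (simp add: winding_number_circlepath)
    have zero_s: "z \<notin> sphere z0 r" if "F z l = 0" for z
      using \<delta>(2)[of z l] l that by fastforce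
    have "(\<Sum>z\<in>{z \<in> s. F z l = 0}. winding_number ?\<gamma> z * zorder (\<lambda>z. F z l) z) =
        (\<Sum>z\<in>{z \<in> ball z0 r. F z l = 0}. of_int (zorder (\<lambda>z. F z l) z))"
    proof (rule sum.mono_neutral_cong_right[OF fin])
      show "{z \<in> ball z0 r. F z l = 0} \<subseteq> {z \<in> s. F z l = 0}" using s by auto
      show "\<forall>z\<in>{z \<in> s. F z l = 0} - {z \<in> ball z0 r. F z l = 0}. winding_number ?\<gamma> z * zorder (\<lambda>z. F z l) z = 0"
      proof
        fix z assume z: "z \<in> {z \<in> s. F z l = 0} - {z \<in> ball z0 r. F z l = 0}"
        then have "z \<notin> cball z0 r" using zero_s[of z] by auto
        then have "winding_number ?\<gamma> z = 0"
          using r by (intro winding_number_zero_outside[of _ "cball z0 r"]) auto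
        then show "winding_number ?\<gamma> z * zorder (\<lambda>z. F z l) z = 0" by simp
      qed
      fix z assume "z \<in> {z \<in> ball z0 r. F z l = 0}"
      then have "winding_number ?\<gamma> z = 1"
        by (intro winding_number_circlepath) (auto simp: dist_norm norm_minus_commute)
      then show "winding_number ?\<gamma> z * zorder (\<lambda>z. F z l) z = of_int (zorder (\<lambda>z. F z l) z)" by simp
    qed
    with sum have "(of_int (\<Sum>z\<in>{z \<in> ball z0 r. F z l = 0}. zorder (\<lambda>z. F z l) z) :: complex) =
        of_int (zorder (\<lambda>z. F z l0) z0)" by simp
    then have "(\<Sum>z\<in>{z \<in> ball z0 r. F z l = 0}. zorder (\<lambda>z. F z l) z) = zorder (\<lambda>z. F z l0) z0"
      by (simp only: of_int_eq_iff)
    moreover have "finite {z \<in> ball z0 r. F z l = 0}"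
      by (rule finite_subset[OF _ fin[of l]]) (use s in auto)
    ultimately show "finite {z \<in> ball z0 r. F z l = 0} \<and>
      (\<Sum>z | z \<in> ball z0 r \<and> F z l = 0. zorder (\<lambda>z. F z l) z) = zorder (\<lambda>z. F z l0) z0" by simp
  qed
qed

text \<open>The closure of F without the cusp: both halves of the boundary belong to it, which makes
  its truncations compact. Selecting one half is left to a weight.\<close>

definition wedge :: "complex set" where
  "wedge = {z. \<bar>Re z\<bar> \<le> 1/2 \<and> norm z \<ge> 1 \<and> Im z > 0}"

definition wedge_int :: "complex set" where
  "wedge_int = {z. \<bar>Re z\<bar> < 1/2 \<and> norm z > 1 \<and> Im z > 0}"

lemma wedge_Im:
  assumes "z \<in> wedge"
  shows "Im z \<ge> 1/2"
proof (rule ccontr)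
  assume "\<not> Im z \<ge> 1/2"
  then have "\<bar>Im z\<bar> < 1/2" "\<bar>Re z\<bar> \<le> 1/2" using assms by (auto simp: wedge_def)
  then have "(Im z)\<^sup>2 \<le> (1/2)\<^sup>2" "(Re z)\<^sup>2 \<le> (1/2)\<^sup>2" by (auto intro!: abs_le_square_iff[THEN iffD1])
  then have "(norm z)\<^sup>2 \<le> 1/2" unfolding cmod_power2 by (simp add: power2_eq_square)
  moreover have "1 \<le> (norm z)\<^sup>2" using assms by (simp add: wedge_def one_le_power)
  ultimately show False by simp
qed

lemma wedge_subsets: "wedge \<subseteq> halfplane" "wedge_int \<subseteq> wedge"
  by (auto simp: wedge_def wedge_int_def halfplane_def)

lemma open_wedge_int: "open wedge_int"
proof -
  have eq: "wedge_int = {z. Re z < 1/2} \<inter> {z. Re z > - 1/2} \<inter> (- cball 0 1) \<inter> {z. Im z > 0}"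
    by (auto simp: wedge_int_def)
  show ?thesis unfolding eq
    by (intro open_Int open_halfspace_Re_lt open_halfspace_Re_gt open_halfspace_Im_gt open_Compl closed_cball)
qed

lemma compact_truncated_wedge: "compact {z \<in> wedge. Im z \<le> Y}"
proof -
  have "{z \<in> wedge. Im z \<le> Y} = cbox (Complex (- 1/2) (1/2)) (Complex (1/2) Y) \<inter> (- ball 0 1)"
    using wedge_Im by (auto simp: wedge_def in_cbox_complex_iff)
  then show ?thesis by (simp add: compact_Int_closed compact_cbox closed_Compl)
qed

section \<open>Zeros in the wedge as the real parameter varies\<close>

context root_family
begin

definition F :: "complex \<Rightarrow> real \<Rightarrow> complex" where "F z l = poly (A z) (of_real l)"

lemma coeff_A_holo: "(\<lambda>z. coeff (A z) i) holomorphic_on halfplane"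
  unfolding A_def by (intro qpoly_holomorphic qpoly_coeff_root_poly e_holo qpoly_ident)

lemma degree_A: "degree (A z) \<le> p"
  by (simp add: A_def degree_root_poly)

lemma F_eq: "F z l = (\<Sum>i\<le>p. coeff (A z) i * of_real l ^ i)"
  unfolding F_def by (rule poly_eq_sum_atMost[OF degree_A])

lemma F_holo: "(\<lambda>z. F z l) holomorphic_on halfplane"
  unfolding F_eq by (intro holomorphic_intros coeff_A_holo)

lemma F_cont: "continuous_on (halfplane \<times> UNIV) (\<lambda>(z, l). F z l)"
proof -
  have "continuous_on (halfplane \<times> UNIV) (\<lambda>x. coeff (A (fst x)) i)" for i
    by (rule continuous_on_compose2[OF holomorphic_on_imp_continuous_on[OF coeff_A_holo]])
       (auto intro: continuous_on_fst)
  then show ?thesis unfolding F_eq case_prod_unfold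
    by (intro continuous_intros) auto
qed

text \<open>F is a polynomial in z - l over power series in q, so the leading power of q dominates
  high up, uniformly in bounded l. No zero can escape to the cusp.\<close>

lemma F_nonzero_at_infinity:
  obtains Y where "\<And>z l. \<bar>Re z\<bar> \<le> 1/2 \<Longrightarrow> Im z \<ge> Y \<Longrightarrow> \<bar>l\<bar> \<le> \<Lambda> \<Longrightarrow> F z l \<noteq> 0"
proof -
  obtain z1 where z1: "z1 \<in> halfplane" "e 0 (qpar z1) \<noteq> 0" using lead_nz by blast
  have q1: "norm (qpar z1) < 1" using z1 by (simp add: halfplane_def qpar_in_ball)
  have eh: "e (p - m) holomorphic_on ball 0 1" if "m \<le> p" for m by (rule e_holo) simp
  have "e (p - p) (qpar z1) \<noteq> 0" using z1 by simp
  then obtain Y where Y: "Y > 0" "\<And>x q. norm x \<ge> Y \<Longrightarrow> q \<noteq> 0 \<Longrightarrow> norm q \<le> 1/2 \<Longrightarrow>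
    norm q * norm x ^ p * Y \<le> 1 \<Longrightarrow> (\<Sum>m\<le>p. e (p - m) q * x ^ m) \<noteq> 0"
    using poly_in_q_nonvanishing[of p "\<lambda>m. e (p - m)" p "qpar z1", OF eh le_refl q1] by blast
  obtain Y1 where Y1: "\<And>z l. \<lbrakk>\<bar>Re z\<bar> \<le> 1/2; Im z \<ge> Y1; norm l \<le> \<Lambda>; Im l = 0\<rbrakk> \<Longrightarrow>
     Im z > 0 \<and> norm (z - l) \<ge> Y \<and> norm (qpar z) \<le> 1/2 \<and> norm (qpar z) * norm (z - l) ^ p * Y \<le> 1"
    using strip_estimates[where \<Lambda> = \<Lambda> and Y = Y and N = p] by blast
  show ?thesis
  proof (rule that[of Y1])
    fix z and l :: real assume z: "\<bar>Re z\<bar> \<le> 1/2" "Im z \<ge> Y1" and l: "\<bar>l\<bar> \<le> \<Lambda>"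
    have "F z l = (\<Sum>m\<le>p. e (p - m) (qpar z) * (z - of_real l) ^ m)"
      unfolding F_def A_def poly_root_poly
      by (rule sum.reindex_bij_witness[of _ "\<lambda>m. p - m" "\<lambda>i. p - i"]) auto
    also have "\<dots> \<noteq> 0"
      using Y1[OF z, of "of_real l"] l by (intro Y(2)) (auto simp: qpar_nonzero)
    finally show "F z l \<noteq> 0" .
  qed
qed

lemma F_nonzero: "\<exists>z\<in>halfplane. F z l \<noteq> 0"
proof -
  obtain Y where Y: "\<And>z l'. \<bar>Re z\<bar> \<le> 1/2 \<Longrightarrow> Im z \<ge> Y \<Longrightarrow> \<bar>l'\<bar> \<le> \<bar>l\<bar> \<Longrightarrow> F z l' \<noteq> 0"
    using F_nonzero_at_infinity[of "\<bar>l\<bar>"] by blast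
  have "F (Complex 0 (max Y 1)) l \<noteq> 0" by (rule Y) auto
  then show ?thesis by (rule bexI) (simp add: halfplane_def)
qed

lemma zorder_F_pos_iff:
  assumes "z \<in> halfplane"
  shows "zorder (\<lambda>z. F z l) z > 0 \<longleftrightarrow> F z l = 0" "zorder (\<lambda>z. F z l) z \<ge> 0"
proof -
  obtain z1 where z1: "z1 \<in> halfplane" "F z1 l \<noteq> 0" using F_nonzero by blast
  have "\<forall>\<^sub>F w in at z. F w l \<noteq> 0 \<and> w \<in> halfplane"
    by (rule non_zero_neighbour_alt[OF F_holo halfplane_topology(1,2) assms z1])
  then have ev: "\<exists>\<^sub>F w in at z. F w l \<noteq> 0"
    by (intro eventually_frequently) (auto elim: eventually_mono)
  show "zorder (\<lambda>z. F z l) z > 0 \<longleftrightarrow> F z l = 0"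
    by (rule zorder_pos_iff[OF F_holo halfplane_topology(1) assms ev])
  have "(\<lambda>z. F z l) analytic_on {z}"
    using F_holo halfplane_topology(1) assms by (auto simp: analytic_at)
  then show "zorder (\<lambda>z. F z l) z \<ge> 0" using ev by (rule zorder_ge_0)
qed

text \<open>Let (z - z0)^n be the largest common factor of all coefficients. The cofactor at z0 is a
  nonzero polynomial in l, and the order is n unless l is one of its finitely many roots.\<close>

lemma zorder_generic:
  assumes "z0 \<in> halfplane"
  shows "\<exists>m. \<exists>B. finite B \<and> (\<forall>l. l \<notin> B \<longrightarrow> zorder (\<lambda>z. F z l) z0 = int m)"
proof -
  obtain z1 where z1: "z1 \<in> halfplane" "e 0 (qpar z1) \<noteq> 0" using lead_nz by blast
  then have nz: "coeff (A z1) p \<noteq> 0" by (simp add: A_def coeff_root_poly_top)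
  have "\<exists>n s. (\<forall>i\<le>p. s i holomorphic_on halfplane) \<and>
    (\<forall>i\<le>p. \<forall>z\<in>halfplane. coeff (A z) i = (z - z0) ^ n * s i z) \<and> (\<exists>i\<le>p. s i z0 \<noteq> 0)"
    by (rule holomorphic_common_factor[of halfplane z0 p "\<lambda>i z. coeff (A z) i" p z1,
        OF halfplane_topology(1,2) assms coeff_A_holo le_refl z1(1) nz]) auto
  then obtain n s where s': "\<forall>i\<le>p. s i holomorphic_on halfplane"
    "\<forall>i\<le>p. \<forall>z\<in>halfplane. coeff (A z) i = (z - z0) ^ n * s i z" "\<exists>i\<le>p. s i z0 \<noteq> 0"
    by blast
  note s = s'(1)[rule_format] s'(2)[rule_format] s'(3)
  define P where "P = (\<Sum>i\<le>p. monom (s i z0) i)"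
  have "coeff P i = s i z0" if "i \<le> p" for i
    unfolding P_def coeff_sum using that by (simp add: coeff_monom sum.delta)
  then have "P \<noteq> 0" using s(3) by (metis coeff_0)
  then have "finite {l. poly P l = 0}" by (rule poly_roots_finite)
  then have fin: "finite {l :: real. poly P (of_real l) = 0}"
    using finite_vimageI[OF _ inj_of_real, of "{l. poly P l = 0}"] by (simp add: vimage_def)
  have "zorder (\<lambda>z. F z l) z0 = int n" if "poly P (of_real l) \<noteq> 0" for l
  proof (rule zorder_eqI[where S = halfplane and g = "\<lambda>z. \<Sum>i\<le>p. s i z * of_real l ^ i"])
    show "(\<lambda>z. \<Sum>i\<le>p. s i z * of_real l ^ i) holomorphic_on halfplane"
      by (intro holomorphic_intros s) auto
    show "(\<Sum>i\<le>p. s i z0 * of_real l ^ i) \<noteq> 0"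
      using that by (simp add: P_def poly_sum poly_monom)
    fix w assume w: "w \<in> halfplane"
    have "F w l = (\<Sum>i\<le>p. s i w * of_real l ^ i * (w - z0) ^ n)"
      unfolding F_eq by (rule sum.cong) (use s(2)[OF _ w] in auto)
    then show "F w l = (\<Sum>i\<le>p. s i w * of_real l ^ i) * (w - z0) powi int n"
      by (simp add: sum_distrib_right)
  qed (use assms halfplane_topology in auto)
  with fin show ?thesis by blast
qed

definition boundary_zeros :: "complex set" where
  "boundary_zeros = {z \<in> wedge - wedge_int. \<exists>l. F z l = 0}"

lemma F_shift: "F (z + 1) l = F z (l - 1)"
  using A_shift[of z 1 "of_real l"] by (simp add: F_def)

text \<open>The right edge is the left edge translated by 1, with l shifted along, so the line Re z
  = - 1/2 and the arc suffice.\<close>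

lemma finite_boundary_zeros: "finite boundary_zeros"
proof -
  let ?L = "{z. Re z = - 1/2 \<and> Im z \<ge> 1/2 \<and> (\<exists>l::real. poly (A z) (of_real l) = 0)}"
  let ?C = "{z. norm z = 1 \<and> Im z \<ge> 1/2 \<and> (\<exists>l::real. poly (A z) (of_real l) = 0)}"
  have "boundary_zeros \<subseteq> ?L \<union> (\<lambda>z. z + 1) ` ?L \<union> ?C"
  proof
    fix z assume z: "z \<in> boundary_zeros"
    then obtain l where l: "F z l = 0" by (auto simp: boundary_zeros_def)
    have Im: "Im z \<ge> 1/2" using z wedge_Im by (auto simp: boundary_zeros_def)
    have "norm z = 1 \<or> Re z = - 1/2 \<or> Re z = 1/2"
      using z by (auto simp: boundary_zeros_def wedge_def wedge_int_def)
    then consider "norm z = 1" | "Re z = - 1/2" | "Re z = 1/2" by blast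
    then show "z \<in> ?L \<union> (\<lambda>z. z + 1) ` ?L \<union> ?C"
    proof cases
      case 3
      have "F (z - 1) (l - 1) = 0" using F_shift[of "z - 1" l] l by simp
      then have "\<exists>l::real. poly (A (z - 1)) (of_real l) = 0" unfolding F_def by blast
      then have "z - 1 \<in> ?L" using 3 Im by simp
      then have "z \<in> (\<lambda>z. z + 1) ` ?L" by (intro image_eqI[of _ _ "z - 1"]) auto
      then show ?thesis by blast
    qed (use l Im in \<open>auto simp: F_def\<close>)
  qed
  then show ?thesis
    using finite_real_roots_line finite_real_roots_arc by (meson finite_UnI finite_imageI finite_subset)
qed

lemma boundary_orders:
  obtains B m where "finite B" "\<And>z l. z \<in> boundary_zeros \<Longrightarrow> l \<notin> B \<Longrightarrow> zorder (\<lambda>z. F z l) z = m z"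
proof -
  have "\<forall>z\<in>boundary_zeros. \<exists>m B. finite B \<and> (\<forall>l. l \<notin> B \<longrightarrow> zorder (\<lambda>z. F z l) z = int m)"
    using zorder_generic wedge_subsets by (auto simp: boundary_zeros_def)
  then obtain m B where mB: "\<And>z. z \<in> boundary_zeros \<Longrightarrow> finite (B z) \<and> (\<forall>l. l \<notin> B z \<longrightarrow> zorder (\<lambda>z. F z l) z = int (m z))"
    by metis
  show ?thesis
    by (rule that[of "\<Union>z\<in>boundary_zeros. B z" "\<lambda>z. int (m z)"]) (use finite_boundary_zeros mB in auto)
qed

lemma finite_wedge_zeros: "finite {z \<in> wedge. F z l = 0}"
proof -
  obtain Y where Y: "\<And>z l'. \<bar>Re z\<bar> \<le> 1/2 \<Longrightarrow> Im z \<ge> Y \<Longrightarrow> \<bar>l'\<bar> \<le> \<bar>l\<bar> \<Longrightarrow> F z l' \<noteq> 0"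
    using F_nonzero_at_infinity[of "\<bar>l\<bar>"] by blast
  obtain z1 where z1: "z1 \<in> halfplane" "F z1 l \<noteq> 0" using F_nonzero by blast
  have "finite {z \<in> {z \<in> wedge. Im z \<le> Y}. F z l = 0}"
    by (rule finite_zeros_on_compact[OF F_holo halfplane_topology(1,2) compact_truncated_wedge _ z1])
       (use wedge_subsets in auto)
  moreover have "{z \<in> wedge. F z l = 0} \<subseteq> {z \<in> {z \<in> wedge. Im z \<le> Y}. F z l = 0}"
    using Y[of _ l] by (auto simp: wedge_def) (meson le_cases)
  ultimately show ?thesis by (rule finite_subset[rotated])
qed

definition \<nu> :: "(complex \<Rightarrow> real) \<Rightarrow> real \<Rightarrow> real" where
  "\<nu> wt l = (\<Sum>z | z \<in> wedge \<and> F z l = 0. wt z * of_int (zorder (\<lambda>z. F z l) z))"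

text \<open>For l near l0 every zero in the wedge lies in a small disc around a zero at l0. An
  interior zero may split, but its pieces stay where the weight is 1. For l outside B a boundary
  zero keeps its order, which exhausts the count of its disc, so nothing enters or leaves through
  the boundary.\<close>

lemma \<nu>_locally_constant:
  assumes B: "finite B" "\<And>z l. z \<in> boundary_zeros \<Longrightarrow> l \<notin> B \<Longrightarrow> zorder (\<lambda>z. F z l) z = m z"
    and l0: "l0 \<notin> B" and wt: "\<And>z. z \<in> wedge_int \<Longrightarrow> wt z = 1"
  shows "\<exists>\<delta>>0. \<forall>l. \<bar>l - l0\<bar> < \<delta> \<longrightarrow> \<nu> wt l = \<nu> wt l0"
proof -
  define Z where "Z = {z \<in> wedge. F z l0 = 0}"
  have finZ: "finite Z" unfolding Z_def by (rule finite_wedge_zeros)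
  obtain Y where Y: "\<And>z l. \<bar>Re z\<bar> \<le> 1/2 \<Longrightarrow> Im z \<ge> Y \<Longrightarrow> \<bar>l\<bar> \<le> \<bar>l0\<bar> + 1 \<Longrightarrow> F z l \<noteq> 0"
    using F_nonzero_at_infinity[of "\<bar>l0\<bar> + 1"] by blast
  \<comment> \<open>Radii that keep the discs around distinct zeros disjoint, and the discs around
    interior zeros inside the interior.\<close>
  have "\<exists>d>0. (\<forall>w\<in>Z. w \<noteq> z \<longrightarrow> 2 * d \<le> dist z w) \<and> (z \<in> wedge_int \<longrightarrow> ball z d \<subseteq> wedge_int)" for z
  proof -
    obtain d1 where d1: "d1 > 0" "\<And>w. w \<in> Z \<Longrightarrow> w \<noteq> z \<Longrightarrow> d1 \<le> dist z w"
      using finite_set_avoid[OF finZ, of z] by blast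
    have "\<exists>d2>0. z \<in> wedge_int \<longrightarrow> ball z d2 \<subseteq> wedge_int"
      using open_wedge_int unfolding open_contains_ball by (cases "z \<in> wedge_int") (auto intro: exI[of _ 1])
    then obtain d2 where d2: "d2 > 0" "z \<in> wedge_int \<Longrightarrow> ball z d2 \<subseteq> wedge_int" by blast
    show ?thesis
    proof (intro exI[of _ "min (d1 / 2) d2"] conjI ballI impI)
      show "0 < min (d1 / 2) d2" using d1(1) d2(1) by simp
      show "2 * min (d1 / 2) d2 \<le> dist z w" if "w \<in> Z" "w \<noteq> z" for w
        using d1(2)[OF that] by linarith
      show "ball z (min (d1 / 2) d2) \<subseteq> wedge_int" if "z \<in> wedge_int"
        using d2(2)[OF that] by auto
    qed
  qed
  then obtain d where d: "\<And>z. d z > 0" "\<And>z w. w \<in> Z \<Longrightarrow> w \<noteq> z \<Longrightarrow> 2 * d z \<le> dist z w"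
    "\<And>z. z \<in> wedge_int \<Longrightarrow> ball z (d z) \<subseteq> wedge_int" by metis
  define Q where "Q z r \<delta> \<longleftrightarrow> 0 < r \<and> r < d z \<and> ball z r \<subseteq> halfplane \<and> \<delta> > 0 \<and>
      (\<forall>l. \<bar>l - l0\<bar> < \<delta> \<longrightarrow> finite {w \<in> ball z r. F w l = 0} \<and>
      (\<Sum>w | w \<in> ball z r \<and> F w l = 0. zorder (\<lambda>z. F z l) w) = zorder (\<lambda>z. F z l0) z)" for z r \<delta>
  have "\<exists>r \<delta>. Q z r \<delta>" if "z \<in> Z" for z
  proof -
    have z: "z \<in> halfplane" "F z l0 = 0" using that wedge_subsets by (auto simp: Z_def)
    show ?thesis unfolding Q_def
      by (rule zero_count_stable[OF halfplane_topology(1,2) F_holo F_cont F_nonzero z d(1)[of z]]) blast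
  qed
  then obtain r \<delta>1 where "\<And>z. z \<in> Z \<Longrightarrow> Q z (r z) (\<delta>1 z)" by metis
  then have r: "\<And>z. z \<in> Z \<Longrightarrow> 0 < r z \<and> r z < d z \<and> ball z (r z) \<subseteq> halfplane \<and> \<delta>1 z > 0"
    and count: "\<And>z l. z \<in> Z \<Longrightarrow> \<bar>l - l0\<bar> < \<delta>1 z \<Longrightarrow> finite {w \<in> ball z (r z). F w l = 0} \<and>
      (\<Sum>w | w \<in> ball z (r z) \<and> F w l = 0. zorder (\<lambda>z. F z l) w) = zorder (\<lambda>z. F z l0) z"
    unfolding Q_def by blast+
  define K where "K = {z \<in> wedge. Im z \<le> Y} - (\<Union>z\<in>Z. ball z (r z))"
  have "compact K" unfolding K_def
    by (intro compact_diff compact_truncated_wedge open_UN ballI open_ball)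
  moreover have "continuous_on (K \<times> UNIV) (\<lambda>(z, l). F z l)"
    by (rule continuous_on_subset[OF F_cont]) (use wedge_subsets in \<open>auto simp: K_def\<close>)
  moreover have "F z l0 \<noteq> 0" if "z \<in> K" for z
  proof
    assume "F z l0 = 0"
    then have "z \<in> Z" using that by (auto simp: K_def Z_def)
    then show False using that r[of z] by (auto simp: K_def)
  qed
  ultimately obtain \<delta>2 where \<delta>2: "\<delta>2 > 0" "\<And>z l. z \<in> K \<Longrightarrow> \<bar>l - l0\<bar> < \<delta>2 \<Longrightarrow> norm (F z l - F z l0) < norm (F z l0)"
    using nonvanishing_stable[of K F l0] by blast
  obtain \<delta>3 where \<delta>3: "\<delta>3 > 0" "\<And>l. \<bar>l - l0\<bar> < \<delta>3 \<Longrightarrow> l \<notin> B"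
  proof -
    obtain \<delta> where "\<delta> > 0" "\<And>x. x \<in> B \<Longrightarrow> x \<noteq> l0 \<Longrightarrow> \<delta> \<le> dist l0 x"
      using finite_set_avoid[OF B(1), of l0] by blast
    then show ?thesis using l0 by (intro that[of \<delta>]) (force simp: dist_real_def)+
  qed
  \<comment> \<open>The 1 keeps |l| <= |l0| + 1, the range for which the height Y was
    chosen.\<close>
  define \<delta> where "\<delta> = Min (insert \<delta>2 (insert \<delta>3 (insert 1 (\<delta>1 ` Z))))"
  have "\<delta> > 0" unfolding \<delta>_def using finZ \<delta>2 \<delta>3 r by (subst Min_gr_iff) auto
  moreover have "\<nu> wt l = \<nu> wt l0" if "\<bar>l - l0\<bar> < \<delta>" for l
  proof -
    have le: "\<bar>l - l0\<bar> < \<delta>2" "\<bar>l - l0\<bar> < \<delta>3" "\<bar>l - l0\<bar> < 1" "\<And>z. z \<in> Z \<Longrightarrow> \<bar>l - l0\<bar> < \<delta>1 z"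
      using that finZ unfolding \<delta>_def by auto
    have lB: "l \<notin> B" by (rule \<delta>3(2)[OF le(2)])
    define V where "V z = {w \<in> wedge \<inter> ball z (r z). F w l = 0}" for z
    have V: "finite (V z)" if "z \<in> Z" for z
      by (rule finite_subset[OF _ conjunct1[OF count[OF that le(4)[OF that]]]]) (auto simp: V_def)
    have split: "{z. z \<in> wedge \<and> F z l = 0} = (\<Union>z\<in>Z. V z)"
    proof safe
      fix z assume z: "z \<in> wedge" "F z l = 0"
      have "\<bar>l\<bar> \<le> \<bar>l0\<bar> + 1" using le(3) by linarith
      then have "Im z \<le> Y" using Y[of z l] z by (cases "Y \<le> Im z") (auto simp: wedge_def)
      moreover have "z \<notin> K" using \<delta>2(2)[OF _ le(1), of z] z by auto
      ultimately show "z \<in> (\<Union>z\<in>Z. V z)" using z by (auto simp: K_def V_def)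
    qed (auto simp: V_def)
    have disj: "V z \<inter> V w = {}" if "z \<in> Z" "w \<in> Z" "z \<noteq> w" for z w
    proof (rule ccontr)
      assume "V z \<inter> V w \<noteq> {}"
      then obtain x where "dist z x < r z" "dist w x < r w" by (auto simp: V_def)
      then have "dist z w < d z + d w" using r[OF that(1)] r[OF that(2)] dist_triangle2[of z w x] by linarith
      then show False using d(2)[OF that(2), of z] d(2)[OF that(1), of w] that by (simp add: dist_commute)
    qed
    have "\<nu> wt l = (\<Sum>z\<in>Z. \<Sum>w\<in>V z. wt w * of_int (zorder (\<lambda>z. F z l) w))"
      unfolding \<nu>_def split using V disj finZ by (intro sum.UNION_disjoint) auto
    also have "\<dots> = (\<Sum>z\<in>Z. wt z * of_int (zorder (\<lambda>z. F z l0) z))"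
    proof (rule sum.cong)
      fix z assume z: "z \<in> Z"
      have zw: "z \<in> wedge" "F z l0 = 0" using z by (auto simp: Z_def)
      note c = count[OF z le(4)[OF z]]
      show "(\<Sum>w\<in>V z. wt w * of_int (zorder (\<lambda>z. F z l) w)) = wt z * of_int (zorder (\<lambda>z. F z l0) z)"
      proof (cases "z \<in> wedge_int")
        case True
        then have sub: "ball z (r z) \<subseteq> wedge_int" using d(3)[OF True] r[OF z] by force
        then have Veq: "V z = {w \<in> ball z (r z). F w l = 0}" using wedge_subsets by (auto simp: V_def)
        have "(\<Sum>w\<in>V z. wt w * of_int (zorder (\<lambda>z. F z l) w)) = (\<Sum>w\<in>V z. of_int (zorder (\<lambda>z. F z l) w))"
          by (rule sum.cong) (use sub wt in \<open>auto simp: V_def\<close>)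
        also have "\<dots> = of_int (\<Sum>w\<in>V z. zorder (\<lambda>z. F z l) w)" by simp
        also have "\<dots> = of_int (zorder (\<lambda>z. F z l0) z)" using c unfolding Veq by simp
        finally show ?thesis using wt[OF True] by simp
      next
        case False
        then have bz: "z \<in> boundary_zeros" using zw by (auto simp: boundary_zeros_def)
        have zh: "z \<in> halfplane" using zw wedge_subsets by auto
        have ord: "zorder (\<lambda>z. F z l) z = zorder (\<lambda>z. F z l0) z"
          using B(2)[OF bz lB] B(2)[OF bz l0] by simp
        then have Fz: "F z l = 0" using zorder_F_pos_iff(1)[OF zh] zw(2) by metis
        let ?W = "{w. w \<in> ball z (r z) \<and> F w l = 0}"
        have finW: "finite ?W" using c by simp
        have zW: "z \<in> ?W" using Fz r[OF z] by simp
        have "(\<Sum>w\<in>?W. zorder (\<lambda>z. F z l) w) = zorder (\<lambda>z. F z l) z + (\<Sum>w\<in>?W - {z}. zorder (\<lambda>z. F z l) w)"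
          by (rule sum.remove[OF finW zW])
        then have zero: "(\<Sum>w\<in>?W - {z}. zorder (\<lambda>z. F z l) w) = 0" using c ord by simp
        have pos: "zorder (\<lambda>z. F z l) w > 0" if "w \<in> ?W - {z}" for w
        proof -
          have "w \<in> halfplane" using that r[OF z] by auto
          then show ?thesis using that zorder_F_pos_iff(1) by auto
        qed
        \<comment> \<open>Orders at zeros are positive, so a remaining sum equal to 0 leaves no
          second zero in the disc.\<close>
        have "?W - {z} = {}"
        proof (rule ccontr)
          assume "?W - {z} \<noteq> {}"
          then have "(\<Sum>w\<in>?W - {z}. zorder (\<lambda>z. F z l) w) > 0" using finW pos by (intro sum_pos) auto
          with zero show False by simp
        qed
        then have "V z = {z}" using zW zw(1) by (auto simp: V_def)
        then show ?thesis using ord by simp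
      qed
    qed simp
    also have "\<dots> = \<nu> wt l0" unfolding \<nu>_def Z_def by (rule sum.cong) auto
    finally show ?thesis .
  qed
  ultimately show ?thesis by blast
qed

end

text \<open>The cells are the points of B and the open gaps between them; on a gap, connectedness
  turns local constancy into constancy.\<close>

lemma finite_interval_partition:
  fixes g :: "real \<Rightarrow> 'b"
  assumes B: "finite B" and loc: "\<And>x. x \<notin> B \<Longrightarrow> \<exists>\<delta>>0. \<forall>y. \<bar>y - x\<bar> < \<delta> \<longrightarrow> g y = g x"
  obtains \<I> :: "real set set" where "finite \<I>" "pairwise disjnt \<I>" "\<forall>I\<in>\<I>. is_interval I" "\<Union>\<I> = UNIV"
    "\<And>I x y. I \<in> \<I> \<Longrightarrow> x \<in> I \<Longrightarrow> y \<in> I \<Longrightarrow> g x = g y"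
proof -
  \<comment> \<open>The strict and the weak lower set together tell a point of B from the gaps on
    either side of it, so the fibres are exactly the cells.\<close>
  define \<sigma> where "\<sigma> y = ({b \<in> B. b < y}, {b \<in> B. b \<le> y})" for y
  define fib where "fib s = {y. \<sigma> y = s}" for s
  define \<I> where "\<I> = fib ` range \<sigma>"
  have "range \<sigma> \<subseteq> Pow B \<times> Pow B" by (auto simp: \<sigma>_def)
  then have fin: "finite \<I>" unfolding \<I>_def using B by (meson finite_Pow_iff finite_SigmaI finite_imageI finite_subset)
  have disj: "pairwise disjnt \<I>" by (auto simp: \<I>_def fib_def pairwise_def disjnt_def)
  have cover: "\<Union>\<I> = UNIV" by (auto simp: \<I>_def fib_def)
  have ivl: "is_interval (fib s)" for s
    unfolding is_interval_1
  proof (intro ballI allI impI)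
    fix a b x assume ab: "a \<in> fib s" "b \<in> fib s" and x: "a \<le> x \<and> x \<le> b"
    have "\<sigma> a = \<sigma> b" using ab by (simp add: fib_def)
    then have eq: "{c \<in> B. c < a} = {c \<in> B. c < b}" "{c \<in> B. c \<le> a} = {c \<in> B. c \<le> b}"
      by (simp_all add: \<sigma>_def)
    have "{c \<in> B. c < a} \<subseteq> {c \<in> B. c < x}" "{c \<in> B. c < x} \<subseteq> {c \<in> B. c < b}"
      "{c \<in> B. c \<le> a} \<subseteq> {c \<in> B. c \<le> x}" "{c \<in> B. c \<le> x} \<subseteq> {c \<in> B. c \<le> b}"
      using x by auto
    then have "\<sigma> x = \<sigma> a" using eq unfolding \<sigma>_def by auto
    then show "x \<in> fib s" using ab by (simp add: fib_def)
  qed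
  have const: "g x = g y" if "x \<in> fib s" "y \<in> fib s" for x y s
  proof (cases "fib s \<inter> B = {}")
    case True
    show ?thesis
    proof (rule connected_local_const[OF _ that])
      show "connected (fib s)" using ivl by (rule is_interval_connected)
      show "\<forall>a\<in>fib s. \<forall>\<^sub>F b in at a within fib s. g a = g b"
      proof
        fix a assume "a \<in> fib s"
        then have "a \<notin> B" using True by auto
        then obtain \<delta> where \<delta>: "\<delta> > 0" "\<forall>y. \<bar>y - a\<bar> < \<delta> \<longrightarrow> g y = g a" using loc by blast
        show "\<forall>\<^sub>F b in at a within fib s. g a = g b"
          unfolding eventually_at
        proof (intro exI[of _ \<delta>] conjI ballI impI \<delta>(1))
          fix y assume "y \<noteq> a \<and> dist y a < \<delta>"
          then have "g y = g a" using \<delta>(2) by (simp add: dist_real_def)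
          then show "g a = g y" ..
        qed
      qed
    qed
  next
    case False
    then obtain b where b: "b \<in> fib s" "b \<in> B" by auto
    have "w = b" if "w \<in> fib s" for w
    proof -
      have "\<sigma> w = \<sigma> b" using that b by (simp add: fib_def)
      then have "{c \<in> B. c < w} = {c \<in> B. c < b}" "{c \<in> B. c \<le> w} = {c \<in> B. c \<le> b}"
        by (simp_all add: \<sigma>_def)
      then have "b \<le> w" "\<not> b < w" using b by blast+
      then show ?thesis by simp
    qed
    then show ?thesis using that by metis
  qed
  show ?thesis
  proof (rule that[OF fin disj _ cover])
    show "\<forall>I\<in>\<I>. is_interval I" using ivl unfolding \<I>_def by blast
    show "g x = g y" if "I \<in> \<I>" "x \<in> I" "y \<in> I" for I x y
      using that const unfolding \<I>_def by blast
  qed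
qed

section \<open>Stabilizers and cusps\<close>

definition mat2 :: "int \<Rightarrow> int \<Rightarrow> int \<Rightarrow> int \<Rightarrow> int^2^2" where
  "mat2 a b c d = vector [vector [a, b], vector [c, d]]"

lemma mat2_entries [simp]:
  "vec_nth (vec_nth (mat2 a b c d) 1) 1 = a" "vec_nth (vec_nth (mat2 a b c d) 1) 2 = b"
  "vec_nth (vec_nth (mat2 a b c d) 2) 1 = c" "vec_nth (vec_nth (mat2 a b c d) 2) 2 = d"
  by (simp_all add: mat2_def vector_2)

lemma mat2_eq_iff: "mat2 a b c d = mat2 a' b' c' d' \<longleftrightarrow> a = a' \<and> b = b' \<and> c = c' \<and> d = d'"
  by (metis mat2_entries)

lemma mat2_cases:
  obtains a b c d where "M = mat2 a b c d"
proof -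
  have "M = mat2 (vec_nth (vec_nth M 1) 1) (vec_nth (vec_nth M 1) 2) (vec_nth (vec_nth M 2) 1) (vec_nth (vec_nth M 2) 2)"
    by (simp add: Finite_Cartesian_Product.vec_eq_iff forall_2)
  then show ?thesis by (rule that)
qed

lemma mat2_mult: "mat2 a b c d ** mat2 a' b' c' d' =
    mat2 (a * a' + b * c') (a * b' + b * d') (c * a' + d * c') (c * b' + d * d')"
  by (simp add: Finite_Cartesian_Product.vec_eq_iff forall_2 matrix_matrix_mult_def sum_2)

lemma mat2_uminus: "- mat2 a b c d = mat2 (- a) (- b) (- c) (- d)"
  by (simp add: Finite_Cartesian_Product.vec_eq_iff forall_2)

lemma mat2_SL2Z: "mat2 a b c d \<in> SL2Z \<longleftrightarrow> a * d - b * c = 1"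
  by (simp add: SL2Z_def det_2)

lemma moebius_mat2: "moebius (mat2 a b c d) \<tau> = (of_int a * \<tau> + of_int b) / (of_int c * \<tau> + of_int d)"
  by (simp add: moebius_def)

lemma SL2Z_cases:
  assumes "M \<in> SL2Z"
  obtains a b c d where "M = mat2 a b c d" "a * d - b * c = 1"
  using assms mat2_SL2Z by (metis mat2_cases)

lemma moebius_halfplane:
  assumes "M \<in> SL2Z" "z \<in> halfplane"
  shows "moebius M z \<in> halfplane"
proof -
  obtain a b c d where M: "M = mat2 a b c d" "a * d - b * c = 1" using SL2Z_cases[OF assms(1)] .
  show ?thesis unfolding halfplane_def M(1) moebius_mat2
    using Im_moebius_int_pos[OF _ M(2)] assms(2) by (simp add: halfplane_def)
qed

lemma SL2Z_mult: "M \<in> SL2Z \<Longrightarrow> N \<in> SL2Z \<Longrightarrow> M ** N \<in> SL2Z"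
  by (simp add: SL2Z_def det_mul)

lemma moebius_mult:
  assumes "M \<in> SL2Z" "N \<in> SL2Z" "z \<in> halfplane"
  shows "moebius (M ** N) z = moebius M (moebius N z)"
proof -
  obtain a b c d where M: "M = mat2 a b c d" "a * d - b * c = 1" using SL2Z_cases[OF assms(1)] .
  obtain a' b' c' d' where N: "N = mat2 a' b' c' d'" "a' * d' - b' * c' = 1" using SL2Z_cases[OF assms(2)] .
  define J where "J = of_int c' * z + of_int d'"
  define I where "I = of_int a' * z + of_int b'"
  have J: "J \<noteq> 0" unfolding J_def using assms(3) by (intro denom_nonzero[OF _ N(2)]) (simp add: halfplane_def)
  have "moebius M (moebius N z) = (of_int a * (I / J) + of_int b) / (of_int c * (I / J) + of_int d)"
    unfolding M N moebius_mat2 I_def J_def ..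
  also have "\<dots> = ((of_int a * (I / J) + of_int b) * J) / ((of_int c * (I / J) + of_int d) * J)"
    using J by simp
  also have "\<dots> = (of_int a * I + of_int b * J) / (of_int c * I + of_int d * J)"
    using J by (simp add: distrib_right)
  also have "\<dots> = moebius (M ** N) z"
    unfolding M N moebius_mat2 mat2_mult I_def J_def by (simp add: algebra_simps)
  finally show ?thesis by simp
qed

lemma mat2_one:
  "mat2 1 0 0 1 ** M = M" "M ** mat2 1 0 0 1 = M"
  by (cases M rule: mat2_cases, simp add: mat2_mult)+

lemma SL2Z_inverse:
  assumes "M \<in> SL2Z"
  obtains N where "N \<in> SL2Z" "M ** N = mat2 1 0 0 1" "N ** M = mat2 1 0 0 1"
proof -
  obtain a b c d where M: "M = mat2 a b c d" "a * d - b * c = 1" using SL2Z_cases[OF assms(1)] .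
  show ?thesis
    by (rule that[of "mat2 d (- b) (- c) a"])
       (use M(2) in \<open>auto simp: M(1) mat2_SL2Z mat2_mult mat2_eq_iff algebra_simps\<close>)
qed

lemma moebius_one: "moebius (mat2 1 0 0 1) z = z"
  by (simp add: moebius_mat2)

lemma moebius_inj:
  assumes "M \<in> SL2Z"
  shows "inj_on (moebius M) halfplane"
proof -
  obtain N where N: "N \<in> SL2Z" "N ** M = mat2 1 0 0 1" using SL2Z_inverse[OF assms] by blast
  show ?thesis
  proof (rule inj_onI)
    fix x y assume xy: "x \<in> halfplane" "y \<in> halfplane" "moebius M x = moebius M y"
    have "moebius (N ** M) x = moebius (N ** M) y"
      using xy by (simp add: moebius_mult[OF N(1) assms])
    then show "x = y" by (simp add: N(2) moebius_one)
  qed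
qed

lemma moebius_uminus: "moebius (- M) z = moebius M z"
proof -
  obtain a b c d where M: "M = mat2 a b c d" by (rule mat2_cases)
  have "of_int (- a) * z + of_int (- b) = - (of_int a * z + of_int b)"
    "of_int (- c) * z + of_int (- d) = - (of_int c * z + of_int d)" by simp_all
  then show ?thesis unfolding M mat2_uminus moebius_mat2 by (simp only: minus_divide_left[symmetric] minus_divide_right[symmetric] minus_minus)
qed

lemma SL2Z_uminus: "M \<in> SL2Z \<Longrightarrow> - M \<in> SL2Z"
  by (elim SL2Z_cases) (simp add: mat2_uminus mat2_SL2Z)

lemma matrix_mult_uminus:
  fixes M N :: "int^2^2"
  shows "M ** (- N) = - (M ** N)" "(- M) ** N = - (M ** N)"
  by (cases M rule: mat2_cases, cases N rule: mat2_cases, simp add: mat2_mult mat2_uminus)+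

section \<open>Stabilizers of points\<close>

definition stab_classes :: "complex \<Rightarrow> (int^2^2) set set" where
  "stab_classes z = (\<lambda>A. {A, - A}) ` {A \<in> SL2Z. moebius A z = z}"

lemma stab_order_eq: "stab_order (Inner z) = card (stab_classes z)"
  by (simp add: stab_classes_def)

text \<open>Conjugation by M maps one stabilizer onto the other and commutes with the sign, so it
  acts on the classes {X, - X}.\<close>

lemma stab_order_moebius:
  assumes "M \<in> SL2Z" "z \<in> halfplane"
  shows "stab_order (Inner (moebius M z)) = stab_order (Inner z)"
proof -
  obtain N where N: "N \<in> SL2Z" "M ** N = mat2 1 0 0 1" "N ** M = mat2 1 0 0 1" by (rule SL2Z_inverse[OF assms(1)])
  define T where "T X = M ** X ** N" for X
  define T' where "T' X = N ** X ** M" for X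
  have TT': "T (T' X) = X" "T' (T X) = X" for X
    unfolding T_def T'_def by (metis N(2,3) matrix_mul_assoc mat2_one)+
  have neg: "T (- X) = - T X" "T' (- X) = - T' X" for X
    by (simp_all add: T_def T'_def matrix_mult_uminus)
  have Nz: "moebius N (moebius M z) = z"
    using moebius_mult[OF N(1) assms] by (simp add: N(3) moebius_one)
  have Mz: "moebius M z \<in> halfplane" by (rule moebius_halfplane[OF assms])
  have T: "T X \<in> SL2Z \<and> moebius (T X) (moebius M z) = moebius M z" if "X \<in> SL2Z" "moebius X z = z" for X
    unfolding T_def using that assms N Mz
    by (simp add: SL2Z_mult moebius_mult Nz)
  have T': "T' X \<in> SL2Z \<and> moebius (T' X) z = z" if "X \<in> SL2Z" "moebius X (moebius M z) = moebius M z" for X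
    unfolding T'_def using that assms N Mz
    by (simp add: SL2Z_mult moebius_mult Nz moebius_halfplane)
  have "bij_betw (image T) (stab_classes z) (stab_classes (moebius M z))"
  proof (rule bij_betw_byWitness[where f' = "image T'"])
    show "\<forall>a\<in>stab_classes z. T' ` T ` a = a" "\<forall>a\<in>stab_classes (moebius M z). T ` T' ` a = a"
      by (auto simp: image_image TT')
    show "image T ` stab_classes z \<subseteq> stab_classes (moebius M z)"
      using T by (auto simp: stab_classes_def neg)
    show "image T' ` stab_classes (moebius M z) \<subseteq> stab_classes z"
      using T' by (auto simp: stab_classes_def neg)
  qed
  then show ?thesis unfolding stab_order_eq using bij_betw_same_card by metis
qed

text \<open>A fixed point keeps its imaginary part, which the map divides by |c z + d|^2.\<close>

lemma stab_norm_denom: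
  assumes "z \<in> halfplane" "a * d - b * c = 1" "moebius (mat2 a b c d) z = z"
  shows "(norm (of_int c * z + of_int d))\<^sup>2 = 1"
proof -
  have z: "Im z > 0" using assms by (simp add: halfplane_def)
  have "Im z = Im z / norm (of_int c * z + of_int d) ^ 2"
    using Im_moebius_int[OF z assms(2)] assms(3) by (simp add: moebius_mat2)
  then show ?thesis using z by (cases "norm (of_int c * z + of_int d) = 0") (auto simp: field_simps)
qed

lemma norm_denom_sq:
  "(norm (of_int c * z + of_int d))\<^sup>2 = (of_int c)\<^sup>2 * (norm z)\<^sup>2 + 2 * of_int (c * d) * Re z + (of_int d)\<^sup>2"
  unfolding cmod_power2 by (simp add: power2_eq_square algebra_simps)

lemma stab_row_determines:
  assumes "z \<in> halfplane" "moebius (mat2 a b c d) z = z" "moebius (mat2 a' b' c d) z = z"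
    "a * d - b * c = 1" "a' * d - b' * c = 1"
  shows "a = a' \<and> b = b'"
proof -
  have z: "Im z > 0" using assms by (simp add: halfplane_def)
  have J: "of_int c * z + of_int d \<noteq> 0" by (rule denom_nonzero[OF z assms(4)])
  have "of_int a * z + of_int b = z * (of_int c * z + of_int d)"
    "of_int a' * z + of_int b' = z * (of_int c * z + of_int d)"
    using assms(2,3) J by (simp_all add: moebius_mat2 divide_eq_eq)
  then have eq: "of_int a * z + of_int b = of_int a' * z + of_int b'" by simp
  from arg_cong[OF eq, of Im] have "a = a'" using z by simp
  with eq show ?thesis by simp
qed

text \<open>The form equals (|c| - |d|)^2 + |c| |d|.\<close>

lemma int_small_quadratic:
  fixes c d :: int
  assumes "c^2 - \<bar>c * d\<bar> + d^2 \<le> 1"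
  shows "\<bar>c\<bar> \<le> 1" "\<bar>d\<bar> \<le> 1"
proof -
  have *: "(\<bar>c\<bar> - \<bar>d\<bar>)^2 + \<bar>c\<bar> * \<bar>d\<bar> \<le> 1"
    using assms by (simp add: power2_eq_square algebra_simps abs_mult)
  have cd: "\<bar>c\<bar> * \<bar>d\<bar> \<le> 1" using * zero_le_power2[of "\<bar>c\<bar> - \<bar>d\<bar>"] by linarith
  have "c = 0 \<or> d = 0 \<or> (\<bar>c\<bar> = 1 \<and> \<bar>d\<bar> = 1)"
  proof (cases "c = 0 \<or> d = 0")
    case False
    then have "\<bar>c\<bar> \<ge> 1" "\<bar>d\<bar> \<ge> 1" by auto
    then have "\<bar>c\<bar> * 1 \<le> 1" "1 * \<bar>d\<bar> \<le> 1"
      using cd mult_left_mono[of 1 "\<bar>d\<bar>" "\<bar>c\<bar>"] mult_right_mono[of 1 "\<bar>c\<bar>" "\<bar>d\<bar>"] by linarith+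
    then show ?thesis using \<open>\<bar>c\<bar> \<ge> 1\<close> \<open>\<bar>d\<bar> \<ge> 1\<close> by simp
  qed auto
  moreover have "\<bar>d\<bar> \<le> 1" if "c = 0" using * that by (simp add: power2_le_iff_abs_le abs_square_le_1)
  moreover have "\<bar>c\<bar> \<le> 1" if "d = 0" using * that by (simp add: abs_square_le_1)
  ultimately show "\<bar>c\<bar> \<le> 1" "\<bar>d\<bar> \<le> 1" by auto
qed

text \<open>Expand |c z + d|^2 = 1 with |z| >= 1 and |2 Re z| <= 1: the form c^2 - |c d| + d^2 is at
  most 1, and less than 1 if |z| > 1 and c is nonzero. If c d = -1, then |z|^2 = 2 Re z, which
  forces Re z >= 1/2.\<close>

lemma stab_rows:
  assumes z: "z \<in> wedge" and det: "a * d - b * c = 1" and fixed: "moebius (mat2 a b c d) z = z"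
  shows "\<bar>c\<bar> \<le> 1" "\<bar>d\<bar> \<le> 1" "z \<in> wedge_int \<Longrightarrow> c = 0" "Re z < 1/2 \<Longrightarrow> c * d \<noteq> -1"
proof -
  have zh: "z \<in> halfplane" using z wedge_subsets by auto
  have eq: "(of_int c)\<^sup>2 * (norm z)\<^sup>2 + 2 * of_int (c * d) * Re z + (of_int d)\<^sup>2 = 1"
    using stab_norm_denom[OF zh det fixed] unfolding norm_denom_sq .
  have n1: "(norm z)\<^sup>2 \<ge> 1" and re: "\<bar>Re z\<bar> \<le> 1/2" using z by (auto simp: wedge_def one_le_power)
  have "\<bar>2 * of_int (c * d) * Re z\<bar> \<le> \<bar>real_of_int (c * d)\<bar>"
    using mult_left_mono[OF re, of "2 * \<bar>real_of_int (c * d)\<bar>"] by (simp add: abs_mult)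
  then have lo: "2 * of_int (c * d) * Re z \<ge> - \<bar>real_of_int (c * d)\<bar>" by linarith
  have c2: "(real_of_int c)\<^sup>2 \<le> (of_int c)\<^sup>2 * (norm z)\<^sup>2"
    using mult_left_mono[OF n1, of "(real_of_int c)\<^sup>2"] by simp
  have "(real_of_int c)\<^sup>2 - \<bar>real_of_int (c * d)\<bar> + (real_of_int d)\<^sup>2 \<le> 1" using eq lo c2 by linarith
  then have "real_of_int (c^2 - \<bar>c * d\<bar> + d^2) \<le> 1" by simp
  then have sq: "c^2 - \<bar>c * d\<bar> + d^2 \<le> 1" by linarith
  from int_small_quadratic[OF this] show cd: "\<bar>c\<bar> \<le> 1" "\<bar>d\<bar> \<le> 1" by auto
  show "c = 0" if "z \<in> wedge_int"
  proof (rule ccontr)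
    assume c: "c \<noteq> 0"
    have n2: "(norm z)\<^sup>2 > 1" using that by (simp add: wedge_int_def one_less_power)
    have "(real_of_int c)\<^sup>2 < (of_int c)\<^sup>2 * (norm z)\<^sup>2"
      using mult_strict_left_mono[OF n2, of "(real_of_int c)\<^sup>2"] c by simp
    then have "(real_of_int c)\<^sup>2 - \<bar>real_of_int (c * d)\<bar> + (real_of_int d)\<^sup>2 < 1" using eq lo by linarith
    then have "real_of_int (c^2 - \<bar>c * d\<bar> + d^2) < 1" by simp
    then have "c^2 - \<bar>c * d\<bar> + d^2 < 1" by linarith
    moreover have "c = 1 \<or> c = -1" "d = 0 \<or> d = 1 \<or> d = -1" using c cd by auto
    ultimately show False by auto
  qed
  show "c * d \<noteq> -1" if "Re z < 1/2"
  proof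
    assume m: "c * d = -1"
    then have "c \<noteq> 0" "d \<noteq> 0" by auto
    then have "(c = 1 \<or> c = -1)" "(d = 1 \<or> d = -1)" using cd by auto
    then have "(real_of_int c)\<^sup>2 = 1" "(real_of_int d)\<^sup>2 = 1" by auto
    then show False using eq n1 that unfolding m by simp
  qed
qed

lemma stab_order_wedge_int:
  assumes "z \<in> wedge_int"
  shows "stab_order (Inner z) = 1"
proof -
  have zw: "z \<in> wedge" "z \<in> halfplane" using assms wedge_subsets by auto
  have "stab_classes z = {{mat2 1 0 0 1, - mat2 1 0 0 1}}"
  proof
    show "stab_classes z \<subseteq> {{mat2 1 0 0 1, - mat2 1 0 0 1}}"
    proof
      fix S assume "S \<in> stab_classes z"
      then obtain X where X: "X \<in> SL2Z" "moebius X z = z" "S = {X, - X}" by (auto simp: stab_classes_def)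
      obtain a b c d where X2: "X = mat2 a b c d" "a * d - b * c = 1" using SL2Z_cases[OF X(1)] .
      have c: "c = 0" using stab_rows(3)[OF zw(1) X2(2)] X(2) X2(1) assms by simp
      then have "a * d = 1" using X2(2) by simp
      then have ad: "(a = 1 \<and> d = 1) \<or> (a = -1 \<and> d = -1)" by (simp add: zmult_eq_1_iff)
      have b: "b = 0" using X(2) ad c unfolding X2(1) moebius_mat2 by auto
      show "S \<in> {{mat2 1 0 0 1, - mat2 1 0 0 1}}" using ad b c unfolding X(3) X2(1) mat2_uminus by auto
    qed
    have "mat2 1 0 0 1 \<in> SL2Z" unfolding mat2_SL2Z by simp
    then show "{{mat2 1 0 0 1, - mat2 1 0 0 1}} \<subseteq> stab_classes z" by (auto simp: stab_classes_def moebius_one)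
  qed
  then show ?thesis unfolding stab_order_eq by simp
qed

text \<open>Up to sign the lower row is (0, 1), (1, 0) or (1, 1), as Re z < 1/2 excludes (1, -1),
  and each row belongs to at most one stabilizing matrix. This bound produces the sixths.\<close>

lemma stab_order_le_3:
  assumes z: "z \<in> wedge" and re: "Re z < 1/2"
  shows "stab_order (Inner z) \<le> 3"
proof -
  have zh: "z \<in> halfplane" using z wedge_subsets by auto
  define P where "P = (\<lambda>r X. X \<in> SL2Z \<and> moebius X z = z \<and>
     vec_nth (vec_nth X 2) 1 = fst r \<and> vec_nth (vec_nth X 2) 2 = (snd r :: int))"
  let ?rows = "{(0, 1), (1, 0), (1, 1)} :: (int \<times> int) set"
  have uniq: "X = X'" if "P r X" "P r X'" for r X X'
  proof -
    obtain a b c d where X: "X = mat2 a b c d" by (rule mat2_cases)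
    obtain a' b' c' d' where X': "X' = mat2 a' b' c' d'" by (rule mat2_cases)
    have "c' = c" "d' = d" using that unfolding P_def X X' by auto
    then show ?thesis
      using that stab_row_determines[OF zh, of a b c d a' b'] unfolding P_def X X' mat2_SL2Z by auto
  qed
  have "stab_classes z \<subseteq> (\<lambda>r. {SOME X. P r X, - (SOME X. P r X)}) ` ?rows"
  proof
    fix S assume "S \<in> stab_classes z"
    then obtain X where X: "X \<in> SL2Z" "moebius X z = z" "S = {X, - X}" by (auto simp: stab_classes_def)
    obtain a b c d where X2: "X = mat2 a b c d" "a * d - b * c = 1" using SL2Z_cases[OF X(1)] .
    have r: "\<bar>c\<bar> \<le> 1" "\<bar>d\<bar> \<le> 1" "c * d \<noteq> -1"
      using stab_rows[OF z X2(2)] X(2) X2(1) re by auto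
    have "c \<noteq> 0 \<or> d \<noteq> 0" using X2(2) by auto
    moreover have "c = -1 \<or> c = 0 \<or> c = 1" "d = -1 \<or> d = 0 \<or> d = 1" using r by auto
    ultimately have "(c, d) \<in> ?rows \<or> (- c, - d) \<in> ?rows" using r(3) by auto
    then obtain X' r where X': "r \<in> ?rows" "P r X'" "S = {X', - X'}"
    proof
      assume "(c, d) \<in> ?rows"
      then show ?thesis using X by (intro that[of "(c, d)" X]) (auto simp: P_def X2)
    next
      assume "(- c, - d) \<in> ?rows"
      then show ?thesis using X SL2Z_uminus[OF X(1)] moebius_uminus[of X z]
        by (intro that[of "(- c, - d)" "- X"]) (auto simp: P_def X2 mat2_uminus)
    qed
    have "(SOME X. P r X) = X'" using uniq[OF someI[of "P r", OF X'(2)] X'(2)] .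
    then show "S \<in> (\<lambda>r. {SOME X. P r X, - (SOME X. P r X)}) ` ?rows" using X' by auto
  qed
  then have "card (stab_classes z) \<le> card ((\<lambda>r. {SOME X. P r X, - (SOME X. P r X)}) ` ?rows)"
    by (intro card_mono) auto
  also have "\<dots> \<le> card ?rows" by (rule card_image_le) auto
  finally show ?thesis unfolding stab_order_eq by simp
qed

section \<open>The vanishing order at finite cusps\<close>

definition cusp_order :: "(complex \<Rightarrow> complex) \<Rightarrow> nat" where
  "cusp_order f = (LEAST n. \<exists>j\<le>qm_depth f. fourier_coeff ((qm_derivation ^^ j) f) n \<noteq> 0)"

text \<open>At a finite cusp the expansion coefficient is a polynomial in a nonconstant affine
  function of \<open>\<tau>\<close>, so it vanishes identically only if all Fourier coefficients involved do.\<close>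

lemma vanishing_order_finite_cusp:
  "vanishing_order f (Cusp (Some l)) = int (cusp_order f)"
proof -
  obtain x y where xy: "quotient_of l = (x, y)" by (cases "quotient_of l")
  have y: "y > 0" using quotient_of_denom_pos[OF xy] .
  have "(\<exists>\<tau>\<in>upper_half. cusp_coeff f (- y) x n \<tau> \<noteq> 0) \<longleftrightarrow>
      (\<exists>j\<le>qm_depth f. fourier_coeff ((qm_derivation ^^ j) f) n \<noteq> 0)" for n
  proof
    assume "\<exists>\<tau>\<in>upper_half. cusp_coeff f (- y) x n \<tau> \<noteq> 0"
    then show "\<exists>j\<le>qm_depth f. fourier_coeff ((qm_derivation ^^ j) f) n \<noteq> 0"
      unfolding cusp_coeff_def by (metis (no_types, lifting) atMost_iff div_0 mult_zero_left sum.neutral)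
  next
    assume "\<exists>j\<le>qm_depth f. fourier_coeff ((qm_derivation ^^ j) f) n \<noteq> 0"
    then obtain j where j: "j \<le> qm_depth f" "fourier_coeff ((qm_derivation ^^ j) f) n \<noteq> 0" by blast
    define P where "P = (\<Sum>j\<le>qm_depth f. monom (fourier_coeff ((qm_derivation ^^ j) f) n / fact j) j)"
    have "coeff P j = fourier_coeff ((qm_derivation ^^ j) f) n / fact j"
      unfolding P_def coeff_sum using j by (simp add: coeff_monom sum.delta)
    then have "P \<noteq> 0" using j(2) by auto
    then have fin: "finite {t. poly P t = 0}" by (rule poly_roots_finite)
    \<comment> \<open>Affine in tau with nonzero slope since y > 0, so it takes infinitely many
      values on the half plane.\<close>
    define t where "t \<tau> = - of_int (- y) * (of_int (- y) * \<tau> + of_int x) / (2 * of_real pi * \<i>)" for \<tau>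
    have "inj_on t upper_half" using y by (intro inj_onI) (simp add: t_def)
    moreover have "infinite upper_half"
    proof
      assume "finite upper_half"
      moreover have "range (\<lambda>n. Complex (real n) 1) \<subseteq> upper_half" by (auto simp: upper_half_def)
      moreover have "inj (\<lambda>n. Complex (real n) 1)" by (auto intro: injI)
      ultimately show False using range_inj_infinite finite_subset by blast
    qed
    ultimately have "infinite (t ` upper_half)" by (simp add: finite_image_iff)
    then have "\<not> t ` upper_half \<subseteq> {t. poly P t = 0}" using fin finite_subset by blast
    then obtain \<tau> where "\<tau> \<in> upper_half" "poly P (t \<tau>) \<noteq> 0" by auto
    moreover have "poly P (t \<tau>) = cusp_coeff f (- y) x n \<tau>"
      unfolding P_def cusp_coeff_def poly_sum poly_monom t_def ..
    ultimately show "\<exists>\<tau>\<in>upper_half. cusp_coeff f (- y) x n \<tau> \<noteq> 0" by auto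
  qed
  then show ?thesis by (simp add: xy cusp_order_def)
qed

section \<open>Quasimodular forms\<close>

text \<open>Every q in the punctured disc is \<open>qpar z\<close> for some z in the half plane,
  found by a logarithm, so the Fourier series converges on the whole disc.\<close>

lemma modular_form_q_series:
  assumes "modular_form k g"
  obtains G where "G holomorphic_on ball 0 1" "\<And>z. z \<in> halfplane \<Longrightarrow> g z = G (qpar z)"
proof -
  obtain a where a: "has_fourier_expansion g a" using assms unfolding modular_form_def by blast
  have s: "(\<lambda>n. a n * qpar z ^ n) sums g z" if "z \<in> halfplane" for z
    using a that halfplane_topology(3) by (simp add: has_fourier_expansion_def)
  define G where "G q = (\<Sum>n. a n * q ^ n)" for q
  have "(\<lambda>n. a n * (q - 0) ^ n) sums G q" if "q \<in> ball 0 1" for q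
  proof (cases "q = 0")
    case True
    then show ?thesis using powser_sums_zero[of a] by (simp add: G_def sums_iff)
  next
    case False
    define z where "z = Ln q / (2 * of_real pi * \<i>)"
    have qz: "qpar z = q" using False by (simp add: qpar_def z_def mult.commute mult.left_commute)
    have "norm q < 1" using that by simp
    then have "exp (- 2 * pi * Im z) < exp 0" using norm_qpar[of z] qz by simp
    then have "z \<in> halfplane" by (simp add: halfplane_def zero_less_mult_iff)
    from s[OF this] show ?thesis unfolding qz by (simp add: G_def sums_iff)
  qed
  then have "G holomorphic_on ball 0 1" by (rule power_series_holomorphic)
  moreover have "g z = G (qpar z)" if "z \<in> halfplane" for z
    using s[OF that] by (simp add: G_def sums_iff)
  ultimately show ?thesis by (rule that)
qed

text \<open>The i-th partial derivative of f with respect to E2, times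
  \<open>qm_kappa ^ i / fact i\<close> and written in q: a Taylor coefficient for the substitution
  that adds \<open>qm_kappa / (z - l)\<close> to E2. For i = 0 it is f itself.\<close>

definition qm_coeff :: "(nat \<Rightarrow> complex \<Rightarrow> complex) \<Rightarrow> nat \<Rightarrow> nat \<Rightarrow> complex \<Rightarrow> complex" where
  "qm_coeff G p i q = qm_kappa ^ i * (\<Sum>j\<le>p. of_nat (j choose i) * G j q * e2_series q ^ (j - i))"

lemma qm_coeff_holo:
  assumes "\<And>j. j \<le> p \<Longrightarrow> G j holomorphic_on ball 0 1"
  shows "qm_coeff G p i holomorphic_on ball 0 1"
  unfolding qm_coeff_def[abs_def]
  by (intro holomorphic_intros assms e2_series_holomorphic) auto

text \<open>The extra factor \<open>z - l\<close> makes the degree in \<open>l\<close> positive also for modular forms.\<close>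

lemma poly_root_poly_qm_coeff:
  "poly (root_poly (qm_coeff G p) (Suc p) z q) l =
    (\<Sum>j\<le>p. G j q * (e2_series q * (z - l) + qm_kappa) ^ j * (z - l) ^ (Suc p - j))"
proof -
  define Y where "Y = z - l"
  define E where "E = e2_series q"
  have "(E * Y + qm_kappa) ^ j * Y ^ (Suc p - j) =
      (\<Sum>i\<le>Suc p. of_nat (j choose i) * qm_kappa ^ i * E ^ (j - i) * Y ^ (Suc p - i))" if "j \<le> p" for j
  proof -
    have "(E * Y + qm_kappa) ^ j * Y ^ (Suc p - j) =
        (\<Sum>i\<le>j. of_nat (j choose i) * qm_kappa ^ i * (E * Y) ^ (j - i) * Y ^ (Suc p - j))"
      by (simp add: add.commute[of "E * Y"] binomial_ring sum_distrib_right)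
    also have "\<dots> = (\<Sum>i\<le>j. of_nat (j choose i) * qm_kappa ^ i * E ^ (j - i) * Y ^ (Suc p - i))"
    proof (rule sum.cong)
      fix i assume "i \<in> {..j}"
      then have "Suc p - i = (j - i) + (Suc p - j)" using that by auto
      then show "of_nat (j choose i) * qm_kappa ^ i * (E * Y) ^ (j - i) * Y ^ (Suc p - j) =
          of_nat (j choose i) * qm_kappa ^ i * E ^ (j - i) * Y ^ (Suc p - i)"
        by (simp only: power_add power_mult_distrib mult_ac)
    qed simp
    also have "\<dots> = (\<Sum>i\<le>Suc p. of_nat (j choose i) * qm_kappa ^ i * E ^ (j - i) * Y ^ (Suc p - i))"
      by (rule sum.mono_neutral_left) (use that in auto)
    finally show ?thesis .
  qed
  then have "(\<Sum>j\<le>p. G j q * ((E * Y + qm_kappa) ^ j * Y ^ (Suc p - j))) =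
      (\<Sum>j\<le>p. \<Sum>i\<le>Suc p. G j q * (of_nat (j choose i) * qm_kappa ^ i * E ^ (j - i) * Y ^ (Suc p - i)))"
    by (intro sum.cong refl) (simp only: atMost_iff sum_distrib_left)
  also have "\<dots> = (\<Sum>i\<le>Suc p. \<Sum>j\<le>p. G j q * (of_nat (j choose i) * qm_kappa ^ i * E ^ (j - i) * Y ^ (Suc p - i)))"
    by (rule sum.swap)
  also have "\<dots> = (\<Sum>i\<le>Suc p. qm_coeff G p i q * Y ^ (Suc p - i))"
    unfolding qm_coeff_def sum_distrib_left sum_distrib_right E_def[symmetric]
    by (intro sum.cong refl) (simp only: mult_ac)
  finally show ?thesis unfolding poly_root_poly Y_def[symmetric] E_def[symmetric] by (simp only: mult.assoc)
qed

text \<open>The weight k - 2 j of \<open>g j\<close> and the weight 2 j of the j-th power of E2 add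
  up to k.\<close>

lemma cocycle_powers:
  fixes J :: complex and k :: int
  assumes "J \<noteq> 0"
  shows "J powi (k - 2 * int j) * J ^ j * J ^ j = J powi k"
proof -
  have "J powi k = J powi ((k - 2 * int j) + int j + int j)" by (rule arg_cong[of _ _ "\<lambda>n. J powi n"]) simp
  then show ?thesis by (simp only: power_int_add[OF disjI1[OF assms]] power_int_of_nat)
qed

section \<open>The zeros of f in a translate of F as zeros of a polynomial in lambda\<close>

locale qm_decomp =
  fixes k :: int and p :: nat and g :: "nat \<Rightarrow> complex \<Rightarrow> complex" and f :: "complex \<Rightarrow> complex"
    and G :: "nat \<Rightarrow> complex \<Rightarrow> complex"
  assumes g_modular: "\<And>j. j \<le> p \<Longrightarrow> modular_form (k - 2 * int j) (g j)"
    and f_eq: "\<And>z. z \<in> halfplane \<Longrightarrow> f z = (\<Sum>j\<le>p. g j z * E2 z ^ j)"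
    and f_nonzero: "\<exists>z\<in>halfplane. f z \<noteq> 0"
    and G_holo: "\<And>j. j \<le> p \<Longrightarrow> G j holomorphic_on ball 0 1"
    and g_G: "\<And>j z. j \<le> p \<Longrightarrow> z \<in> halfplane \<Longrightarrow> g j z = G j (qpar z)"
begin

abbreviation "RP z \<equiv> root_poly (qm_coeff G p) (Suc p) z (qpar z)"

lemma poly_RP:
  assumes "z \<in> halfplane"
  shows "poly (RP z) l = (\<Sum>j\<le>p. g j z * (E2 z * (z - l) + qm_kappa) ^ j * (z - l) ^ (Suc p - j))"
  unfolding poly_root_poly_qm_coeff E2_eq by (rule sum.cong) (use g_G assms in auto)

lemma f_lead: "z \<in> halfplane \<Longrightarrow> f z = qm_coeff G p 0 (qpar z)"
  by (simp add: f_eq qm_coeff_def E2_eq g_G)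

lemma g_transform:
  assumes "j \<le> p" "a * d - b * c = 1" "z \<in> halfplane"
  shows "g j (moebius (mat2 a b c d) z) = (of_int c * z + of_int d) powi (k - 2 * int j) * g j z"
  using g_modular[OF assms(1)] assms(2,3) mat2_SL2Z[of a b c d] halfplane_topology(3)
  unfolding modular_form_def by auto

text \<open>With Y = z + d / c the denominator J is c Y, so E2 at the image point is c J (E2 z Y +
  kappa). Each factor c combines with a Y into a further J, which restores the weight k; the
  remaining powers of Y make up the root polynomial at l = - d / c.\<close>

lemma f_transform:
  assumes det: "a * d - b * c = 1" and c: "c \<noteq> 0" and z: "z \<in> halfplane"
  shows "f (moebius (mat2 a b c d) z) * (z - (- of_int d / of_int c)) ^ Suc p =
    (of_int c * z + of_int d) powi k * poly (RP z) (- of_int d / of_int c)"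
proof -
  define J where "J = of_int c * z + of_int d"
  define Y where "Y = z - (- of_int d / of_int c)"
  have Imz: "Im z > 0" using z by (simp add: halfplane_def)
  have J0: "J \<noteq> 0" unfolding J_def by (rule denom_nonzero[OF Imz det])
  have JY: "J = of_int c * Y" unfolding J_def Y_def using c by (simp add: distrib_left)
  have mz: "moebius (mat2 a b c d) z \<in> halfplane" using det z by (intro moebius_halfplane) (simp add: mat2_SL2Z)
  have E: "E2 (moebius (mat2 a b c d) z) = of_int c * J * (E2 z * Y + qm_kappa)"
  proof -
    have "E2 (moebius (mat2 a b c d) z) = J^2 * E2 z + qm_kappa * of_int c * J"
      unfolding moebius_mat2 J_def by (rule E2_transform[OF Imz det])
    then show ?thesis by (simp add: JY power2_eq_square algebra_simps)
  qed
  have "f (moebius (mat2 a b c d) z) * Y ^ Suc p =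
      (\<Sum>j\<le>p. (J powi (k - 2 * int j) * g j z) * (of_int c * J * (E2 z * Y + qm_kappa)) ^ j * Y ^ Suc p)"
    unfolding f_eq[OF mz] E sum_distrib_right
    by (rule sum.cong) (auto simp: g_transform[OF _ det z] J_def)
  also have "\<dots> = (\<Sum>j\<le>p. J powi k * (g j z * (E2 z * Y + qm_kappa) ^ j * Y ^ (Suc p - j)))"
  proof (rule sum.cong)
    fix j assume "j \<in> {..p}"
    then have "Suc p = j + (Suc p - j)" by auto
    then have "Y ^ Suc p = Y ^ j * Y ^ (Suc p - j)" by (metis power_add)
    moreover have "of_int c ^ j * Y ^ j = J ^ j" unfolding JY by (simp add: power_mult_distrib)
    ultimately have "of_int c ^ j * Y ^ Suc p = J ^ j * Y ^ (Suc p - j)" by (metis mult.assoc)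
    then have cY: "of_int c ^ j * Y ^ Suc p = J ^ j * Y ^ (Suc p - j)" .
    have "(J powi (k - 2 * int j) * g j z) * (of_int c * J * (E2 z * Y + qm_kappa)) ^ j * Y ^ Suc p =
      (J powi (k - 2 * int j) * g j z) * J ^ j * (E2 z * Y + qm_kappa) ^ j * (of_int c ^ j * Y ^ Suc p)"
      by (simp only: power_mult_distrib mult_ac)
    also have "\<dots> = (J powi (k - 2 * int j) * J ^ j * J ^ j) * (g j z * (E2 z * Y + qm_kappa) ^ j * Y ^ (Suc p - j))"
      unfolding cY by (simp only: mult_ac)
    finally have "(J powi (k - 2 * int j) * g j z) * (of_int c * J * (E2 z * Y + qm_kappa)) ^ j * Y ^ Suc p =
      (J powi (k - 2 * int j) * J ^ j * J ^ j) * (g j z * (E2 z * Y + qm_kappa) ^ j * Y ^ (Suc p - j))" .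
    then show "(J powi (k - 2 * int j) * g j z) * (of_int c * J * (E2 z * Y + qm_kappa)) ^ j * Y ^ Suc p =
      J powi k * (g j z * (E2 z * Y + qm_kappa) ^ j * Y ^ (Suc p - j))"
      unfolding cocycle_powers[OF J0] .
  qed simp
  also have "\<dots> = J powi k * poly (RP z) (- of_int d / of_int c)"
    unfolding poly_RP[OF z] Y_def by (simp only: sum_distrib_left)
  finally show ?thesis unfolding J_def Y_def .
qed

lemma moebius_inversion: "moebius (mat2 0 (-1) 1 0) z = - 1 / z"
  by (simp add: moebius_mat2)

text \<open>The resultant argument needs this symmetry for complex l, whereas
  \<open>f_transform\<close> reaches only l = - d / c; hence a separate computation from the
  inversion law of E2.\<close>

lemma RP_inversion:
  assumes z: "z \<in> halfplane" and l: "l \<noteq> 0"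
  shows "z ^ Suc p * poly (RP (- 1 / z)) l = z powi k * (- l) ^ Suc p * poly (RP z) (- 1 / l)"
proof -
  have Imz: "Im z > 0" "z \<noteq> 0" using z by (auto simp: halfplane_def)
  have iz: "- 1 / z \<in> halfplane" using Im_neg_inverse[OF Imz(1)] by (simp add: halfplane_def)
  define Y where "Y = z - (- 1 / l)"
  define X where "X = E2 z * Y + qm_kappa"
  have lY: "l * Y = l * z + 1" using l by (simp add: Y_def distrib_left)
  have zY': "z * (- 1 / z - l) = - l * Y" using Imz(2) by (simp add: right_diff_distrib lY)
  have X': "E2 (- 1 / z) * (- 1 / z - l) + qm_kappa = z * (- l) * X"
  proof -
    define W where "W = - 1 / z - l"
    have zW: "z * W = - (l * Y)" using zY' by (simp add: W_def)
    have "E2 (- 1 / z) * W + qm_kappa = (z * E2 z + qm_kappa) * (z * W) + qm_kappa"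
      unfolding E2_inversion[OF Imz(1)] by (simp add: power2_eq_square algebra_simps)
    also have "\<dots> = - (z * E2 z * (l * Y)) - qm_kappa * (l * Y) + qm_kappa"
      unfolding zW by (simp add: algebra_simps)
    also have "qm_kappa * (l * Y) = qm_kappa * (l * z) + qm_kappa" by (simp add: lY distrib_left)
    also have "- (z * E2 z * (l * Y)) - (qm_kappa * (l * z) + qm_kappa) + qm_kappa = z * (- l) * X"
      by (simp add: X_def algebra_simps)
    finally show ?thesis unfolding W_def .
  qed
  have "z ^ Suc p * poly (RP (- 1 / z)) l = (\<Sum>j\<le>p. z ^ Suc p * ((z powi (k - 2 * int j) * g j z) * (z * (- l) * X) ^ j * (- 1 / z - l) ^ (Suc p - j)))"
    unfolding poly_RP[OF iz] X' sum_distrib_left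
  proof (rule sum.cong)
    fix j assume "j \<in> {..p}"
    then have "g j (- 1 / z) = z powi (k - 2 * int j) * g j z"
      using g_transform[of j 0 0 "-1" 1 z] z by (simp add: moebius_inversion)
    then show "z ^ Suc p * (g j (- 1 / z) * (z * - l * X) ^ j * (- 1 / z - l) ^ (Suc p - j)) =
        z ^ Suc p * (z powi (k - 2 * int j) * g j z * (z * - l * X) ^ j * (- 1 / z - l) ^ (Suc p - j))" by simp
  qed simp
  also have "\<dots> = (\<Sum>j\<le>p. z powi k * (- l) ^ Suc p * (g j z * X ^ j * Y ^ (Suc p - j)))"
  proof (rule sum.cong)
    fix j assume "j \<in> {..p}"
    then have s: "Suc p = j + (Suc p - j)" by auto
    define r where "r = Suc p - j"
    have zs: "z ^ Suc p = z ^ j * z ^ r" and ls: "(- l) ^ Suc p = (- l) ^ j * (- l) ^ r"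
      using s unfolding r_def by (metis power_add)+
    have W: "z ^ r * (- 1 / z - l) ^ r = (- l) ^ r * Y ^ r"
      unfolding power_mult_distrib[symmetric] zY' ..
    have "z ^ Suc p * ((z powi (k - 2 * int j) * g j z) * (z * (- l) * X) ^ j * (- 1 / z - l) ^ r) =
        (z powi (k - 2 * int j) * z ^ j * z ^ j) * (- l) ^ j * (g j z * X ^ j) * (z ^ r * (- 1 / z - l) ^ r)"
      unfolding zs by (simp only: power_mult_distrib mult_ac)
    also have "\<dots> = (z powi (k - 2 * int j) * z ^ j * z ^ j) * (- l) ^ Suc p * (g j z * X ^ j * Y ^ r)"
      unfolding W ls by (simp only: mult_ac)
    finally have "z ^ Suc p * ((z powi (k - 2 * int j) * g j z) * (z * (- l) * X) ^ j * (- 1 / z - l) ^ (Suc p - j)) =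
       (z powi (k - 2 * int j) * z ^ j * z ^ j) * (- l) ^ Suc p * (g j z * X ^ j * Y ^ (Suc p - j))"
      unfolding r_def .
    then show "z ^ Suc p * ((z powi (k - 2 * int j) * g j z) * (z * (- l) * X) ^ j * (- 1 / z - l) ^ (Suc p - j)) =
      z powi k * (- l) ^ Suc p * (g j z * X ^ j * Y ^ (Suc p - j))"
      unfolding cocycle_powers[OF Imz(2)] .
  qed simp
  also have "\<dots> = z powi k * (- l) ^ Suc p * poly (RP z) (- 1 / l)"
    unfolding poly_RP[OF z] X_def Y_def by (simp only: sum_distrib_left)
  finally show ?thesis .
qed

sublocale root_family "qm_coeff G p" "Suc p"
proof
  show "qm_coeff G p i holomorphic_on ball 0 1" for i by (rule qm_coeff_holo[OF G_holo])
  show "\<exists>z\<in>halfplane. qm_coeff G p 0 (qpar z) \<noteq> 0" using f_nonzero f_lead by auto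
  show "poly (RP z) (- 1 / l) = 0" if "z \<in> halfplane" "l \<noteq> 0" "poly (RP (- 1 / z)) l = 0" for z l
  proof -
    have "z \<noteq> 0" using that by (auto simp: halfplane_def)
    then show ?thesis using RP_inversion[OF that(1,2)] that(2,3) by simp
  qed
  \<comment> \<open>The leading coefficient at -1 / z comes from f(-1 / z), and for the inversion -
    d / c is 0.\<close>
  show "poly (RP z) 0 = 0" if "z \<in> halfplane" "qm_coeff G p 0 (qpar (- 1 / z)) = 0" for z
  proof -
    have z: "z \<noteq> 0" "Im z > 0" using that by (auto simp: halfplane_def)
    have "- 1 / z \<in> halfplane" using Im_neg_inverse[OF z(2)] by (simp add: halfplane_def)
    then have "f (- 1 / z) = 0" using that(2) f_lead by simp
    then show ?thesis using f_transform[of 0 0 "-1" 1 z] that(1) z by (simp add: moebius_inversion)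
  qed
qed simp

lemma F_poly_RP: "F z l = poly (RP z) (of_real l)"
  by (simp add: F_def A_def)

lemma f_holo: "f holomorphic_on halfplane"
  by (rule holomorphic_transform[OF holomorphic_on_qpar[OF qm_coeff_holo[of p G 0]]])
     (use G_holo f_lead in auto)

text \<open>By \<open>f_transform\<close>, F and f after the Moebius map differ by powers of x - l
  and J, which have no zeros in the half plane because l is real. The map itself has the
  nonvanishing difference quotient 1 / (J x J z), so it preserves orders.\<close>

lemma zorder_moebius:
  assumes det: "a * d - b * c = 1" and c: "c \<noteq> 0" and z: "z \<in> halfplane"
  shows "zorder f (moebius (mat2 a b c d) z) = zorder (\<lambda>x. F x (- of_int d / of_int c)) z"
proof -
  let ?m = "moebius (mat2 a b c d)"
  define J where "J x = of_int c * x + of_int d" for x :: complex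
  have M: "mat2 a b c d \<in> SL2Z" using det by (simp add: mat2_SL2Z)
  have J0: "J x \<noteq> 0" if "x \<in> halfplane" for x
    unfolding J_def using that by (intro denom_nonzero[OF _ det]) (simp add: halfplane_def)
  have mz: "?m x \<in> halfplane" if "x \<in> halfplane" for x by (rule moebius_halfplane[OF M that])
  have m_holo: "?m holomorphic_on halfplane"
    unfolding moebius_mat2 by (intro holomorphic_intros) (use J0 in \<open>auto simp: J_def\<close>)
  define h where "h = zor_poly f (?m z)"
  define n where "n = nat (zorder f (?m z))"
  note ex = zorder_exist_zero[OF f_holo halfplane_topology(1,2) mz[OF z] f_nonzero, folded h_def n_def]
  have n: "zorder f (?m z) = int n" using conjunct1[OF ex] unfolding n_def by (auto split: if_splits)
  from conjunct2[OF ex] obtain r where r: "r > 0" "cball (?m z) r \<subseteq> halfplane" "h holomorphic_on cball (?m z) r"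
    "\<forall>w\<in>cball (?m z) r. f w = h w * (w - ?m z) ^ n \<and> h w \<noteq> 0" by (elim exE conjE)
  define S where "S = halfplane \<inter> ?m -` ball (?m z) r"
  have S: "open S" "z \<in> S" "S \<subseteq> halfplane"
    unfolding S_def using r(1) z continuous_open_preimage[OF holomorphic_on_imp_continuous_on[OF m_holo] halfplane_topology(1) open_ball]
    by auto
  define l where "l = - real_of_int d / real_of_int c"
  have l: "(of_real l :: complex) = - of_int d / of_int c" by (simp add: l_def)
  have xl: "x - of_real l \<noteq> 0" if "x \<in> halfplane" for x using that by (auto simp: halfplane_def complex_eq_iff)
  define u where "u x = (x - of_real l) ^ Suc p * inverse (J x powi k) * h (?m x) * inverse (J x * J z) ^ n" for x
  have "zorder (\<lambda>x. F x l) z = int n"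
  proof (rule zorder_eqI[where S = S and g = u])
    have "?m ` S \<subseteq> cball (?m z) r" by (auto simp: S_def)
    then have "(\<lambda>x. h (?m x)) holomorphic_on S"
      using holomorphic_on_compose_gen[OF holomorphic_on_subset[OF m_holo S(3)] r(3)] by (simp add: o_def)
    moreover have "J holomorphic_on S" unfolding J_def[abs_def] by (intro holomorphic_intros)
    ultimately show "u holomorphic_on S" unfolding u_def[abs_def]
      using S(3) J0 z by (intro holomorphic_intros) (auto simp: power_int_eq_0_iff)
    show "u z \<noteq> 0" unfolding u_def using xl[OF z] J0[OF z] bspec[OF r(4), of "?m z"] r(1) by (simp add: power_int_eq_0_iff)
    fix x assume x: "x \<in> S" "x \<noteq> z"
    then have xh: "x \<in> halfplane" using S by auto
    have diff: "?m x - ?m z = (x - z) * inverse (J x * J z)"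
    proof -
      have "(of_int a * x + of_int b) * J z - (of_int a * z + of_int b) * J x = of_int (a * d - b * c) * (x - z)"
        by (simp add: J_def algebra_simps)
      then have num: "(of_int a * x + of_int b) * J z - (of_int a * z + of_int b) * J x = x - z" unfolding det by simp
      show ?thesis unfolding moebius_mat2 J_def[symmetric]
        unfolding diff_frac_eq[OF J0[OF xh] J0[OF z]] num by (rule divide_inverse)
    qed
    have "f (?m x) = h (?m x) * ((x - z) * inverse (J x * J z)) ^ n"
      using bspec[OF r(4), of "?m x"] x(1) unfolding diff by (simp add: S_def)
    moreover have "f (?m x) * (x - of_real l) ^ Suc p = J x powi k * F x l"
      using f_transform[OF det c xh] unfolding J_def F_poly_RP l .
    ultimately have "J x powi k * F x l = h (?m x) * ((x - z) * inverse (J x * J z)) ^ n * (x - of_real l) ^ Suc p" by simp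
    moreover have "F x l = inverse (J x powi k) * (J x powi k * F x l)"
      using J0[OF xh] by (simp add: power_int_eq_0_iff)
    ultimately have "F x l = inverse (J x powi k) * (h (?m x) * ((x - z) * inverse (J x * J z)) ^ n * (x - of_real l) ^ Suc p)"
      by simp
    then show "F x l = u x * (x - z) powi int n"
      unfolding u_def power_int_of_nat power_mult_distrib by (simp only: mult_ac)
  qed (use S in auto)
  then show ?thesis using n by (simp add: l_def)
qed

text \<open>Zero on the half of the boundary of the wedge that F omits, so that a weighted sum over
  the whole wedge reduces to F.\<close>

definition wt :: "complex \<Rightarrow> real" where
  "wt z = (if Inner z \<in> fundamental_domain then 1 / of_nat (stab_order (Inner z)) else 0)"

lemma fundamental_domain_wedge:
  assumes "Inner z \<in> fundamental_domain"
  shows "z \<in> wedge" "Re z < 1/2"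
  using assms by (auto simp: fundamental_domain_def wedge_def upper_half_def)

lemma wt_wedge_int: "z \<in> wedge_int \<Longrightarrow> wt z = 1"
  unfolding wt_def using stab_order_wedge_int[of z]
  by (auto simp: fundamental_domain_def wedge_int_def upper_half_def simp del: stab_order.simps)

lemma wt_sixth: "\<exists>m::int. wt z = of_int m / 6"
proof (cases "Inner z \<in> fundamental_domain")
  case True
  \<comment> \<open>Cardinality 0, the default for infinite sets, is covered too: 1 / 0 = 0 is a
    sixth of an integer.\<close>
  from stab_order_le_3[OF fundamental_domain_wedge[OF this]]
  have "stab_order (Inner z) \<in> {0, 1, 2, 3}" by auto
  then consider "wt z = of_int 0 / 6" | "wt z = of_int 6 / 6" | "wt z = of_int 3 / 6" | "wt z = of_int 2 / 6"
    unfolding wt_def using True by (auto simp del: stab_order.simps)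
  then show ?thesis by cases blast+
next
  case False
  then have "wt z = of_int 0 / 6" by (simp add: wt_def)
  then show ?thesis by blast
qed

lemma \<nu>_sixth: "\<exists>m::int. \<nu> wt l = of_int m / 6"
proof -
  obtain m where m: "\<And>z. wt z = of_int (m z) / 6" using wt_sixth by metis
  have "\<nu> wt l = of_int (\<Sum>z | z \<in> wedge \<and> F z l = 0. m z * zorder (\<lambda>z. F z l) z) / 6"
    unfolding \<nu>_def by (simp add: m sum_divide_distrib)
  then show ?thesis by blast
qed

text \<open>Since c is nonzero, the cusp of the translate is the finite point a / c. Among the inner
  points only images of zeros of F contribute, so the sum is finite.\<close>

lemma zero_count_translate_eq:
  assumes det: "a * d - b * c = 1" and c: "c \<noteq> 0"
  shows "zero_count_translate f (mat2 a b c d) = of_nat (cusp_order f) + \<nu> wt (- of_int d / of_int c)"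
proof -
  let ?M = "mat2 a b c d"
  let ?l = "- of_int d / of_int c :: real"
  define h where "h \<tau> = of_int (vanishing_order f \<tau>) / real (stab_order \<tau>)" for \<tau>
  have M: "?M \<in> SL2Z" using det by (simp add: mat2_SL2Z)
  define Z where "Z = {z. Inner z \<in> fundamental_domain \<and> F z ?l = 0}"
  have finZ: "finite Z"
    by (rule finite_subset[OF _ finite_wedge_zeros[of ?l]]) (auto simp: Z_def fundamental_domain_wedge)
  have inner: "h (act ?M (Inner z)) = wt z * of_int (zorder (\<lambda>x. F x ?l) z)" if "Inner z \<in> fundamental_domain" for z
  proof -
    have zh: "z \<in> halfplane" using fundamental_domain_wedge(1)[OF that] wedge_subsets by auto
    show ?thesis using that
      by (simp add: h_def wt_def zorder_moebius[OF det c zh] stab_order_moebius[OF M zh] del: stab_order.simps)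
  qed
  have cusp: "act ?M (Cusp None) = Cusp (Some (Rat.Fract a c))"
    using c by (simp add: proj_def)
  have "zero_count_translate f ?M = infsum h (act ?M ` fundamental_domain)"
    unfolding zero_count_translate_def h_def ..
  also have "\<dots> = infsum h (act ?M ` (insert (Cusp None) (Inner ` Z)))"
  proof (rule infsum_cong_neutral)
    fix \<tau> assume "\<tau> \<in> act ?M ` insert (Cusp None) (Inner ` Z) - act ?M ` fundamental_domain"
    then show "h \<tau> = 0" by (auto simp: Z_def fundamental_domain_def)
  next
    fix \<tau> assume t: "\<tau> \<in> act ?M ` fundamental_domain - act ?M ` insert (Cusp None) (Inner ` Z)"
    then obtain x where x: "x \<in> fundamental_domain" "\<tau> = act ?M x" by blast
    obtain z where z: "x = Inner z"
      using x t by (cases x) (auto simp: fundamental_domain_def)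
    have zf: "Inner z \<in> fundamental_domain" using x z by simp
    have zh: "z \<in> halfplane" using fundamental_domain_wedge(1)[OF zf] wedge_subsets by auto
    have "z \<notin> Z"
    proof
      assume "z \<in> Z"
      then have "\<tau> \<in> act ?M ` insert (Cusp None) (Inner ` Z)" unfolding x(2) z by (intro imageI) simp
      then show False using t by simp
    qed
    then have "F z ?l \<noteq> 0" using zf by (simp add: Z_def)
    then have "zorder (\<lambda>x. F x ?l) z = 0" using zorder_F_pos_iff[OF zh, of ?l] by linarith
    then show "h \<tau> = 0" unfolding x(2) z inner[OF zf] by simp
  qed simp
  also have "\<dots> = sum h (act ?M ` (insert (Cusp None) (Inner ` Z)))"
    using finZ by (intro infsum_finite) auto
  also have "\<dots> = (\<Sum>x\<in>insert (Cusp None) (Inner ` Z). h (act ?M x))"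
  proof (subst sum.reindex)
    show "inj_on (act ?M) (insert (Cusp None) (Inner ` Z))"
    proof (rule inj_onI)
      fix x y assume xy: "x \<in> insert (Cusp None) (Inner ` Z)" "y \<in> insert (Cusp None) (Inner ` Z)" "act ?M x = act ?M y"
      have hp: "z \<in> halfplane" if "z \<in> Z" for z
        using that fundamental_domain_wedge(1) wedge_subsets by (auto simp: Z_def)
      show "x = y"
        using xy hp inj_onD[OF moebius_inj[OF M]] by auto
    qed
  qed simp
  also have "\<dots> = h (act ?M (Cusp None)) + (\<Sum>x\<in>Inner ` Z. h (act ?M x))"
    using finZ by (intro sum.insert) auto
  also have "h (act ?M (Cusp None)) = of_nat (cusp_order f)"
    unfolding cusp h_def vanishing_order_finite_cusp by simp
  also have "(\<Sum>x\<in>Inner ` Z. h (act ?M x)) = (\<Sum>z\<in>Z. h (act ?M (Inner z)))"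
    by (subst sum.reindex) (auto simp: inj_on_def)
  also have "\<dots> = (\<Sum>z\<in>Z. wt z * of_int (zorder (\<lambda>x. F x ?l) z))"
    by (rule sum.cong) (use inner in \<open>auto simp: Z_def\<close>)
  also have "\<dots> = \<nu> wt ?l"
    unfolding \<nu>_def
    by (rule sum.mono_neutral_left[OF finite_wedge_zeros])
       (auto simp: Z_def wt_def fundamental_domain_wedge)
  finally show ?thesis .
qed

text \<open>Every matrix that the choice operator may return has - d / c = l, and the count depends
  only on this quotient.\<close>

lemma zero_count_eq: "zero_count f (Some l) = of_nat (cusp_order f) + \<nu> wt (of_rat l)"
proof -
  obtain x y where xy: "quotient_of l = (x, y)" by (cases "quotient_of l")
  have y: "y > 0" "coprime x y" "l = Rat.Fract x y"
    using quotient_of_denom_pos[OF xy] quotient_of_coprime[OF xy] quotient_of_div[OF xy]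
    by (auto simp: Fract_of_int_quotient)
  obtain u v where uv: "u * x + v * y = 1" using bezout_int[of x y] y(2) by auto
  define M where "M = (SOME A. A \<in> SL2Z \<and> Some l = proj (- vec_nth (vec_nth A 2) 2) (vec_nth (vec_nth A 2) 1))"
  \<comment> \<open>Bezout makes the determinant u x + v y = 1, and the lower row (y, - x) has - d /
    c = x / y.\<close>
  have "mat2 (- u) (- v) y (- x) \<in> SL2Z \<and> Some l = proj (- vec_nth (vec_nth (mat2 (- u) (- v) y (- x)) 2) 2) (vec_nth (vec_nth (mat2 (- u) (- v) y (- x)) 2) 1)"
    using uv y by (simp add: mat2_SL2Z proj_def)
  then have M: "M \<in> SL2Z \<and> Some l = proj (- vec_nth (vec_nth M 2) 2) (vec_nth (vec_nth M 2) 1)"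
    unfolding M_def by (rule someI)
  obtain a b c d where M2: "M = mat2 a b c d" "a * d - b * c = 1" using SL2Z_cases[of M] M by blast
  have c: "c \<noteq> 0" "l = Rat.Fract (- d) c" using M unfolding M2(1) by (auto simp: proj_def split: if_splits)
  have "(of_rat l :: real) = - of_int d / of_int c" using c by (simp add: of_rat_rat)
  then show ?thesis
    unfolding zero_count_def M_def[symmetric] M2(1) zero_count_translate_eq[OF M2(2) c(1)] by simp
qed

end

theorem theorem1p2:
  fixes f :: "complex \<Rightarrow> complex" and k :: int and p :: nat
  assumes "quasimodular_form k p f"
    and "\<exists>\<tau>\<in>upper_half. f \<tau> \<noteq> 0"
  shows "\<exists>(\<I> :: real set set) (N :: real set \<Rightarrow> real).
           finite \<I> \<and> pairwise disjnt \<I> \<and> (\<forall>I\<in>\<I>. is_interval I) \<and> \<Union>\<I> = UNIV \<and>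
           (\<forall>I\<in>\<I>. (\<exists>m::int. N I = of_int m / 6) \<and>
              (\<forall>l::rat. of_rat l \<in> I \<longrightarrow> zero_count f (Some l) = N I))"
proof -
  obtain g where g: "quasimodular_decomp k p g f" using assms(1) unfolding quasimodular_form_def by blast
  then have gm: "modular_form (k - 2 * int j) (g j)" if "j \<le> p" for j
    using that by (simp add: quasimodular_decomp_def)
  have "\<forall>j. \<exists>G. j \<le> p \<longrightarrow> G holomorphic_on ball 0 1 \<and> (\<forall>z\<in>halfplane. g j z = G (qpar z))"
    using modular_form_q_series[OF gm] by metis
  then obtain G where G: "\<And>j. j \<le> p \<Longrightarrow> G j holomorphic_on ball 0 1 \<and> (\<forall>z\<in>halfplane. g j z = G j (qpar z))"
    by metis
  interpret qm_decomp k p g f G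
  proof
    show "f z = (\<Sum>j\<le>p. g j z * E2 z ^ j)" if "z \<in> halfplane" for z
      using g that halfplane_topology(3) by (simp add: quasimodular_decomp_def)
    show "\<exists>z\<in>halfplane. f z \<noteq> 0" using assms(2) halfplane_topology(3) by simp
  qed (use gm G in auto)
  obtain B m where B: "finite B" "\<And>z l. z \<in> boundary_zeros \<Longrightarrow> l \<notin> B \<Longrightarrow> zorder (\<lambda>z. F z l) z = m z"
    using boundary_orders by blast
  have "\<exists>\<delta>>0. \<forall>y. \<bar>y - x\<bar> < \<delta> \<longrightarrow> \<nu> wt y = \<nu> wt x" if "x \<notin> B" for x
    by (rule \<nu>_locally_constant[OF B(1) _ that, of m wt]) (use B(2) wt_wedge_int in auto)
  from finite_interval_partition[OF B(1) this] obtain \<I> :: "real set set"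
    where \<I>: "finite \<I>" "pairwise disjnt \<I>" "\<forall>I\<in>\<I>. is_interval I" "\<Union>\<I> = UNIV"
      "\<And>I x y. I \<in> \<I> \<Longrightarrow> x \<in> I \<Longrightarrow> y \<in> I \<Longrightarrow> \<nu> wt x = \<nu> wt y" by blast
  \<comment> \<open>The count \<open>\<nu> wt\<close> is defined at every real parameter, so any
    point of the cell, rational or not, may represent it, and the value is still an integer multiple
    of 1/6.\<close>
  define N where "N I = of_nat (cusp_order f) + \<nu> wt (SOME x. x \<in> I)" for I
  have "\<exists>m::int. N I = of_int m / 6" for I
  proof -
    obtain m :: int where "\<nu> wt (SOME x. x \<in> I) = of_int m / 6" using \<nu>_sixth by blast
    then have "N I = of_int (6 * int (cusp_order f) + m) / 6" by (simp add: N_def add_divide_distrib)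
    then show ?thesis by blast
  qed
  moreover have "zero_count f (Some l) = N I" if "I \<in> \<I>" "of_rat l \<in> I" for I l
    unfolding zero_count_eq N_def using \<I>(5)[OF that(1,2) someI[of "\<lambda>x. x \<in> I", OF that(2)]] by simp
  ultimately show ?thesis using \<I>(1-4) by (intro exI[of _ \<I>] exI[of _ N]) auto
qed

end
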